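(* Let $A$ be a stratified set which has the right lifting property with respect to every inner elementary anodyne extension except possibly $\Delta^1[2]'\subseteq\Delta^1[2]''$. Suppose that the thin $1$-simplices of $A$ are exactly the $1$-simplices $v$ for which there exists a stratified map $f:\mathrm{th}_1(\tilde E_2)\to A$ with $f(e^-_1)=v$. Then $A$ is a weak complicial set.
   Context: A stratified set is a simplicial set with a set of thin simplices containing every degenerate simplex and no $0$-simplex; stratified maps preserve thinness. For $n\ge1$, $0\le k\le n$: $\Delta^k[n]$ is $\Delta[n]$ with $\alpha:[r]\to[n]$ thin iff degenerate or $\mathrm{im}(\alpha)\supseteq\{k-1,k,k+1\}\cap[n]$; $\Lambda^k[n]$ is the regular subset (thin simplices those thin in $\Delta^k[n]$) of $\alpha$ with $\mathrm{im}(\alpha)\cup\{k\}\ne[n]$; $\Delta^k[n]'$ (resp. $\Delta^k[n]''$) is $\Delta^k[n]$ with additionally the $(n-1)$-faces $\delta_i$, $i\ne k$ (resp. all $(n-1)$-faces) thin. Elementary anodyne extensions: $\Lambda^k[n]\subseteq\Delta^k[n]$ ($n\ge1$) and $\Delta^k[n]'\subseteq\Delta^k[n]''$ ($n\ge2$); inner if $0<k<n$. A weak complicial set is a stratified set with the right lifting property against all elementary anodyne extensions. $E$ is the simplicial set whose $m$-simplices are arbitrary functions $[m]\to\{-,+\}$ (words), operators acting by precomposition; $e^-_1$ is the $1$-simplex $-+$; $E_2$ is the simplicial subset of $E$ generated by the $2$-simplices $-+-$ and $+-+$; $\tilde E_2$ is its underlying simplicial set with only degenerate simplices thin; $\mathrm{th}_1(\tilde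 E_2)$ is $\tilde E_2$ with all simplices of dimension $>1$ made thin. *)

theory Defs
  imports Main
begin

text \<open>An operator alpha : [m] -> [n] is a weakly monotone function on {0..m} with values
  in {0..n}; it is represented by a function nat => nat that is 0 outside {0..m}
  (extensional representation).\<close>

definition ops :: "nat \<Rightarrow> nat \<Rightarrow> (nat \<Rightarrow> nat) set" where
  "ops m n = {\<alpha>. (\<forall>i\<le>m. \<alpha> i \<le> n) \<and> (\<forall>i j. i \<le> j \<and> j \<le> m \<longrightarrow> \<alpha> i \<le> \<alpha> j)
                 \<and> (\<forall>i>m. \<alpha> i = 0)}"

definition opcomp :: "nat \<Rightarrow> (nat \<Rightarrow> nat) \<Rightarrow> (nat \<Rightarrow> nat) \<Rightarrow> (nat \<Rightarrow> nat)" where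
  "opcomp k \<beta> \<alpha> = (\<lambda>i. if i \<le> k then \<alpha> (\<beta> i) else 0)"

definition idop :: "nat \<Rightarrow> (nat \<Rightarrow> nat)" where
  "idop n = (\<lambda>i. if i \<le> n then i else 0)"

definition face :: "nat \<Rightarrow> nat \<Rightarrow> (nat \<Rightarrow> nat)" where
  "face n i = (\<lambda>j. if j \<le> n - 1 then (if j < i then j else j + 1) else 0)"

text \<open>Simp X n is the set of n-simplices; Act X m n alpha x is x.alpha for
  x an n-simplex and alpha : [m] -> [n].\<close>
record 'a sset =
  Simp :: "nat \<Rightarrow> 'a set"
  Act :: "nat \<Rightarrow> nat \<Rightarrow> (nat \<Rightarrow> nat) \<Rightarrow> 'a \<Rightarrow> 'a"

record 'a strat = "'a sset" +
  Thin :: "nat \<Rightarrow> 'a set"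

definition simplicial_set :: "('a, 'z) sset_scheme \<Rightarrow> bool" where
  "simplicial_set X \<longleftrightarrow>
     (\<forall>m n \<alpha> x. \<alpha> \<in> ops m n \<and> x \<in> Simp X n \<longrightarrow> Act X m n \<alpha> x \<in> Simp X m) \<and>
     (\<forall>n x. x \<in> Simp X n \<longrightarrow> Act X n n (idop n) x = x) \<and>
     (\<forall>k m n \<alpha> \<beta> x. \<alpha> \<in> ops m n \<and> \<beta> \<in> ops k m \<and> x \<in> Simp X n \<longrightarrow>
        Act X k n (opcomp k \<beta> \<alpha>) x = Act X k m \<beta> (Act X m n \<alpha> x))"

definition degenerate :: "('a, 'z) sset_scheme \<Rightarrow> nat \<Rightarrow> 'a \<Rightarrow> bool" where
  "degenerate X n x \<longleftrightarrow> (\<exists>m \<sigma> y. m < n \<and> \<sigma> \<in> ops n m \<and> \<sigma> ` {0..n} = {0..m} \<and>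
        y \<in> Simp X m \<and> x = Act X n m \<sigma> y)"

definition stratified_set :: "'a strat \<Rightarrow> bool" where
  "stratified_set X \<longleftrightarrow> simplicial_set X \<and> (\<forall>n. Thin X n \<subseteq> Simp X n) \<and>
     (\<forall>n x. x \<in> Simp X n \<and> degenerate X n x \<longrightarrow> x \<in> Thin X n) \<and> Thin X 0 = {}"

definition strat_map :: "'a strat \<Rightarrow> 'b strat \<Rightarrow> (nat \<Rightarrow> 'a \<Rightarrow> 'b) \<Rightarrow> bool" where
  "strat_map X Y f \<longleftrightarrow>
     (\<forall>n x. x \<in> Simp X n \<longrightarrow> f n x \<in> Simp Y n) \<and>
     (\<forall>m n \<alpha> x. \<alpha> \<in> ops m n \<and> x \<in> Simp X n \<longrightarrow> f m (Act X m n \<alpha> x) = Act Y m n \<alpha> (f n x)) \<and>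
     (\<forall>n x. x \<in> Thin X n \<longrightarrow> f n x \<in> Thin Y n)"

text \<open>Right lifting property of A against the inclusion U \<subseteq> V (U a stratified subset of V).\<close>
definition rlp :: "'a strat \<Rightarrow> 'b strat \<Rightarrow> 'b strat \<Rightarrow> bool" where
  "rlp A U V \<longleftrightarrow> (\<forall>f. strat_map U A f \<longrightarrow>
      (\<exists>g. strat_map V A g \<and> (\<forall>n x. x \<in> Simp U n \<longrightarrow> g n x = f n x)))"

definition stdsimp :: "nat \<Rightarrow> (nat \<Rightarrow> nat) sset" where
  "stdsimp n = \<lparr>Simp = (\<lambda>m. ops m n), Act = (\<lambda>m m' \<alpha> x. opcomp m \<alpha> x)\<rparr>"

definition DeltaK :: "nat \<Rightarrow> nat \<Rightarrow> (nat \<Rightarrow> nat) strat" where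
  "DeltaK n k = \<lparr>Simp = (\<lambda>m. ops m n), Act = (\<lambda>m m' \<alpha> x. opcomp m \<alpha> x),
     Thin = (\<lambda>m. {\<alpha> \<in> ops m n. degenerate (stdsimp n) m \<alpha> \<or>
                                 {k - 1, k, k + 1} \<inter> {0..n} \<subseteq> \<alpha> ` {0..m}})\<rparr>"

text \<open>Lambda^k[n] (note k - 1 = 0 for k = 0 in nat, which is harmless here)\<close>
definition HornK :: "nat \<Rightarrow> nat \<Rightarrow> (nat \<Rightarrow> nat) strat" where
  "HornK n k = \<lparr>Simp = (\<lambda>m. {\<alpha> \<in> ops m n. \<alpha> ` {0..m} \<union> {k} \<noteq> {0..n}}),
     Act = (\<lambda>m m' \<alpha> x. opcomp m \<alpha> x),
     Thin = (\<lambda>m. {\<alpha> \<in> Thin (DeltaK n k) m. \<alpha> ` {0..m} \<union> {k} \<noteq> {0..n}})\<rparr>"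

definition DeltaK' :: "nat \<Rightarrow> nat \<Rightarrow> (nat \<Rightarrow> nat) strat" where
  "DeltaK' n k = DeltaK n k\<lparr>Thin := (\<lambda>m. Thin (DeltaK n k) m \<union>
      (if m = n - 1 then {face n i | i. i \<le> n \<and> i \<noteq> k} else {}))\<rparr>"

definition DeltaK'' :: "nat \<Rightarrow> nat \<Rightarrow> (nat \<Rightarrow> nat) strat" where
  "DeltaK'' n k = DeltaK n k\<lparr>Thin := (\<lambda>m. Thin (DeltaK n k) m \<union>
      (if m = n - 1 then {face n i | i. i \<le> n} else {}))\<rparr>"

definition weak_complicial :: "'a strat \<Rightarrow> bool" where
  "weak_complicial A \<longleftrightarrow> stratified_set A \<and>
     (\<forall>n k. 1 \<le> n \<and> k \<le> n \<longrightarrow> rlp A (HornK n k) (DeltaK n k)) \<and>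
     (\<forall>n k. 2 \<le> n \<and> k \<le> n \<longrightarrow> rlp A (DeltaK' n k) (DeltaK'' n k))"

text \<open>An m-simplex of E is a word [m] -> {-,+}, encoded as nat => bool (False = -, True = +),
  False outside {0..m}.\<close>
definition actE :: "nat \<Rightarrow> nat \<Rightarrow> (nat \<Rightarrow> nat) \<Rightarrow> (nat \<Rightarrow> bool) \<Rightarrow> (nat \<Rightarrow> bool)" where
  "actE m n \<alpha> w = (\<lambda>i. if i \<le> m then w (\<alpha> i) else False)"

definition wordE :: "nat \<Rightarrow> (nat \<Rightarrow> bool) set" where
  "wordE m = {w. \<forall>i>m. w i = False}"

definition mpm :: "nat \<Rightarrow> bool" where "mpm = (\<lambda>i. i = 1)"
definition pmp :: "nat \<Rightarrow> bool" where "pmp = (\<lambda>i. i = 0 \<or> i = 2)"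

definition e1minus :: "nat \<Rightarrow> bool" where "e1minus = (\<lambda>i. i = 1)"

definition E2 :: "(nat \<Rightarrow> bool) sset" where
  "E2 = \<lparr>Simp = (\<lambda>m. {actE m 2 \<alpha> w | \<alpha> w. \<alpha> \<in> ops m 2 \<and> w \<in> {mpm, pmp}}), Act = actE\<rparr>"

definition th1E2 :: "(nat \<Rightarrow> bool) strat" where
  "th1E2 = \<lparr>Simp = Simp E2, Act = actE,
     Thin = (\<lambda>m. {x \<in> Simp E2 m. degenerate E2 m x \<or> 1 < m})\<rparr>"

end

theory Submission
  imports Defs
begin

text \<open>
  A thin 1-simplex v comes with an inverse w and two thin 2-simplices witnessing that both composites
  are degenerate. Consider a left outer horn with vertices -, + and a simplex \<Delta> opposite them.
  Its restriction to the boundary of \<Delta> is an edge e from - to + in the slice of A over that boundary. The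
  slice projects to A by a right fibration, so the inverse of the underlying 1-simplex of e lifts to a
  one-sided inverse of e, and then by associativity to a genuine inverse x with a thin triangle
  - + - in the slice. The inner horn + - \<Delta> can be filled, and after that the inner horn - + - \<Delta>,
  one face of which fills the given outer horn. The extensions that only concern thinness follow in the same
  way, or in dimension 2 from the two-out-of-three property of invertible 1-simplices. Right outer
  extensions follow by passing to the opposite stratified set.
\<close>

section \<open>Operators and maps on subcomplexes of an infinite simplex\<close>

text \<open>Every filler must come from a horn whose pivot has neighbours on both sides. This is why
  the new vertices are put in front of \<Delta>: a triangle 0 1 2 of the slice that lacks its edge
  01 is an outer horn there, but in A the pivot 2 lies between 1 and \<Delta>. Only the horn with
  edges 12 and 02 lifts in this way, so just one of the two triangles of an inverse pair can be
  lifted; the other is won by lifting once more from the inverse and comparing. Thinness of the face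
  opposite a pivot is therefore derived only for simplices with at least four vertices. A triangle
  over a nonempty face of \<Delta> has enough of them, whereas over the empty face the thinness of
  the lifted edge is that of the chosen inverse in A. Subcomplexes are families of finite sets of
  natural numbers rather than subsets of one standard simplex, because vertices have to be added,
  doubled and dropped while the others keep their names.\<close>

text \<open>Simplices of the simplex on the vertex set of all natural numbers: operators [m] -> [n] for
  arbitrary n.\<close>

definition Ops :: "nat \<Rightarrow> (nat \<Rightarrow> nat) set" where
  "Ops m = {\<alpha>. (\<forall>i j. i \<le> j \<and> j \<le> m \<longrightarrow> \<alpha> i \<le> \<alpha> j) \<and> (\<forall>i>m. \<alpha> i = 0)}"

lemma ops_eq_Ops: "ops m n = {\<alpha> \<in> Ops m. \<alpha> ` {0..m} \<subseteq> {0..n}}"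
  by (fastforce simp: ops_def Ops_def image_subset_iff)

lemma opcomp_in_Ops: "\<beta> \<in> ops k m \<Longrightarrow> \<alpha> \<in> Ops m \<Longrightarrow> opcomp k \<beta> \<alpha> \<in> Ops k"
  by (auto simp: Ops_def ops_def opcomp_def)

lemma opcomp_mono_in_Ops: "mono \<phi> \<Longrightarrow> \<alpha> \<in> Ops m \<Longrightarrow> opcomp m \<alpha> \<phi> \<in> Ops m"
  by (auto simp: Ops_def opcomp_def mono_def)

lemma image_opcomp: "opcomp k \<beta> \<alpha> ` {0..k} = \<alpha> ` \<beta> ` {0..k}"
  by (auto simp: opcomp_def image_image)

lemma image_ops_le: "\<beta> \<in> ops k m \<Longrightarrow> \<beta> ` {0..k} \<subseteq> {0..m}"
  by (auto simp: ops_def)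

lemma image_opcomp_subset: "\<beta> \<in> ops k m \<Longrightarrow> opcomp k \<beta> \<alpha> ` {0..k} \<subseteq> \<alpha> ` {0..m}"
  using image_ops_le unfolding image_opcomp by (blast intro: image_mono)

lemma opcomp_assoc:
  "\<beta> \<in> ops k m \<Longrightarrow> opcomp k \<beta> (opcomp m \<alpha> \<phi>) = opcomp k (opcomp k \<beta> \<alpha>) \<phi>"
  by (auto simp: ops_def opcomp_def fun_eq_iff)

lemma opcomp_twice: "opcomp m (opcomp m \<alpha> \<psi>) \<phi> = opcomp m \<alpha> (\<phi> \<circ> \<psi>)"
  by (auto simp: opcomp_def fun_eq_iff)

lemma opcomp_cong: "(\<And>x. x \<in> \<alpha> ` {0..m} \<Longrightarrow> \<phi> x = \<psi> x) \<Longrightarrow> opcomp m \<alpha> \<phi> = opcomp m \<alpha> \<psi>"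
  by (auto simp: opcomp_def fun_eq_iff)

lemma opcomp_id: "\<alpha> \<in> Ops m \<Longrightarrow> (\<And>x. x \<in> \<alpha> ` {0..m} \<Longrightarrow> \<phi> x = x) \<Longrightarrow> opcomp m \<alpha> \<phi> = \<alpha>"
  by (auto simp: opcomp_def fun_eq_iff Ops_def)

lemma ops_opcomp: "\<alpha> \<in> ops m n \<Longrightarrow> \<beta> \<in> ops k m \<Longrightarrow> opcomp k \<beta> \<alpha> \<in> ops k n"
  by (auto simp: ops_def opcomp_def)

lemma face_in_ops: "1 \<le> n \<Longrightarrow> i \<le> n \<Longrightarrow> face n i \<in> ops (n - 1) n"
  by (auto simp: ops_def face_def)

lemma image_face: assumes "1 \<le> n" "i \<le> n" shows "face n i ` {0..n - 1} = {0..n} - {i}"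
proof -
  have "x \<in> face n i ` {0..n-1}" if "x \<le> n" "x \<noteq> i" for x
  proof (cases "x < i")
    case True then have "x = face n i x" "x \<in> {0..n-1}" using assms by (auto simp: face_def)
    then show ?thesis by blast
  next
    case False then have "x = face n i (x - 1)" "x - 1 \<in> {0..n-1}" using that by (auto simp: face_def)
    then show ?thesis by blast
  qed
  moreover have "face n i ` {0..n-1} \<subseteq> {0..n} - {i}" using assms by (auto simp: face_def)
  ultimately show ?thesis by fastforce
qed

section \<open>Degeneracy detected by a repeated vertex\<close>

definition repeat_op :: "nat \<Rightarrow> nat \<Rightarrow> nat \<Rightarrow> nat" where
  "repeat_op m i = (\<lambda>j. if j \<le> m then (if j = Suc i then i else j) else 0)"

lemma repeat_op_in_ops: "i < m \<Longrightarrow> repeat_op m i \<in> ops m m"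
  by (auto simp: ops_def repeat_op_def)

lemma opcomp_repeat_op: "\<alpha> \<in> Ops m \<Longrightarrow> \<alpha> (Suc i) = \<alpha> i \<Longrightarrow> i < m \<Longrightarrow> opcomp m (repeat_op m i) \<alpha> = \<alpha>"
  by (auto simp: Ops_def opcomp_def repeat_op_def fun_eq_iff)

definition degen_op :: "nat \<Rightarrow> nat \<Rightarrow> nat \<Rightarrow> nat" where
  "degen_op m i = (\<lambda>j. if j \<le> m then (if j \<le> i then j else j - 1) else 0)"

lemma degen_op_in_ops: "i < m \<Longrightarrow> degen_op m i \<in> ops m (m - 1)"
  by (auto simp: ops_def degen_op_def)

lemma image_degen_op: "i < m \<Longrightarrow> degen_op m i ` {0..m} = {0..m-1}"
proof -
  assume i: "i < m"
  have "x \<in> degen_op m i ` {0..m}" if "x \<le> m - 1" for x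
  proof (cases "x \<le> i")
    case True then have "x = degen_op m i x" "x \<in> {0..m}" using i by (auto simp: degen_op_def)
    then show ?thesis by blast
  next
    case False then have "x = degen_op m i (Suc x)" "Suc x \<in> {0..m}" using that i by (auto simp: degen_op_def)
    then show ?thesis by blast
  qed
  moreover have "degen_op m i ` {0..m} \<subseteq> {0..m-1}" using i by (auto simp: degen_op_def)
  ultimately show ?thesis by fastforce
qed

lemma repeat_op_factor: "i < m \<Longrightarrow> repeat_op m i = opcomp m (degen_op m i) (face m (Suc i))"
  by (auto simp: repeat_op_def opcomp_def degen_op_def face_def fun_eq_iff)

text \<open>A simplex fixed by the idempotent \<open>repeat_op m i\<close> is the degeneracy
  \<open>degen_op m i\<close> of its own face opposite the vertex i + 1. This turns degeneracy into
  an equation, which is easier to transport along maps than the existential definition.\<close>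

lemma degenerate_if_repeat:
  assumes X: "simplicial_set X" and x: "x \<in> Simp X m" and i: "i < m"
    and eq: "Act X m m (repeat_op m i) x = x"
  shows "degenerate X m x"
proof -
  have f: "face m (Suc i) \<in> ops (m-1) m" using i by (intro face_in_ops) auto
  have "Act X m (m-1) (degen_op m i) (Act X (m-1) m (face m (Suc i)) x) = x"
    using X f degen_op_in_ops[OF i] x eq unfolding repeat_op_factor[OF i] simplicial_set_def by metis
  moreover have "Act X (m-1) m (face m (Suc i)) x \<in> Simp X (m-1)"
    using X f x unfolding simplicial_set_def by metis
  ultimately show ?thesis unfolding degenerate_def
    using i degen_op_in_ops[OF i] image_degen_op[OF i]
    by (intro exI[of _ "m-1"] exI[of _ "degen_op m i"] exI[of _ "Act X (m-1) m (face m (Suc i)) x"]) auto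
qed

lemma repeat_if_not_inj:
  assumes a: "\<alpha> \<in> Ops m" and "\<not> inj_on \<alpha> {0..m}"
  shows "\<exists>i<m. \<alpha> (Suc i) = \<alpha> i"
proof -
  obtain i j where ij: "i < j" "j \<le> m" "\<alpha> i = \<alpha> j"
    using assms(2) unfolding inj_on_def by (metis atLeastAtMost_iff linorder_neqE_nat)
  have mon: "\<And>i j. i \<le> j \<Longrightarrow> j \<le> m \<Longrightarrow> \<alpha> i \<le> \<alpha> j" using a by (auto simp: Ops_def)
  have "\<alpha> i \<le> \<alpha> (Suc i)" "\<alpha> (Suc i) \<le> \<alpha> j" using mon[of i "Suc i"] mon[of "Suc i" j] ij by auto
  then show ?thesis using ij by (intro exI[of _ i]) auto
qed

lemma simplicial_set_stdsimp: "simplicial_set (stdsimp n)"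
  unfolding simplicial_set_def stdsimp_def
  by (auto simp: ops_opcomp opcomp_assoc) (auto simp: opcomp_def idop_def ops_def fun_eq_iff)

text \<open>A surjection onto fewer points is not injective, and a monotone map that is not
  injective already repeats a value at two neighbouring places.\<close>

lemma degenerate_stdsimp_iff:
  assumes "\<alpha> \<in> ops m n"
  shows "degenerate (stdsimp n) m \<alpha> \<longleftrightarrow> (\<exists>i<m. \<alpha> (Suc i) = \<alpha> i)"
proof
  assume "degenerate (stdsimp n) m \<alpha>"
  then obtain l \<sigma> y where *: "l < m" "\<sigma> \<in> ops m l" "\<sigma> ` {0..m} = {0..l}" "\<alpha> = opcomp m \<sigma> y"
    unfolding degenerate_def by (auto simp: stdsimp_def)
  have "\<not> inj_on \<sigma> {0..m}" using card_image[of \<sigma> "{0..m}"] *(1,3) by auto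
  then obtain i where "i < m" "\<sigma> (Suc i) = \<sigma> i"
    using repeat_if_not_inj[of \<sigma> m] *(2) by (auto simp: ops_eq_Ops)
  then show "\<exists>i<m. \<alpha> (Suc i) = \<alpha> i" using *(4) by (intro exI[of _ i]) (auto simp: opcomp_def)
next
  assume "\<exists>i<m. \<alpha> (Suc i) = \<alpha> i"
  then obtain i where i: "i < m" "\<alpha> (Suc i) = \<alpha> i" by blast
  have "opcomp m (repeat_op m i) \<alpha> = \<alpha>" using opcomp_repeat_op i assms by (auto simp: ops_eq_Ops)
  then show "degenerate (stdsimp n) m \<alpha>"
    using degenerate_if_repeat[OF simplicial_set_stdsimp, of \<alpha> n m i] assms i by (auto simp: stdsimp_def)
qed

text \<open>Both directions must be monotone on all natural numbers, since relabellings are applied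
  as global vertex maps: \<iota> is continued as a constant beyond n, and \<rho> counts the members
  of S below its argument even when the argument is not in S.\<close>

lemma enumeration:
  assumes "finite S" "card S = Suc n"
  obtains \<iota> :: "nat \<Rightarrow> nat" and \<rho> :: "nat \<Rightarrow> nat" where "mono \<iota>" "mono \<rho>" "\<iota> ` {0..n} = S"
    "\<rho> ` S = {0..n}" "\<And>i. i \<le> n \<Longrightarrow> \<rho> (\<iota> i) = i" "\<And>x. x \<in> S \<Longrightarrow> \<iota> (\<rho> x) = x"
proof -
  define xs where "xs = sorted_list_of_set S"
  have xs: "sorted xs" "distinct xs" "set xs = S" "length xs = Suc n"
    using assms by (auto simp: xs_def)
  define \<iota> where "\<iota> i = xs ! (min i n)" for i
  define \<rho> where "\<rho> x = card {y \<in> S. y < x}" for x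
  have m: "mono \<iota>" unfolding mono_def \<iota>_def using xs by (auto intro!: sorted_nth_mono)
  have "\<iota> ` {0..n} = (!) xs ` {0..<length xs}"
    using xs(4) by (intro image_cong) (auto simp: \<iota>_def)
  then have im: "\<iota> ` {0..n} = S" using xs(3) by (simp add: nth_image[of "length xs" xs, simplified])
  have rho: "\<rho> (\<iota> i) = i" if "i \<le> n" for i
  proof -
    have "{y \<in> S. y < \<iota> i} = (!) xs ` {..<i}"
    proof safe
      fix y assume y: "y \<in> S" "y < \<iota> i"
      then obtain j where j: "j < Suc n" "y = xs ! j" using xs by (auto simp: in_set_conv_nth)
      have "j < i"
      proof (rule ccontr)
        assume "\<not> j < i" then have "xs ! i \<le> xs ! j" using xs j by (intro sorted_nth_mono) auto
        then show False using y j that by (auto simp: \<iota>_def min_def)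
      qed
      then show "y \<in> (!) xs ` {..<i}" using j by auto
    next
      fix j assume j: "j < i"
      show "xs ! j \<in> S" using xs(3,4) j that by (auto simp: set_conv_nth)
      have "xs ! j \<le> xs ! i" using xs j that by (intro sorted_nth_mono) auto
      moreover have "xs ! j \<noteq> xs ! i" using xs j that by (simp add: nth_eq_iff_index_eq)
      ultimately show "xs ! j < \<iota> i" using that by (auto simp: \<iota>_def)
    qed
    moreover have "inj_on ((!) xs) {..<i}" using xs that by (auto intro!: inj_onI simp: nth_eq_iff_index_eq)
    ultimately show ?thesis by (simp add: \<rho>_def card_image)
  qed
  have mr: "mono \<rho>" unfolding mono_def \<rho>_def using assms(1) by (auto intro!: card_mono)
  have ir: "\<iota> (\<rho> x) = x" if "x \<in> S" for x using that rho im by auto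
  have "\<rho> ` S = {0..n}" unfolding im[symmetric] image_image using rho by auto
  then show thesis using that m mr im rho ir by blast
qed

section \<open>Partially defined maps on complexes of vertex sets\<close>

type_synonym 'a opfun = "nat \<Rightarrow> (nat \<Rightarrow> nat) \<Rightarrow> 'a"

text \<open>A simplicial complex on the natural numbers. The empty set is exempt because the image
  of an operator is never empty.\<close>

definition dclosed :: "nat set set \<Rightarrow> bool" where
  "dclosed U \<longleftrightarrow> (\<forall>S\<in>U. \<forall>T\<subseteq>S. T \<noteq> {} \<longrightarrow> T \<in> U)"

lemma dclosedD: "dclosed U \<Longrightarrow> S \<in> U \<Longrightarrow> T \<subseteq> S \<Longrightarrow> T \<noteq> {} \<Longrightarrow> T \<in> U"
  by (auto simp: dclosed_def)

text \<open>Maps on a complex are total functions with unspecified values elsewhere, so this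
  relation takes the place of equality.\<close>

definition agree :: "nat set set \<Rightarrow> 'a opfun \<Rightarrow> 'a opfun \<Rightarrow> bool" where
  "agree U F G \<longleftrightarrow> (\<forall>m. \<forall>\<alpha>\<in>Ops m. \<alpha> ` {0..m} \<in> U \<longrightarrow> F m \<alpha> = G m \<alpha>)"

definition pull :: "(nat \<Rightarrow> nat) \<Rightarrow> 'a opfun \<Rightarrow> nat \<Rightarrow> (nat \<Rightarrow> nat) \<Rightarrow> 'a" where
  "pull \<phi> F = (\<lambda>m \<alpha>. F m (opcomp m \<alpha> \<phi>))"

lemma agree_sym: "agree U F G \<Longrightarrow> agree U G F" by (auto simp: agree_def)
lemma agree_refl: "agree U F F" by (auto simp: agree_def)
lemma agree_trans: "agree U F G \<Longrightarrow> agree U G H \<Longrightarrow> agree U F H" by (auto simp: agree_def)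
lemma agree_mono: "agree U F G \<Longrightarrow> V \<subseteq> U \<Longrightarrow> agree V F G" by (auto simp: agree_def)

text \<open>Precomposition with \<psi> carries an equation on V back to U. The maps \<theta>1 and
  \<theta>2 are compared with the composites only on vertices that occur, so they may be chosen
  conveniently elsewhere.\<close>

lemma agree_pull:
  assumes "agree V (pull \<phi>1 H1) (pull \<phi>2 H2)" "mono \<psi>" "\<And>S. S \<in> U \<Longrightarrow> \<psi> ` S \<in> V"
    "\<And>S x. S \<in> U \<Longrightarrow> x \<in> S \<Longrightarrow> \<theta>1 x = \<phi>1 (\<psi> x) \<and> \<theta>2 x = \<phi>2 (\<psi> x)"
  shows "agree U (pull \<theta>1 H1) (pull \<theta>2 H2)"
  unfolding agree_def
proof safe
  fix m \<alpha> assume a: "\<alpha> \<in> Ops m" "\<alpha> ` {0..m} \<in> U"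
  have "opcomp m \<alpha> \<theta>1 = opcomp m (opcomp m \<alpha> \<psi>) \<phi>1" "opcomp m \<alpha> \<theta>2 = opcomp m (opcomp m \<alpha> \<psi>) \<phi>2"
    using assms(4)[OF a(2)] by (auto simp: opcomp_twice intro!: opcomp_cong)
  moreover have "opcomp m \<alpha> \<psi> \<in> Ops m" "opcomp m \<alpha> \<psi> ` {0..m} \<in> V"
    using opcomp_mono_in_Ops assms(2,3) a by (auto simp: image_opcomp)
  ultimately show "pull \<theta>1 H1 m \<alpha> = pull \<theta>2 H2 m \<alpha>"
    using assms(1) unfolding agree_def pull_def by auto
qed

lemma pull_id: "agree U (pull id F) F"
  unfolding agree_def pull_def by (simp add: opcomp_id)

lemma pull_pull: "pull \<psi> (pull \<phi> F) = pull (\<phi> \<circ> \<psi>) F"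
  by (simp add: pull_def opcomp_twice)

section \<open>Maps from such complexes to a stratified set\<close>

locale stratified =
  fixes A :: "'a strat"
  assumes strat: "stratified_set A"
begin

lemma simplicial: "simplicial_set A" using strat by (auto simp: stratified_set_def)

lemma Act_in: "\<alpha> \<in> ops m n \<Longrightarrow> x \<in> Simp A n \<Longrightarrow> Act A m n \<alpha> x \<in> Simp A m"
  using simplicial unfolding simplicial_set_def by blast

lemma Act_id: "x \<in> Simp A n \<Longrightarrow> Act A n n (idop n) x = x"
  using simplicial unfolding simplicial_set_def by blast

lemma Act_opcomp: "\<alpha> \<in> ops m n \<Longrightarrow> \<beta> \<in> ops k m \<Longrightarrow> x \<in> Simp A n \<Longrightarrow>
    Act A k n (opcomp k \<beta> \<alpha>) x = Act A k m \<beta> (Act A m n \<alpha> x)"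
  using simplicial unfolding simplicial_set_def by blast

lemma Thin_Simp: "x \<in> Thin A n \<Longrightarrow> x \<in> Simp A n"
  using strat by (auto simp: stratified_set_def)

lemma thin_if_repeat: "x \<in> Simp A m \<Longrightarrow> i < m \<Longrightarrow> Act A m m (repeat_op m i) x = x \<Longrightarrow> x \<in> Thin A m"
  using strat degenerate_if_repeat[of A x m i] simplicial unfolding stratified_set_def by blast

text \<open>A simplicial map to A from the complex of all simplices whose vertex set lies in U. Thinness of
  a simplex depends only on its vertex set, because degenerate simplices are always thin.\<close>

definition smap :: "nat set set \<Rightarrow> 'a opfun \<Rightarrow> bool" where
  "smap U F \<longleftrightarrow> (\<forall>m. \<forall>\<alpha>\<in>Ops m. \<alpha> ` {0..m} \<in> U \<longrightarrow> F m \<alpha> \<in> Simp A m \<and>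
     (\<forall>k. \<forall>\<beta>\<in>ops k m. F k (opcomp k \<beta> \<alpha>) = Act A k m \<beta> (F m \<alpha>)))"

definition thn :: "'a opfun \<Rightarrow> nat set \<Rightarrow> bool" where
  "thn F T \<longleftrightarrow> (\<forall>m. \<forall>\<alpha>\<in>Ops m. \<alpha> ` {0..m} = T \<longrightarrow> F m \<alpha> \<in> Thin A m)"

lemma smap_Simp: "smap U F \<Longrightarrow> \<alpha> \<in> Ops m \<Longrightarrow> \<alpha> ` {0..m} \<in> U \<Longrightarrow> F m \<alpha> \<in> Simp A m"
  unfolding smap_def by blast

lemma smap_Act: "smap U F \<Longrightarrow> \<alpha> \<in> Ops m \<Longrightarrow> \<alpha> ` {0..m} \<in> U \<Longrightarrow> \<beta> \<in> ops k m \<Longrightarrow>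
   F k (opcomp k \<beta> \<alpha>) = Act A k m \<beta> (F m \<alpha>)"
  unfolding smap_def by blast

lemma smap_subset: "smap U F \<Longrightarrow> V \<subseteq> U \<Longrightarrow> smap V F" unfolding smap_def by blast

lemma smap_repeat_thin:
  assumes "smap U F" "\<alpha> \<in> Ops m" "\<alpha> ` {0..m} \<in> U" "i < m" "\<alpha> (Suc i) = \<alpha> i"
  shows "F m \<alpha> \<in> Thin A m"
proof (rule thin_if_repeat[OF smap_Simp[OF assms(1-3)] assms(4)])
  show "Act A m m (repeat_op m i) (F m \<alpha>) = F m \<alpha>"
    using smap_Act[OF assms(1-3) repeat_op_in_ops[OF assms(4)]]
    unfolding opcomp_repeat_op[OF assms(2,5,4)] by (rule sym)
qed

text \<open>An injective operator lists its image in increasing order, and the sorted list of a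
  finite set is unique.\<close>

lemma inj_Ops_unique:
  assumes "\<alpha> \<in> Ops m" "\<beta> \<in> Ops l" "inj_on \<alpha> {0..m}" "inj_on \<beta> {0..l}" "\<alpha> ` {0..m} = \<beta> ` {0..l}"
  shows "m = l \<and> \<alpha> = \<beta>"
proof -
  have ml: "m = l" using card_image[OF assms(3)] card_image[OF assms(4)] assms(5) by simp
  have key: "sorted (map \<gamma> [0..<Suc n]) \<and> distinct (map \<gamma> [0..<Suc n]) \<and> set (map \<gamma> [0..<Suc n]) = \<gamma> ` {0..n}"
    if g: "\<gamma> \<in> Ops n" "inj_on \<gamma> {0..n}" for \<gamma> n
  proof -
    have "\<gamma> i \<le> \<gamma> j" if "i \<le> j" "j < Suc n" for i j using g(1) that by (simp add: Ops_def)
    then have "sorted (map \<gamma> [0..<Suc n])"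
      by (simp add: sorted_iff_nth_mono del: upt_Suc)
    then show ?thesis
      using g(2) by (simp only: distinct_map distinct_upt set_map set_upt atLeastLessThanSuc_atLeastAtMost simp_thms)
  qed
  have "map \<alpha> [0..<Suc m] = map \<beta> [0..<Suc m]"
    using key[OF assms(1,3)] key[OF assms(2,4)] assms(5) ml by (intro sorted_distinct_set_unique) (simp_all only:)
  then have "\<forall>i\<in>{0..m}. \<alpha> i = \<beta> i"
    by (simp only: map_eq_conv set_upt atLeastLessThanSuc_atLeastAtMost)
  then have "\<alpha> i = \<beta> i" for i
    using assms(1,2) ml by (cases "i \<le> m") (simp_all add: Ops_def)
  then show ?thesis using ml by auto
qed

text \<open>One nondegenerate simplex decides for the whole vertex set: any other operator with
  image T repeats a vertex and so gives a degenerate simplex.\<close>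

lemma thnI:
  assumes "smap U F" "T \<in> U" "\<alpha> \<in> Ops m" "inj_on \<alpha> {0..m}" "\<alpha> ` {0..m} = T" "F m \<alpha> \<in> Thin A m"
  shows "thn F T"
  unfolding thn_def
proof safe
  fix l \<beta> assume b: "\<beta> \<in> Ops l" "T = \<beta> ` {0..l}"
  show "F l \<beta> \<in> Thin A l"
  proof (cases "inj_on \<beta> {0..l}")
    case True then show ?thesis using inj_Ops_unique[OF b(1) assms(3) True assms(4)] b assms by auto
  next
    case False then show ?thesis using repeat_if_not_inj[OF b(1)] smap_repeat_thin[OF assms(1) b(1)] b assms(2) by blast
  qed
qed

lemma smap_pull:
  assumes "smap V F" "mono \<phi>" "\<And>S. S \<in> U \<Longrightarrow> \<phi> ` S \<in> V"
  shows "smap U (pull \<phi> F)"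
  unfolding smap_def
proof (intro allI ballI impI conjI)
  fix m \<alpha> assume a: "\<alpha> \<in> Ops m" "\<alpha> ` {0..m} \<in> U"
  have a': "opcomp m \<alpha> \<phi> \<in> Ops m" "opcomp m \<alpha> \<phi> ` {0..m} \<in> V"
    using a assms(2,3) opcomp_mono_in_Ops by (auto simp: image_opcomp)
  show "pull \<phi> F m \<alpha> \<in> Simp A m" using smap_Simp[OF assms(1) a'] by (simp add: pull_def)
  fix k \<beta> assume b: "\<beta> \<in> ops k m"
  show "pull \<phi> F k (opcomp k \<beta> \<alpha>) = Act A k m \<beta> (pull \<phi> F m \<alpha>)"
    using smap_Act[OF assms(1) a' b] by (simp add: pull_def opcomp_assoc[OF b])
qed

lemma smap_agree:
  assumes "smap U F" "agree U F G" "dclosed U"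
  shows "smap U G"
  unfolding smap_def
proof (intro allI ballI impI conjI)
  fix m \<alpha> assume a: "\<alpha> \<in> Ops m" "\<alpha> ` {0..m} \<in> U"
  then show "G m \<alpha> \<in> Simp A m" using assms(1,2) unfolding agree_def smap_def by metis
  fix k \<beta> assume b: "\<beta> \<in> ops k m"
  have "opcomp k \<beta> \<alpha> ` {0..k} \<in> U"
    using assms(3) a(2) image_opcomp_subset[OF b] unfolding dclosed_def by auto
  then show "G k (opcomp k \<beta> \<alpha>) = Act A k m \<beta> (G m \<alpha>)"
    using assms(1,2) a b opcomp_in_Ops[OF b a(1)] unfolding agree_def smap_def by metis
qed

lemma thn_agree: "thn F T \<Longrightarrow> agree U F G \<Longrightarrow> T \<in> U \<Longrightarrow> thn G T"
  unfolding thn_def agree_def by metis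

lemma thn_pull: "thn F (\<phi> ` T) \<Longrightarrow> mono \<phi> \<Longrightarrow> thn (pull \<phi> F) T"
  using opcomp_mono_in_Ops unfolding thn_def pull_def by (auto simp: image_opcomp)

text \<open>After two vertices of T are collapsed, every simplex on T repeats a vertex and is
  degenerate.\<close>

lemma thn_pull_degenerate:
  assumes "smap V F" "mono \<phi>" "\<phi> ` T \<in> V" "x \<in> T" "y \<in> T" "x \<noteq> y" "\<phi> x = \<phi> y"
  shows "thn (pull \<phi> F) T"
  unfolding thn_def
proof safe
  fix m \<alpha> assume a: "\<alpha> \<in> Ops m" "T = \<alpha> ` {0..m}"
  obtain i j where "i \<le> m" "j \<le> m" "x = \<alpha> i" "y = \<alpha> j" using assms(4,5) a(2) by auto
  then have "opcomp m \<alpha> \<phi> i = opcomp m \<alpha> \<phi> j" "i \<noteq> j" "i \<in> {0..m}" "j \<in> {0..m}"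
    using assms by (auto simp: opcomp_def)
  then have "\<not> inj_on (opcomp m \<alpha> \<phi>) {0..m}" unfolding inj_on_def by blast
  then show "pull \<phi> F m \<alpha> \<in> Thin A m"
    using repeat_if_not_inj[OF opcomp_mono_in_Ops[OF assms(2) a(1)]] assms(1,3) a
      smap_repeat_thin[OF assms(1) opcomp_mono_in_Ops[OF assms(2) a(1)]] unfolding pull_def
    by (auto simp: image_opcomp)
qed

text \<open>No simplex of the union straddles the two complexes, so a definition by cases on the
  vertex set suffices; closure under faces makes each of the two cases stable under the
  action.\<close>

lemma smap_glue:
  assumes "smap U F" "smap V G" "dclosed U" "dclosed V" "agree (U \<inter> V) F G"
  obtains H where "smap (U \<union> V) H" "agree U H F" "agree V H G"
proof -
  define H where "H m \<alpha> = (if \<alpha> ` {0..m} \<in> U then F m \<alpha> else G m \<alpha>)" for m \<alpha>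
  have a: "agree U F H" "agree V G H" using assms(5) by (auto simp: agree_def H_def)
  have "smap U H" "smap V H" using smap_agree a assms by blast+
  then have "smap (U \<union> V) H" unfolding smap_def by blast
  then show thesis using that a agree_sym by blast
qed

end

locale inner_complicial = stratified +
  assumes inner1: "\<And>n k. 0 < k \<Longrightarrow> k < n \<Longrightarrow> rlp A (HornK n k) (DeltaK n k)"
    and inner2: "\<And>n k. 2 \<le> n \<Longrightarrow> 0 < k \<Longrightarrow> k < n \<Longrightarrow> (n, k) \<noteq> (2, 1) \<Longrightarrow> rlp A (DeltaK' n k) (DeltaK'' n k)"

context inner_complicial begin

section \<open>Filling inner horns\<close>

definition adjacent :: "nat set \<Rightarrow> nat \<Rightarrow> nat \<Rightarrow> bool" where
  "adjacent S x y \<longleftrightarrow> x \<in> S \<and> y \<in> S \<and> x < y \<and> (\<forall>z\<in>S. z \<le> x \<or> y \<le> z)"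

text \<open>Under the order isomorphism of S with {0..n}, neighbours become successive numbers. Thus
  the vertices k - 1, k, k + 1 in the definition of \<open>DeltaK\<close> correspond to a pivot and
  its two neighbours in S.\<close>

lemma adjacent_rank:
  assumes "adjacent S x y" "mono \<iota>" "\<iota> ` {0..n} = S" "mono \<rho>" "\<rho> ` S = {0..n}"
     "\<And>i. i \<le> n \<Longrightarrow> \<rho> (\<iota> i) = i" "\<And>x. x \<in> S \<Longrightarrow> \<iota> (\<rho> x) = x"
  shows "\<rho> y = Suc (\<rho> x)" "\<rho> y \<le> n"
proof -
  have xy: "x \<in> S" "y \<in> S" "x < y" using assms(1) by (auto simp: adjacent_def)
  show yn: "\<rho> y \<le> n" using assms(5) xy by force
  have "\<rho> x \<noteq> \<rho> y" using assms(7) xy by (metis less_irrefl)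
  moreover have "\<rho> x \<le> \<rho> y" using assms(4) xy by (simp add: mono_def)
  moreover have "\<not> Suc (\<rho> x) < \<rho> y"
  proof
    assume l: "Suc (\<rho> x) < \<rho> y"
    define z where "z = \<iota> (Suc (\<rho> x))"
    have "z \<in> S" using l yn assms(3) by (auto simp: z_def)
    moreover have "\<rho> z = Suc (\<rho> x)" using l yn assms(6) by (simp add: z_def)
    moreover have "z \<le> x \<or> y \<le> z" using assms(1) \<open>z \<in> S\<close> by (auto simp: adjacent_def)
    ultimately show False using l assms(4) unfolding mono_def by fastforce
  qed
  ultimately show "\<rho> y = Suc (\<rho> x)" by simp
qed

text \<open>The condition on thin simplices leaves out those with a repeated vertex, since these are
  degenerate and every simplicial map sends them to thin simplices.\<close>

lemma strat_map_of_smap: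
  assumes F: "smap U F" and \<phi>: "mono \<phi>"
    and im: "\<And>m \<alpha>. \<alpha> \<in> Simp X m \<Longrightarrow> \<alpha> \<in> Ops m \<and> \<phi> ` \<alpha> ` {0..m} \<in> U"
    and act: "Act X = (\<lambda>m m' \<beta> x. opcomp m \<beta> x)"
    and thin: "\<And>m \<alpha>. \<alpha> \<in> Thin X m \<Longrightarrow> \<alpha> \<in> Simp X m \<and>
       ((\<exists>i<m. \<alpha> (Suc i) = \<alpha> i) \<or> pull \<phi> F m \<alpha> \<in> Thin A m)"
  shows "strat_map X A (pull \<phi> F)"
proof -
  have *: "\<alpha> \<in> Ops m \<and> opcomp m \<alpha> \<phi> \<in> Ops m \<and> opcomp m \<alpha> \<phi> ` {0..m} \<in> U" if "\<alpha> \<in> Simp X m" for m \<alpha>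
    using im[OF that] opcomp_mono_in_Ops[OF \<phi>] by (auto simp: image_opcomp)
  have "pull \<phi> F m (Act X m n \<beta> \<alpha>) = Act A m n \<beta> (pull \<phi> F n \<alpha>)" if "\<beta> \<in> ops m n" "\<alpha> \<in> Simp X n" for m n \<beta> \<alpha>
    using smap_Act[OF F _ _ that(1)] *[OF that(2)] unfolding act pull_def by (simp add: opcomp_assoc[OF that(1), symmetric])
  moreover have "pull \<phi> F m \<alpha> \<in> Simp A m" if "\<alpha> \<in> Simp X m" for m \<alpha>
    using smap_Simp[OF F] *[OF that] unfolding pull_def by auto
  moreover have "pull \<phi> F m \<alpha> \<in> Thin A m" if t: "\<alpha> \<in> Thin X m" for m \<alpha>
  proof (cases "\<exists>i<m. \<alpha> (Suc i) = \<alpha> i")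
    case True
    then obtain i where "i < m" "opcomp m \<alpha> \<phi> (Suc i) = opcomp m \<alpha> \<phi> i" by (auto simp: opcomp_def)
    then show ?thesis unfolding pull_def using smap_repeat_thin[OF F] * thin[OF t] by auto
  next
    case False then show ?thesis using thin[OF t] by blast
  qed
  ultimately show ?thesis unfolding strat_map_def by auto
qed

text \<open>This is the extension from \<open>DeltaK'\<close> to \<open>DeltaK''\<close>,
  transported to an arbitrary vertex set with pivot p. The neighbours a and b make the pivot inner,
  and four vertices mean n \<ge> 3, which avoids the excluded pair (2, 1).\<close>

lemma thin_codim1:
  assumes F: "smap U F" and S: "S \<in> U" "finite S" "4 \<le> card S" and U: "dclosed U"
    and adj: "adjacent S a p" "adjacent S p b"
    and thin: "\<And>T. T \<subseteq> S \<Longrightarrow> {a, p, b} \<subseteq> T \<Longrightarrow> thn F T"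
    and faces: "\<And>q. q \<in> S \<Longrightarrow> q \<noteq> p \<Longrightarrow> thn F (S - {q})"
  shows "thn F (S - {p})"
proof -
  obtain n where n: "card S = Suc n" "3 \<le> n" using S(3) by (cases "card S") auto
  obtain \<iota> \<rho> where e: "mono \<iota>" "mono \<rho>" "\<iota> ` {0..n} = S" "\<rho> ` S = {0..n}"
    "\<And>i. i \<le> n \<Longrightarrow> \<rho> (\<iota> i) = i" "\<And>x. x \<in> S \<Longrightarrow> \<iota> (\<rho> x) = x"
    using enumeration[OF S(2) n(1)] by metis
  define k where "k = \<rho> p"
  have ab: "a \<in> S" "p \<in> S" "b \<in> S" using adj by (auto simp: adjacent_def)
  have k: "k = Suc (\<rho> a)" "\<rho> b = Suc k" "\<rho> b \<le> n"
    using adjacent_rank[OF adj(1) e(1,3,2,4-6)] adjacent_rank[OF adj(2) e(1,3,2,4-6)] by (auto simp: k_def)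
  have inj: "inj_on \<iota> {0..n}" using e(5) by (intro inj_on_inverseI[of _ \<rho>]) simp
  have im_face: "\<iota> ` face n i ` {0..n-1} = S - {\<iota> i}" if "i \<le> n" for i
  proof -
    have "face n i ` {0..n-1} = {0..n} - {i}" using image_face[of n i] that n(2) by simp
    moreover have "\<iota> ` ({0..n} - {i}) = \<iota> ` {0..n} - \<iota> ` {i}"
      using that by (intro inj_on_image_set_diff[OF inj]) auto
    ultimately show ?thesis using e(3) by simp
  qed
  have sm: "strat_map (DeltaK' n k) A (pull \<iota> F)"
  proof (rule strat_map_of_smap[OF F e(1)])
    fix m \<alpha> assume "\<alpha> \<in> Simp (DeltaK' n k) m"
    then have a: "\<alpha> \<in> ops m n" by (simp add: DeltaK'_def DeltaK_def)
    then have "\<iota> ` \<alpha> ` {0..m} \<subseteq> \<iota> ` {0..n}" by (intro image_mono image_ops_le)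
    then have "\<iota> ` \<alpha> ` {0..m} \<subseteq> S" by (simp only: e(3))
    then show "\<alpha> \<in> Ops m \<and> \<iota> ` \<alpha> ` {0..m} \<in> U" using U S a unfolding dclosed_def by (auto simp: ops_eq_Ops)
  next
    fix m \<alpha> assume t: "\<alpha> \<in> Thin (DeltaK' n k) m"
    have a: "\<alpha> \<in> ops m n" using t face_in_ops n(2) by (auto simp: DeltaK'_def DeltaK_def split: if_splits)
    have a': "opcomp m \<alpha> \<iota> \<in> Ops m" using a opcomp_mono_in_Ops e(1) by (auto simp: ops_eq_Ops)
    consider "degenerate (stdsimp n) m \<alpha>" | "{k - 1, k, k + 1} \<inter> {0..n} \<subseteq> \<alpha> ` {0..m}"
      | i where "i \<le> n" "i \<noteq> k" "m = n - 1" "\<alpha> = face n i"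
      using t by (auto simp: DeltaK'_def DeltaK_def split: if_splits)
    then have "(\<exists>i<m. \<alpha> (Suc i) = \<alpha> i) \<or> pull \<iota> F m \<alpha> \<in> Thin A m"
    proof cases
      case 1 then show ?thesis using degenerate_stdsimp_iff[OF a] by blast
    next
      case 2
      have "{\<rho> a, \<rho> p, \<rho> b} \<subseteq> \<alpha> ` {0..m}" using 2 k by (auto simp: k_def)
      then have "\<iota> ` {\<rho> a, \<rho> p, \<rho> b} \<subseteq> \<iota> ` \<alpha> ` {0..m}" by (rule image_mono)
      then have "{a, p, b} \<subseteq> \<iota> ` \<alpha> ` {0..m}" using ab e(6) by simp
      moreover have "\<iota> ` \<alpha> ` {0..m} \<subseteq> S" using image_mono[OF image_ops_le[OF a], of \<iota>] by (simp only: e(3))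
      ultimately have "thn F (\<iota> ` \<alpha> ` {0..m})" using thin by blast
      then show ?thesis using a' unfolding thn_def pull_def by (auto simp: image_opcomp)
    next
      case 3
      have "\<iota> i \<noteq> p" using 3 e(5) k_def by metis
      then have "thn F (\<iota> ` \<alpha> ` {0..m})" using 3 im_face faces e(3) by auto
      then show ?thesis using a' unfolding thn_def pull_def by (auto simp: image_opcomp)
    qed
    then show "\<alpha> \<in> Simp (DeltaK' n k) m \<and> ((\<exists>i<m. \<alpha> (Suc i) = \<alpha> i) \<or> pull \<iota> F m \<alpha> \<in> Thin A m)"
      using a by (simp add: DeltaK'_def DeltaK_def)
  qed (simp add: DeltaK'_def DeltaK_def)
  have "rlp A (DeltaK' n k) (DeltaK'' n k)" using inner2[of n k] n k by auto
  then obtain g where g: "strat_map (DeltaK'' n k) A g" "\<And>m x. x \<in> Simp (DeltaK' n k) m \<Longrightarrow> g m x = pull \<iota> F m x"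
    using sm unfolding rlp_def by blast
  have f: "face n k \<in> ops (n-1) n" using k face_in_ops by auto
  have "face n k \<in> Thin (DeltaK'' n k) (n-1)" using k by (auto simp: DeltaK''_def)
  then have "g (n-1) (face n k) \<in> Thin A (n-1)"
    using g(1) unfolding strat_map_def by blast
  moreover have "face n k \<in> Simp (DeltaK' n k) (n-1)" using f by (simp add: DeltaK'_def DeltaK_def)
  ultimately have th: "F (n-1) (opcomp (n-1) (face n k) \<iota>) \<in> Thin A (n-1)"
    using g(2) by (simp add: pull_def)
  have Sp: "\<iota> ` face n k ` {0..n-1} = S - {p}" using im_face[of k] k e(6) ab by (auto simp: k_def)
  have fO: "face n k \<in> Ops (n-1)" using f by (auto simp: ops_eq_Ops)
  have inj: "inj_on (opcomp (n-1) (face n k) \<iota>) {0..n-1}"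
    using Sp n ab(2) by (intro eq_card_imp_inj_on) (simp_all add: image_opcomp)
  have SpU: "S - {p} \<in> U"
  proof -
    have "a \<in> S - {p}" using adj(1) by (auto simp: adjacent_def)
    then show ?thesis by (intro dclosedD[OF U S(1)]) auto
  qed
  have im: "opcomp (n-1) (face n k) \<iota> ` {0..n-1} = S - {p}" unfolding image_opcomp by (fact Sp)
  show ?thesis
    using thnI[of U F "S - {p}" "opcomp (n-1) (face n k) \<iota>" "n-1"] F SpU opcomp_mono_in_Ops[OF e(1) fO] inj im th
    by blast
qed

text \<open>The faces of S that belong to U form exactly the horn at p. Its filler lives on {0..n},
  is brought back to S along \<rho>, and is glued to F.\<close>

lemma horn_extension:
  assumes F: "smap U F" and S: "finite S" "S \<notin> U" "S - {p} \<notin> U" and U: "dclosed U"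
    and adj: "adjacent S a p" "adjacent S p b"
    and thin: "\<And>T. T \<in> U \<Longrightarrow> T \<subseteq> S \<Longrightarrow> {a, p, b} \<subseteq> T \<Longrightarrow> thn F T"
    and horn: "\<And>T. T \<subset> S \<Longrightarrow> T \<noteq> {} \<Longrightarrow> T \<noteq> S - {p} \<Longrightarrow> T \<in> U"
  obtains G where "smap (U \<union> {S, S - {p}}) G" "agree U G F" "thn G S"
proof -
  have ab: "a \<in> S" "p \<in> S" "b \<in> S" "a < p" "p < b" using adj by (auto simp: adjacent_def)
  obtain n where n: "card S = Suc n" using S(1) ab(1) by (cases "card S") auto
  obtain \<iota> \<rho> where e: "mono \<iota>" "mono \<rho>" "\<iota> ` {0..n} = S" "\<rho> ` S = {0..n}"
    "\<And>i. i \<le> n \<Longrightarrow> \<rho> (\<iota> i) = i" "\<And>x. x \<in> S \<Longrightarrow> \<iota> (\<rho> x) = x"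
    using enumeration[OF S(1) n] by metis
  define k where "k = \<rho> p"
  have k: "k = Suc (\<rho> a)" "\<rho> b = Suc k" "\<rho> b \<le> n"
    using adjacent_rank[OF adj(1) e(1,3,2,4-6)] adjacent_rank[OF adj(2) e(1,3,2,4-6)] by (auto simp: k_def)
  have ik: "\<iota> k = p" using e(6) ab by (simp add: k_def)
  have inU: "\<iota> ` T \<in> U" if "T \<subseteq> {0..n}" "T \<union> {k} \<noteq> {0..n}" "T \<noteq> {}" for T
  proof -
    have T: "T = \<rho> ` \<iota> ` T" using e(5) that(1) by (force simp: image_image)
    have sub: "\<iota> ` T \<subseteq> S" using that(1) e(3) by blast
    have "\<iota> ` T \<noteq> S" using T e(4) that k by auto
    moreover have "\<iota> ` T \<noteq> S - {p}"
    proof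
      assume "\<iota> ` T = S - {p}"
      then have "\<rho> ` (insert p (\<iota> ` T)) = \<rho> ` S" using ab by (simp add: insert_absorb)
      then show False using T e(4) that(2) by (auto simp: k_def)
    qed
    ultimately show ?thesis using horn sub that(3) by blast
  qed
  have sm: "strat_map (HornK n k) A (pull \<iota> F)"
  proof (rule strat_map_of_smap[OF F e(1)])
    fix m \<alpha> assume a: "\<alpha> \<in> Simp (HornK n k) m"
    then show "\<alpha> \<in> Ops m \<and> \<iota> ` \<alpha> ` {0..m} \<in> U"
      using inU[of "\<alpha> ` {0..m}"] by (auto simp: HornK_def ops_eq_Ops)
  next
    fix m \<alpha> assume t: "\<alpha> \<in> Thin (HornK n k) m"
    have a: "\<alpha> \<in> ops m n" using t by (auto simp: HornK_def DeltaK_def)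
    have a': "opcomp m \<alpha> \<iota> \<in> Ops m" using a opcomp_mono_in_Ops e(1) by (auto simp: ops_eq_Ops)
    consider "degenerate (stdsimp n) m \<alpha>" | "{k - 1, k, k + 1} \<inter> {0..n} \<subseteq> \<alpha> ` {0..m}"
      using t by (auto simp: HornK_def DeltaK_def)
    then have "(\<exists>i<m. \<alpha> (Suc i) = \<alpha> i) \<or> pull \<iota> F m \<alpha> \<in> Thin A m"
    proof cases
      case 1 then show ?thesis using degenerate_stdsimp_iff[OF a] by blast
    next
      case 2
      have "{\<rho> a, \<rho> p, \<rho> b} \<subseteq> \<alpha> ` {0..m}" using 2 k by (auto simp: k_def)
      then have "\<iota> ` {\<rho> a, \<rho> p, \<rho> b} \<subseteq> \<iota> ` \<alpha> ` {0..m}" by (rule image_mono)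
      then have "{a, p, b} \<subseteq> \<iota> ` \<alpha> ` {0..m}" using ab e(6) by simp
      moreover have "\<iota> ` \<alpha> ` {0..m} \<subseteq> S" using image_mono[OF image_ops_le[OF a], of \<iota>] by (simp only: e(3))
      moreover have "\<iota> ` \<alpha> ` {0..m} \<in> U"
        using inU[of "\<alpha> ` {0..m}"] t a by (auto simp: HornK_def ops_eq_Ops)
      ultimately have "thn F (\<iota> ` \<alpha> ` {0..m})" using thin by blast
      then show ?thesis using a' unfolding thn_def pull_def by (auto simp: image_opcomp)
    qed
    then show "\<alpha> \<in> Simp (HornK n k) m \<and> ((\<exists>i<m. \<alpha> (Suc i) = \<alpha> i) \<or> pull \<iota> F m \<alpha> \<in> Thin A m)"
      using t a by (simp add: HornK_def)
  qed (simp add: HornK_def)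
  have "rlp A (HornK n k) (DeltaK n k)" using inner1[of k n] k by auto
  then obtain g where g: "strat_map (DeltaK n k) A g"
     "\<And>m x. x \<in> Simp (HornK n k) m \<Longrightarrow> g m x = pull \<iota> F m x"
    using sm unfolding rlp_def by blast
  let ?V = "{T. T \<subseteq> S \<and> T \<noteq> {}}"
  have gs: "smap {T. T \<subseteq> {0..n} \<and> T \<noteq> {}} g"
    unfolding smap_def
  proof (intro allI ballI impI conjI)
    fix m \<alpha> assume "\<alpha> \<in> Ops m" "\<alpha> ` {0..m} \<in> {T. T \<subseteq> {0..n} \<and> T \<noteq> {}}"
    then have a: "\<alpha> \<in> ops m n" by (auto simp: ops_eq_Ops)
    then show "g m \<alpha> \<in> Simp A m" using g(1) unfolding strat_map_def by (simp add: DeltaK_def)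
    fix l \<beta> assume "\<beta> \<in> ops l m"
    then show "g l (opcomp l \<beta> \<alpha>) = Act A l m \<beta> (g m \<alpha>)"
      using g(1) a unfolding strat_map_def by (simp add: DeltaK_def)
  qed
  have gV: "smap ?V (pull \<rho> g)"
    using e(4) by (intro smap_pull[OF gs e(2)]) auto
  \<comment> \<open>A simplex of U on vertices of S has neither S nor S - {p} as its vertex set, so
    it corresponds to a simplex of the horn, where the filler extends F.\<close>
  have ag: "agree (U \<inter> ?V) F (pull \<rho> g)"
    unfolding agree_def
  proof (intro allI ballI impI)
    fix m \<alpha> assume "\<alpha> \<in> Ops m" "\<alpha> ` {0..m} \<in> U \<inter> ?V"
    then have a: "\<alpha> \<in> Ops m" "\<alpha> ` {0..m} \<in> U" "\<alpha> ` {0..m} \<subseteq> S" by auto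
    have o: "opcomp m \<alpha> \<rho> \<in> Ops m" using a e(2) opcomp_mono_in_Ops by blast
    have im: "\<iota> ` \<rho> ` \<alpha> ` {0..m} = \<alpha> ` {0..m}" using e(6) a(3) by (force simp: image_image)
    have "\<rho> ` \<alpha> ` {0..m} \<union> {k} \<noteq> {0..n}"
    proof
      assume "\<rho> ` \<alpha> ` {0..m} \<union> {k} = {0..n}"
      then have "\<iota> ` (\<rho> ` \<alpha> ` {0..m} \<union> {k}) = S" using e(3) by simp
      then have "insert p (\<alpha> ` {0..m}) = S" using im ik by (simp add: image_Un)
      then have "\<alpha> ` {0..m} = S \<or> \<alpha> ` {0..m} = S - {p}" by blast
      then show False using S(2,3) a(2) by auto
    qed
    moreover have "\<rho> ` \<alpha> ` {0..m} \<subseteq> {0..n}" using image_mono[OF a(3), of \<rho>] by (simp only: e(4))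
    ultimately have "opcomp m \<alpha> \<rho> \<in> Simp (HornK n k) m"
      using o by (simp add: HornK_def ops_eq_Ops image_opcomp)
    then have "g m (opcomp m \<alpha> \<rho>) = F m (opcomp m (opcomp m \<alpha> \<rho>) \<iota>)" using g(2) by (simp add: pull_def)
    also have "opcomp m (opcomp m \<alpha> \<rho>) \<iota> = \<alpha>"
      unfolding opcomp_twice using a e(6) by (intro opcomp_id) auto
    finally show "F m \<alpha> = pull \<rho> g m \<alpha>" by (simp add: pull_def)
  qed
  have dV: "dclosed ?V" by (auto simp: dclosed_def)
  obtain H where H: "smap (U \<union> ?V) H" "agree U H F" "agree ?V H (pull \<rho> g)"
    using smap_glue[OF F gV U dV ag] by blast
  have "thn (pull \<rho> g) S"
    unfolding thn_def
  proof safe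
    fix m \<alpha> assume a: "\<alpha> \<in> Ops m" "S = \<alpha> ` {0..m}"
    have "opcomp m \<alpha> \<rho> \<in> Thin (DeltaK n k) m"
      using opcomp_mono_in_Ops[OF e(2) a(1)] e(4) a(2) by (auto simp: DeltaK_def ops_eq_Ops image_opcomp)
    then show "pull \<rho> g m \<alpha> \<in> Thin A m" using g(1) unfolding strat_map_def pull_def by blast
  qed
  then have "thn H S" using thn_agree[OF _ agree_sym[OF H(3)]] ab by blast
  moreover have "smap (U \<union> {S, S - {p}}) H" using H(1) ab by (elim smap_subset) auto
  ultimately show thesis using that H(2) by blast
qed

text \<open>The members of X are attached in order of increasing cardinality, each along the inner horn
  that omits its face opposite p.\<close>
lemma horn_extensions:
  assumes "finite X" and F: "smap U F" and U: "dclosed U"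
    and X: "\<And>S. S \<in> X \<Longrightarrow> finite S \<and> S \<notin> U \<and> S - {p} \<notin> U"
    and adj: "\<And>S. S \<in> X \<Longrightarrow> \<exists>a b. adjacent S a p \<and> adjacent S p b \<and>
               (\<forall>T\<in>U. T \<subseteq> S \<longrightarrow> {a, p, b} \<subseteq> T \<longrightarrow> thn F T)"
    and horn: "\<And>S T. S \<in> X \<Longrightarrow> T \<subset> S \<Longrightarrow> T \<noteq> {} \<Longrightarrow> T \<in> U \<or> insert p T \<in> X"
  obtains G where "smap (U \<union> X \<union> (\<lambda>S. S - {p}) ` X) G" "dclosed (U \<union> X \<union> (\<lambda>S. S - {p}) ` X)"
    "agree U G F" "\<forall>S\<in>X. thn G S"
    "\<forall>S\<in>X. 4 \<le> card S \<longrightarrow> (\<forall>q\<in>S. q \<noteq> p \<longrightarrow> S - {q} \<in> U \<longrightarrow> thn F (S - {q})) \<longrightarrow> thn G (S - {p})"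
proof -
  have "\<exists>G. smap (U \<union> X \<union> (\<lambda>S. S - {p}) ` X) G \<and> dclosed (U \<union> X \<union> (\<lambda>S. S - {p}) ` X) \<and> agree U G F \<and> (\<forall>S\<in>X. thn G S)"
    using assms(1) X adj horn
  proof (induction "card X" arbitrary: X)
    case 0 then show ?case using F U agree_refl by auto
  next
    case (Suc c)
    \<comment> \<open>A member of largest cardinality is attached last. By maximality no proper face
      of another member becomes equal to it after adding p, so the premises survive for the
      remaining members.\<close>
    obtain S where S: "S \<in> X" "\<And>S'. S' \<in> X \<Longrightarrow> card S' \<le> card S"
    proof -
      have "X \<noteq> {}" using Suc(2) by auto
      then have "Max (card ` X) \<in> card ` X" using Suc(3) by simp
      then obtain S where "S \<in> X" "card S = Max (card ` X)" by auto
      then show thesis using that Suc(3) by simp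
    qed
    define Y where "Y = X - {S}"
    let ?U = "U \<union> Y \<union> (\<lambda>S. S - {p}) ` Y"
    have pX: "p \<in> S'" if "S' \<in> X" for S' using Suc(5)[OF that] by (auto simp: adjacent_def)
    have "\<exists>G. smap ?U G \<and> dclosed ?U \<and> agree U G F \<and> (\<forall>S\<in>Y. thn G S)"
    proof (rule Suc(1))
      show "c = card Y" "finite Y" using Suc(2,3) S by (auto simp: Y_def)
      fix S' assume S': "S' \<in> Y"
      then have "S' \<in> X" by (simp add: Y_def)
      then show "finite S' \<and> S' \<notin> U \<and> S' - {p} \<notin> U" "\<exists>a b. adjacent S' a p \<and> adjacent S' p b \<and>
               (\<forall>T\<in>U. T \<subseteq> S' \<longrightarrow> {a, p, b} \<subseteq> T \<longrightarrow> thn F T)" using Suc(4,5) by blast+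
      fix T assume T: "T \<subset> S'" "T \<noteq> {}"
      have "insert p T \<noteq> S"
      proof
        assume "insert p T = S"
        then have "S \<subseteq> S'" using T pX[OF \<open>S' \<in> X\<close>] by auto
        then have "S = S'" using S(2)[OF \<open>S' \<in> X\<close>] Suc(4)[OF \<open>S' \<in> X\<close>] by (simp add: card_seteq)
        then show False using S' by (simp add: Y_def)
      qed
      then show "T \<in> U \<or> insert p T \<in> Y" using Suc(6)[OF \<open>S' \<in> X\<close> T] by (simp add: Y_def)
    qed
    then obtain G where G: "smap ?U G" "dclosed ?U" "agree U G F" "\<And>S. S \<in> Y \<Longrightarrow> thn G S" by blast
    obtain a b where ab: "adjacent S a p" "adjacent S p b"
        "\<forall>T\<in>U. T \<subseteq> S \<longrightarrow> {a, p, b} \<subseteq> T \<longrightarrow> thn F T"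
      using Suc(5)[OF S(1)] by (elim exE conjE) (rule that)
    have SU: "S \<notin> ?U" "S - {p} \<notin> ?U"
    proof -
      have "S \<notin> Y" by (simp add: Y_def)
      moreover have "S \<noteq> S' - {p}" for S' using pX[OF S(1)] by auto
      ultimately show "S \<notin> ?U" using Suc(4)[OF S(1)] by auto
      have "S - {p} \<notin> Y" using pX by (auto simp: Y_def)
      moreover have "S - {p} \<noteq> S' - {p}" if "S' \<in> Y" for S'
        using pX[OF S(1)] pX[of S'] that by (auto simp: Y_def)
      ultimately show "S - {p} \<notin> ?U" using Suc(4)[OF S(1)] by auto
    qed
    have th: "thn G T" if "T \<in> ?U" "T \<subseteq> S" "{a, p, b} \<subseteq> T" for T
    proof -
      have "T \<in> U \<or> T \<in> Y" using that by auto
      then show ?thesis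
      proof
        assume "T \<in> U"
        then show ?thesis using ab(3) that(2,3) by (intro thn_agree[OF _ agree_sym[OF G(3)]]) auto
      qed (rule G(4))
    qed
    \<comment> \<open>A face T of S outside U, other than the one opposite p, yields a proper face
      \<open>insert p T\<close> of S. That face is one of the members attached before, and T is
      either this face or its face opposite p.\<close>
    have hn: "T \<in> ?U" if "T \<subset> S" "T \<noteq> {}" "T \<noteq> S - {p}" for T
    proof (cases "T \<in> U")
      case False
      then have i: "insert p T \<in> X" using Suc(6)[OF S(1) that(1,2)] by blast
      have "insert p T \<noteq> S" using that by auto
      then have i: "insert p T \<in> Y" using i by (simp add: Y_def)
      show ?thesis
      proof (cases "p \<in> T")
        case True then show ?thesis using i by (simp add: insert_absorb)
      next
        case False then have "T = insert p T - {p}" by auto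
        then show ?thesis using i by blast
      qed
    qed auto
    obtain H where H: "smap (?U \<union> {S, S - {p}}) H" "agree ?U H G" "thn H S"
      using horn_extension[OF G(1) _ SU G(2) ab(1,2) th hn] Suc(4)[OF S(1)] by blast
    have XY: "U \<union> X \<union> (\<lambda>S. S - {p}) ` X = ?U \<union> {S, S - {p}}" using S(1) by (auto simp: Y_def)
    have "dclosed (?U \<union> {S, S - {p}})"
      unfolding dclosed_def
    proof (intro ballI allI impI)
      fix S' T assume T: "S' \<in> ?U \<union> {S, S - {p}}" "T \<subseteq> S'" "T \<noteq> {}"
      show "T \<in> ?U \<union> {S, S - {p}}"
      proof (cases "S' \<in> ?U")
        case True then show ?thesis using G(2) T unfolding dclosed_def by blast
      next
        case False then have "T \<subseteq> S" using T by auto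
        then show ?thesis using hn T(3) by blast
      qed
    qed
    moreover have "agree U H F" using agree_trans[OF agree_mono[OF H(2)] G(3)] by blast
    moreover have "thn H S'" if "S' \<in> X" for S'
    proof (cases "S' = S")
      case False then have "S' \<in> Y" using that by (simp add: Y_def)
      then show ?thesis using G(4) thn_agree[OF _ agree_sym[OF H(2)]] by blast
    qed (use H in simp)
    ultimately show ?case unfolding XY using H(1) by blast
  qed
  then obtain G where G: "smap (U \<union> X \<union> (\<lambda>S. S - {p}) ` X) G" "dclosed (U \<union> X \<union> (\<lambda>S. S - {p}) ` X)" "agree U G F" "\<And>S. S \<in> X \<Longrightarrow> thn G S" by blast
  have "thn G (S - {p})" if S: "S \<in> X" "4 \<le> card S" and q: "\<forall>q\<in>S. q \<noteq> p \<longrightarrow> S - {q} \<in> U \<longrightarrow> thn F (S - {q})" for S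
  proof -
    obtain a b where ab: "adjacent S a p" "adjacent S p b"
        "\<forall>T\<in>U. T \<subseteq> S \<longrightarrow> {a, p, b} \<subseteq> T \<longrightarrow> thn F T"
      using adj[OF S(1)] by (elim exE conjE) (rule that)
    have pS: "p \<in> S" using ab by (auto simp: adjacent_def)
    \<comment> \<open>Each face of S through p is in U or in X, so its thinness is either a premise
      or was produced by an attachment.\<close>
    have UX: "T \<in> U \<or> T \<in> X" if "T \<subseteq> S" "p \<in> T" for T
      using horn[OF S(1), of T] S(1) that by (cases "T = S") (auto simp: insert_absorb)
    show ?thesis
    proof (rule thin_codim1[OF G(1) _ _ S(2) G(2) ab(1,2)])
      show "S \<in> U \<union> X \<union> (\<lambda>S. S - {p}) ` X" "finite S" using S(1) X by auto
      fix T assume T: "T \<subseteq> S" "{a, p, b} \<subseteq> T"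
      have "T \<in> U \<or> T \<in> X" using UX[of T] T by simp
      then show "thn G T"
      proof
        assume "T \<in> U"
        then show ?thesis using ab(3) T by (intro thn_agree[OF _ agree_sym[OF G(3)]]) auto
      qed (rule G(4))
    next
      fix r assume r: "r \<in> S" "r \<noteq> p"
      have "S - {r} \<in> U \<or> S - {r} \<in> X" using UX[of "S - {r}"] r pS by auto
      then show "thn G (S - {r})"
      proof
        assume "S - {r} \<in> U"
        then show ?thesis using q r by (intro thn_agree[OF _ agree_sym[OF G(3)]]) auto
      qed (rule G(4))
    qed
  qed
  then show thesis using that G by blast
qed

end

section \<open>Simplices of a slice\<close>

text \<open>The vertices from 4 onwards carry a family D of faces; the vertices 0, ..., 3 are put in front of
  them. A map on \<open>cyl {0..q} D\<close> is a q-simplex of the slice of A over the complex D, and pulling back along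
  \<open>pr a b c d\<close>, which relocates the vertices 0, ..., 3 only, is the action of operators on such simplices.
  For \<open>D = {{}}\<close> this is A itself.\<close>

definition cyl :: "nat set \<Rightarrow> nat set set \<Rightarrow> nat set set" where
  "cyl P D = {S. S \<noteq> {} \<and> S \<inter> {..<4} \<subseteq> P \<and> S \<inter> {4..} \<in> D}"

definition fam :: "nat set set \<Rightarrow> bool" where
  "fam D \<longleftrightarrow> finite D \<and> {} \<in> D \<and> (\<forall>\<sigma>\<in>D. finite \<sigma> \<and> \<sigma> \<subseteq> {4..}) \<and> (\<forall>\<sigma>\<in>D. \<forall>\<tau>\<subseteq>\<sigma>. \<tau> \<in> D)"

definition pr :: "nat \<Rightarrow> nat \<Rightarrow> nat \<Rightarrow> nat \<Rightarrow> nat \<Rightarrow> nat" where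
  "pr a b c d x = (if x = 0 then a else if x = 1 then b else if x = 2 then c else if x = 3 then d else x)"

lemma mono_pr: "a \<le> b \<Longrightarrow> b \<le> c \<Longrightarrow> c \<le> d \<Longrightarrow> d \<le> 4 \<Longrightarrow> mono (pr a b c d)"
  by (auto simp: mono_def pr_def)

lemma pr_ge: "4 \<le> x \<Longrightarrow> pr a b c d x = x" by (simp add: pr_def)

lemma pr_id: "pr 0 1 2 3 = id" by (auto simp: pr_def)

lemma pr_simps: "pr a b c d 0 = a" "pr a b c d 1 = b" "pr a b c d (Suc 0) = b" "pr a b c d 2 = c" "pr a b c d 3 = d"
  by (auto simp: pr_def)

lemma pr_comp: "pr a b c d \<circ> pr a' b' c' d' = pr (pr a b c d a') (pr a b c d b') (pr a b c d c') (pr a b c d d')"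
proof
  fix x :: nat
  consider "x = 0" | "x = 1" | "x = 2" | "x = 3" | "4 \<le> x" by linarith
  then show "(pr a b c d \<circ> pr a' b' c' d') x = pr (pr a b c d a') (pr a b c d b') (pr a b c d c') (pr a b c d d') x"
    by cases (simp_all add: pr_simps pr_ge)
qed

lemma dclosed_cyl: "fam D \<Longrightarrow> dclosed (cyl P D)"
  unfolding dclosed_def cyl_def fam_def
proof (intro ballI allI impI)
  fix S T assume D: "finite D \<and> {} \<in> D \<and> (\<forall>\<sigma>\<in>D. finite \<sigma> \<and> \<sigma> \<subseteq> {4..}) \<and> (\<forall>\<sigma>\<in>D. \<forall>\<tau>\<subseteq>\<sigma>. \<tau> \<in> D)"
    and S: "S \<in> {S. S \<noteq> {} \<and> S \<inter> {..<4} \<subseteq> P \<and> S \<inter> {4..} \<in> D}" and T: "T \<subseteq> S" "T \<noteq> {}"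
  have "T \<inter> {4..} \<subseteq> S \<inter> {4..}" using T by auto
  moreover have "S \<inter> {4..} \<in> D" using S by simp
  ultimately have "T \<inter> {4..} \<in> D" using D by blast
  then show "T \<in> {S. S \<noteq> {} \<and> S \<inter> {..<4} \<subseteq> P \<and> S \<inter> {4..} \<in> D}" using S T by auto
qed

lemma dclosed_Un: "dclosed U \<Longrightarrow> dclosed V \<Longrightarrow> dclosed (U \<union> V)"
  unfolding dclosed_def by auto

lemma fam_down: "fam D \<Longrightarrow> \<sigma> \<in> D \<Longrightarrow> \<tau> \<subseteq> \<sigma> \<Longrightarrow> \<tau> \<in> D" by (auto simp: fam_def)

lemma fam_empty: "fam {{}}" by (auto simp: fam_def)

lemma cyl_Int: "cyl P D \<inter> cyl Q E = cyl (P \<inter> Q) (D \<inter> E)" by (auto simp: cyl_def)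

lemma Un_in_cyl:
  assumes "Q \<subseteq> {..<4}" "\<sigma> \<subseteq> {4..}"
  shows "Q \<union> \<sigma> \<in> cyl P D \<longleftrightarrow> Q \<union> \<sigma> \<noteq> {} \<and> Q \<subseteq> P \<and> \<sigma> \<in> D"
proof -
  have "(Q \<union> \<sigma>) \<inter> {..<4} = Q" "(Q \<union> \<sigma>) \<inter> {4..} = \<sigma>" using assms by fastforce+
  then show ?thesis by (simp add: cyl_def)
qed

text \<open>Values below 4 never run into the vertices of the members of D, so only the front part
  of a vertex set is changed.\<close>

lemma pr_image_cyl:
  assumes "S \<in> cyl P D" "p < 4" "q < 4" "r < 4" "s < 4" "\<forall>x\<in>P. pr p q r s x \<in> V"
  shows "pr p q r s ` S \<in> cyl V D"
proof -
  have lt: "pr p q r s x < 4" if "x < 4" for x using that assms(2-5) by (auto simp: pr_def)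
  have "pr p q r s ` S \<inter> {4..} = S \<inter> {4..}"
  proof safe
    fix x assume "x \<in> S" "4 \<le> pr p q r s x"
    then show "pr p q r s x \<in> S" using lt[of x] pr_ge[of x p q r s] by (cases "x < 4") auto
  next
    fix x :: nat assume "x \<in> S" "4 \<le> x" then show "x \<in> pr p q r s ` S" using pr_ge[of x p q r s] by (metis image_eqI)
  qed
  moreover have "pr p q r s ` S \<inter> {..<4} \<subseteq> V"
  proof
    fix y assume "y \<in> pr p q r s ` S \<inter> {..<4}"
    then obtain x where x: "x \<in> S" "y = pr p q r s x" "y < 4" by auto
    then have "x < 4" using pr_ge[of x p q r s] by (cases "x < 4") auto
    then have "x \<in> P" using assms(1) x by (auto simp: cyl_def)
    then show "y \<in> V" using assms(6) x by auto
  qed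
  ultimately show ?thesis using assms(1) by (simp add: cyl_def)
qed

text \<open>The working rule for faces and degeneracies in the slice: a known equation is pulled
  back along the operator \<open>pr p q r s\<close>, and a finite check on the front vertices in P
  remains. At vertices outside P the numbers p, q, r, s are chosen for monotonicity alone.
  Identities are written as \<open>pr 0 1 2 3\<close> throughout so that both sides have the shape
  expected here.\<close>

lemma agree_cyl:
  assumes "agree (cyl V D) (pull (pr a1 b1 c1 d1) H1) (pull (pr a2 b2 c2 d2) H2)"
    "p \<le> q" "q \<le> r" "r \<le> s" "s < 4"
    "\<forall>x\<in>P. pr p q r s x \<in> V \<and> pr a b c d x = pr a1 b1 c1 d1 (pr p q r s x) \<and> pr a' b' c' d' x = pr a2 b2 c2 d2 (pr p q r s x)"
  shows "agree (cyl P D) (pull (pr a b c d) H1) (pull (pr a' b' c' d') H2)"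
proof (rule agree_pull[OF assms(1)])
  show "mono (pr p q r s)" using assms(2-5) by (intro mono_pr) auto
  fix S assume S: "S \<in> cyl P D"
  then show "pr p q r s ` S \<in> cyl V D" by (rule pr_image_cyl) (use assms(2-6) in auto)
  fix x assume x: "x \<in> S"
  show "pr a b c d x = pr a1 b1 c1 d1 (pr p q r s x) \<and> pr a' b' c' d' x = pr a2 b2 c2 d2 (pr p q r s x)"
  proof (cases "x < 4")
    case True then have "x \<in> P" using S x by (auto simp: cyl_def)
    then show ?thesis using assms(6) by blast
  next
    case False then show ?thesis using pr_ge by simp
  qed
qed

lemma agree_pr:
  assumes "\<forall>x\<in>P. pr a b c d x = pr a' b' c' d' x"
  shows "agree (cyl P D) (pull (pr a b c d) F) (pull (pr a' b' c' d') F)"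
  unfolding agree_def
proof (intro allI ballI impI)
  fix m :: nat and \<alpha> :: "nat \<Rightarrow> nat" assume S: "\<alpha> ` {0..m} \<in> cyl P D"
  have "opcomp m \<alpha> (pr a b c d) = opcomp m \<alpha> (pr a' b' c' d')"
  proof (rule opcomp_cong)
    fix x assume "x \<in> \<alpha> ` {0..m}"
    then have "x \<in> P \<or> 4 \<le> x" using S by (cases "x < 4") (auto simp: cyl_def)
    then show "pr a b c d x = pr a' b' c' d' x" using assms pr_ge by auto
  qed
  then show "pull (pr a b c d) F m \<alpha> = pull (pr a' b' c' d') F m \<alpha>" by (simp add: pull_def)
qed

lemma pr_image_Un:
  assumes "\<sigma> \<subseteq> {4..}" shows "pr a b c d ` (Q \<union> \<sigma>) = pr a b c d ` Q \<union> \<sigma>"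
proof -
  have "pr a b c d x = x" if "x \<in> \<sigma>" for x using assms that by (intro pr_ge) auto
  then have "pr a b c d ` \<sigma> = \<sigma>" by simp
  then show ?thesis by (simp add: image_Un)
qed

section \<open>Composition of edges in the slice\<close>

context inner_complicial begin

lemma smap_glue3:
  assumes "smap U1 K1" "smap U2 K2" "smap U3 K3" "dclosed U1" "dclosed U2" "dclosed U3"
    "agree (U1 \<inter> U2) K1 K2" "agree (U1 \<inter> U3) K1 K3" "agree (U2 \<inter> U3) K2 K3"
  obtains G where "smap (U1 \<union> U2 \<union> U3) G" "dclosed (U1 \<union> U2 \<union> U3)" "agree U1 G K1" "agree U2 G K2" "agree U3 G K3"
proof -
  obtain H where H: "smap (U1 \<union> U2) H" "agree U1 H K1" "agree U2 H K2"
    using smap_glue[OF assms(1,2,4,5,7)] by blast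
  have d: "dclosed (U1 \<union> U2)" using assms(4,5) by (rule dclosed_Un)
  have d': "dclosed (U1 \<union> U2 \<union> U3)" using d assms(6) by (rule dclosed_Un)
  have "agree (U1 \<inter> U3) H K3" "agree (U2 \<inter> U3) H K3"
    using agree_trans[OF agree_mono[OF H(2)] assms(8)] agree_trans[OF agree_mono[OF H(3)] assms(9)] by auto
  then have "agree ((U1 \<union> U2) \<inter> U3) H K3" unfolding agree_def by blast
  then obtain G where G: "smap (U1 \<union> U2 \<union> U3) G" "agree (U1 \<union> U2) G H" "agree U3 G K3"
    using smap_glue[OF H(1) assms(3) d assms(6)] by blast
  show thesis
    using that[OF G(1) d' agree_trans[OF agree_mono[OF G(2)] H(2)] agree_trans[OF agree_mono[OF G(2)] H(3)] G(3)] by auto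
qed

text \<open>Thin 2-simplices H of the slice, with faces a = 01, b = 12 and c = 02.\<close>

definition slice_tri :: "nat set set \<Rightarrow> 'a opfun \<Rightarrow> 'a opfun \<Rightarrow> 'a opfun \<Rightarrow> 'a opfun \<Rightarrow> bool" where
  "slice_tri D H a b c \<longleftrightarrow> smap (cyl {0,1,2} D) H \<and> (\<forall>\<sigma>\<in>D. thn H ({0,1,2} \<union> \<sigma>)) \<and>
     agree (cyl {0,1} D) (pull (pr 0 1 1 1) H) (pull (pr 0 1 2 3) a) \<and>
     agree (cyl {0,1} D) (pull (pr 1 2 2 2) H) (pull (pr 0 1 2 3) b) \<and>
     agree (cyl {0,1} D) (pull (pr 0 2 2 2) H) (pull (pr 0 1 2 3) c)"

text \<open>Thinness of an edge of the slice is demanded over every face in D; the empty face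
  accounts for the underlying 1-simplex of A.\<close>

definition marked :: "nat set set \<Rightarrow> 'a opfun \<Rightarrow> bool" where
  "marked D a \<longleftrightarrow> (\<forall>\<sigma>\<in>D. thn a ({0,1} \<union> \<sigma>))"

lemma slice_triD:
  assumes "slice_tri D H a b c"
  shows "smap (cyl {0,1,2} D) H" "\<And>\<sigma>. \<sigma> \<in> D \<Longrightarrow> thn H ({0,1,2} \<union> \<sigma>)"
     "agree (cyl {0,1} D) (pull (pr 0 1 1 1) H) (pull (pr 0 1 2 3) a)"
     "agree (cyl {0,1} D) (pull (pr 1 2 2 2) H) (pull (pr 0 1 2 3) b)"
     "agree (cyl {0,1} D) (pull (pr 0 2 2 2) H) (pull (pr 0 1 2 3) c)"
  using assms unfolding slice_tri_def by blast+

lemma slice_triI: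
  assumes "smap (cyl {0,1,2} D) H" "\<And>\<sigma>. \<sigma> \<in> D \<Longrightarrow> thn H ({0,1,2} \<union> \<sigma>)"
     "agree (cyl {0,1} D) (pull (pr 0 1 1 1) H) (pull (pr 0 1 2 3) a)"
     "agree (cyl {0,1} D) (pull (pr 1 2 2 2) H) (pull (pr 0 1 2 3) b)"
     "agree (cyl {0,1} D) (pull (pr 0 2 2 2) H) (pull (pr 0 1 2 3) c)"
  shows "slice_tri D H a b c"
  using assms unfolding slice_tri_def by blast

lemma smap_pr:
  assumes "smap (cyl V D) F" "p \<le> q" "q \<le> r" "r \<le> s" "s < 4" "\<forall>x\<in>P. pr p q r s x \<in> V"
  shows "smap (cyl P D) (pull (pr p q r s) F)"
  using assms by (intro smap_pull[OF assms(1)] mono_pr pr_image_cyl) auto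

lemma thn_pr:
  assumes "thn F (Q' \<union> \<sigma>)" "\<sigma> \<subseteq> {4..}" "pr p q r s ` Q = Q'" "p \<le> q" "q \<le> r" "r \<le> s" "s < 4"
  shows "thn (pull (pr p q r s) F) (Q \<union> \<sigma>)"
  using assms by (intro thn_pull mono_pr) (auto simp: pr_image_Un simp del: Un_insert_left)

lemma agree_restrict_pr:
  "agree U G F \<Longrightarrow> V \<subseteq> U \<Longrightarrow> agree V F (pull \<phi> K) \<Longrightarrow> agree V (pull (pr 0 1 2 3) G) (pull \<phi> K)"
  unfolding pr_id by (rule agree_trans[OF pull_id agree_trans[OF agree_mono]])

lemma agree_common: "agree U F K \<Longrightarrow> agree U G K \<Longrightarrow> agree U F G"
  using agree_trans agree_sym by blast

text \<open>Every simplex \<open>{0,1,2,3} \<union> \<sigma>\<close> is attached along its horn at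
  p. Both neighbours of p are front vertices, so the thinness conditions of these horns concern
  faces with three consecutive front vertices, and in \<open>U D\<close> such faces are simplices of
  the given triangles. The facets of the simplex that lie in \<open>U D\<close> omit a front vertex,
  so they are thin too, which makes the new triangle thin.\<close>

lemma prism_fill:
  fixes p :: nat
  defines "U \<equiv> \<lambda>D. (\<Union>i\<in>{0,1,2,3} - {p}. cyl ({0,1,2,3} - {i}) D)"
  assumes D: "fam D" and p: "p = 1 \<or> p = 2" and F: "smap (U D) F"
    and th: "\<And>i \<sigma>. i \<in> {0,1,2,3} - {p} \<Longrightarrow> \<sigma> \<in> D \<Longrightarrow> thn F ({0,1,2,3} - {i} \<union> \<sigma>)"
  obtains G where "smap (cyl {0,1,2,3} D) G" "agree (U D) G F" "\<And>\<sigma>. \<sigma> \<in> D \<Longrightarrow> thn G ({0,1,2,3} - {p} \<union> \<sigma>)"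
proof -
  let ?R = "{0,1,2,3} :: nat set"
  define X where "X = (\<lambda>\<sigma>. ?R \<union> \<sigma>) ` D"
  have D': "\<And>\<sigma>. \<sigma> \<in> D \<Longrightarrow> \<sigma> \<subseteq> {4..} \<and> finite \<sigma>" using D by (auto simp: fam_def)
  have R: "?R = {..<4}" by auto
  have inU: "S \<in> U D \<longleftrightarrow> S \<noteq> {} \<and> S \<inter> {4..} \<in> D \<and> \<not> ?R - {p} \<subseteq> S" for S
    using p unfolding U_def cyl_def R by auto
  have dU: "dclosed (U D)"
    unfolding dclosed_def
  proof (intro ballI allI impI)
    fix S T assume S: "S \<in> U D" "T \<subseteq> S" "T \<noteq> {}"
    then obtain i where "i \<in> ?R - {p}" "S \<in> cyl (?R - {i}) D" by (auto simp: U_def)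
    then show "T \<in> U D" unfolding U_def by (intro UN_I[of i] dclosedD[OF dclosed_cyl[OF D] _ S(2,3)])
  qed
  have adj: "adjacent (?R \<union> \<sigma>) (p-1) p \<and> adjacent (?R \<union> \<sigma>) p (p+1)" if "\<sigma> \<in> D" for \<sigma>
    using D'[OF that] p unfolding adjacent_def by force
  obtain G where G: "smap (U D \<union> X \<union> (\<lambda>S. S - {p}) ` X) G" "agree (U D) G F" "\<forall>S\<in>X. thn G S"
     "\<forall>S\<in>X. 4 \<le> card S \<longrightarrow> (\<forall>q\<in>S. q \<noteq> p \<longrightarrow> S - {q} \<in> U D \<longrightarrow> thn F (S - {q})) \<longrightarrow> thn G (S - {p})"
  proof (rule horn_extensions[of X "U D" F p])
    show "finite X" using D by (auto simp: X_def fam_def)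
    show "smap (U D) F" "dclosed (U D)" by fact+
  next
    fix S assume "S \<in> X"
    then obtain \<sigma> where \<sigma>: "\<sigma> \<in> D" "S = ?R \<union> \<sigma>" by (auto simp: X_def)
    show "finite S \<and> S \<notin> U D \<and> S - {p} \<notin> U D" using \<sigma> D'[OF \<sigma>(1)] p unfolding inU by auto
    show "\<exists>a b. adjacent S a p \<and> adjacent S p b \<and> (\<forall>T\<in>U D. T \<subseteq> S \<longrightarrow> {a, p, b} \<subseteq> T \<longrightarrow> thn F T)"
    proof (intro exI conjI ballI impI)
      show "adjacent S (p-1) p" "adjacent S p (p+1)" using adj \<sigma> by auto
      fix T assume T: "T \<in> U D" "T \<subseteq> S" "{p-1, p, p+1} \<subseteq> T"
      define \<tau> where "\<tau> = T \<inter> {4..}"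
      have \<tau>: "\<tau> \<in> D" using T(1) inU by (simp add: \<tau>_def)
      obtain i where i: "i \<in> ?R - {p}" "i \<notin> T" using T(1) inU by auto
      have "T = (T \<inter> {..<4}) \<union> \<tau>" unfolding \<tau>_def by auto
      moreover have "p = 1 \<and> {0,1,2} \<subseteq> T \<or> p = 2 \<and> {1,2,3} \<subseteq> T"
        using T(3) p by (auto simp: numeral_2_eq_2 numeral_3_eq_3)
      then have "T \<inter> {..<4} = ?R - {i}" using i unfolding R[symmetric] by auto
      ultimately show "thn F T" using th[OF i(1) \<tau>] by simp
    qed
    fix T assume T: "T \<subset> S" "T \<noteq> {}"
    show "T \<in> U D \<or> insert p T \<in> X"
    proof (rule disjCI)
      assume ni: "insert p T \<notin> X"
      define \<tau> where "\<tau> = T \<inter> {4..}"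
      have "\<tau> \<subseteq> \<sigma>" using T(1) \<sigma>(2) by (auto simp: \<tau>_def)
      then have \<tau>: "\<tau> \<in> D" by (rule fam_down[OF D \<sigma>(1)])
      have "\<not> ?R - {p} \<subseteq> T"
      proof
        assume "?R - {p} \<subseteq> T"
        then have "insert p T = ?R \<union> \<tau>" using p T(1) \<sigma>(2) unfolding \<tau>_def R by fastforce
        then show False using ni \<tau> by (auto simp: X_def)
      qed
      then show "T \<in> U D" unfolding inU using T(2) \<tau> by (simp add: \<tau>_def)
    qed
  qed (rule that)
  have "thn G (?R - {p} \<union> \<sigma>)" if \<sigma>: "\<sigma> \<in> D" for \<sigma>
  proof -
    have "thn G (?R \<union> \<sigma> - {p})"
    proof (rule G(4)[rule_format])
      show "?R \<union> \<sigma> \<in> X" using \<sigma> by (auto simp: X_def)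
      have "card ?R \<le> card (?R \<union> \<sigma>)" using D'[OF \<sigma>] by (intro card_mono) auto
      then show "4 \<le> card (?R \<union> \<sigma>)" by simp
      fix q assume q: "q \<in> ?R \<union> \<sigma>" "q \<noteq> p" "?R \<union> \<sigma> - {q} \<in> U D"
      have "q \<in> ?R" using q(3) D'[OF \<sigma>] unfolding inU by force
      then have "?R \<union> \<sigma> - {q} = ?R - {q} \<union> \<sigma>" using D'[OF \<sigma>] by force
      then show "thn F (?R \<union> \<sigma> - {q})" using th[of q \<sigma>] \<open>q \<in> ?R\<close> q(2) \<sigma> by simp
    qed
    moreover have "?R \<union> \<sigma> - {p} = ?R - {p} \<union> \<sigma>" using D'[OF \<sigma>] p by force
    ultimately show ?thesis by simp
  qed
  moreover have "smap (cyl ?R D) G"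
  proof (rule smap_subset[OF G(1)], rule subsetI)
    fix S assume S: "S \<in> cyl ?R D"
    define \<tau> where "\<tau> = S \<inter> {4..}"
    have \<tau>: "\<tau> \<in> D" "S \<noteq> {}" using S by (auto simp: cyl_def \<tau>_def)
    show "S \<in> U D \<union> X \<union> (\<lambda>S. S - {p}) ` X"
    proof (cases "?R - {p} \<subseteq> S")
      case False then show ?thesis using \<tau> inU[of S] unfolding \<tau>_def by simp
    next
      case True
      then have *: "insert p S = ?R \<union> \<tau>" using p unfolding \<tau>_def R by fastforce
      have "insert p S \<in> X" using \<tau> * by (auto simp: X_def)
      moreover have "S = insert p S \<or> S = insert p S - {p}" by blast
      ultimately show ?thesis by (metis Un_iff image_eqI)
    qed
  qed
  ultimately show thesis using that G(2) by blast
qed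

text \<open>Filling the prism with vertices 0, 1, 2, 3: the product (ab)c = f yields a(bc) = f with pivot 2, and
  conversely with pivot 1.\<close>

lemma slice_tri_assoc_right:
  assumes D: "fam D" and T1: "slice_tri D H1 a b d" and T2: "slice_tri D H2 b c e" and T3: "slice_tri D H3 d c f"
  shows "\<exists>H. slice_tri D H a e f"
proof -
  note t1 = slice_triD[OF T1] and t2 = slice_triD[OF T2] and t3 = slice_triD[OF T3]
  let ?U1 = "cyl {0,1,2} D" and ?U2 = "cyl {1,2,3} D" and ?U3 = "cyl {0,2,3} D"
  \<comment> \<open>\<open>pr 0 0 1 2\<close> moves the vertices 1, 2, 3 (for \<open>H2\<close>) and
    likewise 0, 2, 3 (for \<open>H3\<close>) to 0, 1, 2; its value at the absent vertex only has to
    keep it monotone.\<close>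
  let ?K1 = "pull (pr 0 1 2 3) H1" and ?K2 = "pull (pr 0 0 1 2) H2" and ?K3 = "pull (pr 0 0 1 2) H3"
  have D': "\<And>\<sigma>. \<sigma> \<in> D \<Longrightarrow> \<sigma> \<subseteq> {4..} \<and> finite \<sigma>" using D by (auto simp: fam_def)
  have s: "smap ?U1 ?K1" "smap ?U2 ?K2" "smap ?U3 ?K3"
    by (rule smap_pr[OF t1(1)] smap_pr[OF t2(1)] smap_pr[OF t3(1)]; simp add: pr_simps)+
  have "agree (cyl {0,1} D) (pull (pr 1 2 2 2) H1) (pull (pr 0 1 1 1) H2)" by (rule agree_common[OF t1(4) t2(3)])
  then have "agree (cyl {1,2} D) ?K1 ?K2"
    by (rule agree_cyl[where p=0 and q=0 and r=1 and s=1]) (simp_all add: pr_simps)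
  then have o1: "agree (?U1 \<inter> ?U2) ?K1 ?K2" by (simp add: cyl_Int)
  have "agree (cyl {0,1} D) (pull (pr 0 2 2 2) H1) (pull (pr 0 1 1 1) H3)" by (rule agree_common[OF t1(5) t3(3)])
  then have "agree (cyl {0,2} D) ?K1 ?K3"
    by (rule agree_cyl[where p=0 and q=0 and r=1 and s=1]) (simp_all add: pr_simps)
  then have o2: "agree (?U1 \<inter> ?U3) ?K1 ?K3" by (simp add: cyl_Int)
  have "agree (cyl {0,1} D) (pull (pr 1 2 2 2) H2) (pull (pr 1 2 2 2) H3)" by (rule agree_common[OF t2(4) t3(4)])
  then have "agree (cyl {2,3} D) ?K2 ?K3"
    by (rule agree_cyl[where p=0 and q=0 and r=0 and s=1]) (simp_all add: pr_simps)
  then have o3: "agree (?U2 \<inter> ?U3) ?K2 ?K3" by (simp add: cyl_Int)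
  let ?U = "?U1 \<union> ?U2 \<union> ?U3"
  obtain F where F: "smap ?U F" "dclosed ?U" "agree ?U1 F ?K1" "agree ?U2 F ?K2" "agree ?U3 F ?K3"
    using smap_glue3[OF s dclosed_cyl[OF D] dclosed_cyl[OF D] dclosed_cyl[OF D] o1 o2 o3] .
  have th: "thn F ({0,1,2} \<union> \<sigma>)" "thn F ({1,2,3} \<union> \<sigma>)" "thn F ({0,2,3} \<union> \<sigma>)" if \<sigma>: "\<sigma> \<in> D" for \<sigma>
  proof -
    have "thn ?K1 ({0,1,2} \<union> \<sigma>)" "thn ?K2 ({1,2,3} \<union> \<sigma>)" "thn ?K3 ({0,2,3} \<union> \<sigma>)"
      using D'[OF \<sigma>] by (auto intro!: thn_pr[OF t1(2)[OF \<sigma>]] thn_pr[OF t2(2)[OF \<sigma>]] thn_pr[OF t3(2)[OF \<sigma>]]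
          simp: pr_simps simp del: Un_insert_left)
    then show "thn F ({0,1,2} \<union> \<sigma>)" "thn F ({1,2,3} \<union> \<sigma>)" "thn F ({0,2,3} \<union> \<sigma>)"
      using thn_agree[OF _ agree_sym[OF F(3)]] thn_agree[OF _ agree_sym[OF F(4)]] thn_agree[OF _ agree_sym[OF F(5)]]
        D'[OF \<sigma>] \<sigma> by (auto simp: Un_in_cyl simp del: Un_insert_left)
  qed
  have Ueq: "(\<Union>i\<in>{0,1,2,3} - {2}. cyl ({0,1,2,3} - {i}) D) = ?U"
    by (auto simp: insert_Diff_if)
  obtain G where G: "smap (cyl {0,1,2,3} D) G" "agree ?U G F" "\<And>\<sigma>. \<sigma> \<in> D \<Longrightarrow> thn G ({0,1,2,3} - {2} \<union> \<sigma>)"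
  proof (rule prism_fill[OF D, of 2 F, unfolded Ueq])
    fix i \<sigma> assume "i \<in> {0,1,2,3} - {2::nat}" "\<sigma> \<in> D"
    then show "thn F ({0,1,2,3} - {i} \<union> \<sigma>)" using th[of \<sigma>] by (auto simp: insert_Diff_if)
  qed (use F in auto)
  have g1: "agree ?U1 (pull (pr 0 1 2 3) G) ?K1" and g2: "agree ?U2 (pull (pr 0 1 2 3) G) ?K2"
    and g3: "agree ?U3 (pull (pr 0 1 2 3) G) ?K3"
    by (rule agree_restrict_pr[OF G(2) _ F(3)] agree_restrict_pr[OF G(2) _ F(4)] agree_restrict_pr[OF G(2) _ F(5)]; blast)+
  \<comment> \<open>The new triangle is the face 0 1 3 opposite the pivot 2, renamed to 0 1
    2.\<close>
  define H where "H = pull (pr 0 1 3 3) G"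
  have "smap (cyl {0,1,2} D) H" unfolding H_def by (rule smap_pr[OF G(1)]) (simp_all add: pr_simps)
  moreover have "thn H ({0,1,2} \<union> \<sigma>)" if "\<sigma> \<in> D" for \<sigma>
    unfolding H_def using D'[OF that] by (intro thn_pr[OF G(3)[OF that]]) (auto simp: pr_simps)
  moreover have "agree (cyl {0,1} D) (pull (pr 0 1 1 1) G) (pull (pr 0 1 1 1) H1)"
    by (rule agree_cyl[OF g1, where p=0 and q=1 and r=1 and s=1]) (simp_all add: pr_simps)
  from agree_trans[OF this t1(3)] have "agree (cyl {0,1} D) (pull (pr 0 1 1 1) H) (pull (pr 0 1 2 3) a)"
    by (simp add: H_def pull_pull pr_comp pr_simps)
  moreover have "agree (cyl {0,1} D) (pull (pr 1 3 3 3) G) (pull (pr 0 2 2 2) H2)"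
    by (rule agree_cyl[OF g2, where p=1 and q=3 and r=3 and s=3]) (simp_all add: pr_simps)
  from agree_trans[OF this t2(5)] have "agree (cyl {0,1} D) (pull (pr 1 2 2 2) H) (pull (pr 0 1 2 3) e)"
    by (simp add: H_def pull_pull pr_comp pr_simps)
  moreover have "agree (cyl {0,1} D) (pull (pr 0 3 3 3) G) (pull (pr 0 2 2 2) H3)"
    by (rule agree_cyl[OF g3, where p=0 and q=3 and r=3 and s=3]) (simp_all add: pr_simps)
  from agree_trans[OF this t3(5)] have "agree (cyl {0,1} D) (pull (pr 0 2 2 2) H) (pull (pr 0 1 2 3) f)"
    by (simp add: H_def pull_pull pr_comp pr_simps)
  ultimately have "slice_tri D H a e f" by (intro slice_triI)
  then show ?thesis by blast
qed

lemma slice_tri_assoc_left: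
  assumes D: "fam D" and T1: "slice_tri D H1 a b d" and T2: "slice_tri D H2 b c e" and T3: "slice_tri D H3 a e f"
  shows "\<exists>H. slice_tri D H d c f"
proof -
  note t1 = slice_triD[OF T1] and t2 = slice_triD[OF T2] and t3 = slice_triD[OF T3]
  let ?U1 = "cyl {0,1,2} D" and ?U2 = "cyl {1,2,3} D" and ?U3 = "cyl {0,1,3} D"
  let ?K1 = "pull (pr 0 1 2 3) H1" and ?K2 = "pull (pr 0 0 1 2) H2" and ?K3 = "pull (pr 0 1 1 2) H3"
  have D': "\<And>\<sigma>. \<sigma> \<in> D \<Longrightarrow> \<sigma> \<subseteq> {4..} \<and> finite \<sigma>" using D by (auto simp: fam_def)
  have s: "smap ?U1 ?K1" "smap ?U2 ?K2" "smap ?U3 ?K3"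
    by (rule smap_pr[OF t1(1)] smap_pr[OF t2(1)] smap_pr[OF t3(1)]; simp add: pr_simps)+
  have "agree (cyl {0,1} D) (pull (pr 1 2 2 2) H1) (pull (pr 0 1 1 1) H2)" by (rule agree_common[OF t1(4) t2(3)])
  then have "agree (cyl {1,2} D) ?K1 ?K2"
    by (rule agree_cyl[where p=0 and q=0 and r=1 and s=1]) (simp_all add: pr_simps)
  then have o1: "agree (?U1 \<inter> ?U2) ?K1 ?K2" by (simp add: cyl_Int)
  have "agree (cyl {0,1} D) (pull (pr 0 1 1 1) H1) (pull (pr 0 1 1 1) H3)" by (rule agree_common[OF t1(3) t3(3)])
  then have "agree (cyl {0,1} D) ?K1 ?K3"
    by (rule agree_cyl[where p=0 and q=1 and r=1 and s=1]) (simp_all add: pr_simps)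
  then have o2: "agree (?U1 \<inter> ?U3) ?K1 ?K3" by (simp add: cyl_Int)
  have "agree (cyl {0,1} D) (pull (pr 0 2 2 2) H2) (pull (pr 1 2 2 2) H3)" by (rule agree_common[OF t2(5) t3(4)])
  then have "agree (cyl {1,3} D) ?K2 ?K3"
    by (rule agree_cyl[where p=0 and q=0 and r=1 and s=1]) (simp_all add: pr_simps)
  then have o3: "agree (?U2 \<inter> ?U3) ?K2 ?K3" by (simp add: cyl_Int)
  let ?U = "?U1 \<union> ?U2 \<union> ?U3"
  obtain F where F: "smap ?U F" "dclosed ?U" "agree ?U1 F ?K1" "agree ?U2 F ?K2" "agree ?U3 F ?K3"
    using smap_glue3[OF s dclosed_cyl[OF D] dclosed_cyl[OF D] dclosed_cyl[OF D] o1 o2 o3] .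
  have th: "thn F ({0,1,2} \<union> \<sigma>)" "thn F ({1,2,3} \<union> \<sigma>)" "thn F ({0,1,3} \<union> \<sigma>)" if \<sigma>: "\<sigma> \<in> D" for \<sigma>
  proof -
    have "thn ?K1 ({0,1,2} \<union> \<sigma>)" "thn ?K2 ({1,2,3} \<union> \<sigma>)" "thn ?K3 ({0,1,3} \<union> \<sigma>)"
      using D'[OF \<sigma>] by (auto intro!: thn_pr[OF t1(2)[OF \<sigma>]] thn_pr[OF t2(2)[OF \<sigma>]] thn_pr[OF t3(2)[OF \<sigma>]]
          simp: pr_simps simp del: Un_insert_left)
    then show "thn F ({0,1,2} \<union> \<sigma>)" "thn F ({1,2,3} \<union> \<sigma>)" "thn F ({0,1,3} \<union> \<sigma>)"
      using thn_agree[OF _ agree_sym[OF F(3)]] thn_agree[OF _ agree_sym[OF F(4)]] thn_agree[OF _ agree_sym[OF F(5)]]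
        D'[OF \<sigma>] \<sigma> by (auto simp: Un_in_cyl simp del: Un_insert_left)
  qed
  have Ueq: "(\<Union>i\<in>{0,1,2,3} - {1}. cyl ({0,1,2,3} - {i}) D) = ?U"
    by (auto simp: insert_Diff_if)
  obtain G where G: "smap (cyl {0,1,2,3} D) G" "agree ?U G F" "\<And>\<sigma>. \<sigma> \<in> D \<Longrightarrow> thn G ({0,1,2,3} - {1} \<union> \<sigma>)"
  proof (rule prism_fill[OF D, of 1 F, unfolded Ueq])
    fix i \<sigma> assume "i \<in> {0,1,2,3} - {1::nat}" "\<sigma> \<in> D"
    then show "thn F ({0,1,2,3} - {i} \<union> \<sigma>)" using th[of \<sigma>] by (auto simp: insert_Diff_if)
  qed (use F in auto)
  have g1: "agree ?U1 (pull (pr 0 1 2 3) G) ?K1" and g2: "agree ?U2 (pull (pr 0 1 2 3) G) ?K2"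
    and g3: "agree ?U3 (pull (pr 0 1 2 3) G) ?K3"
    by (rule agree_restrict_pr[OF G(2) _ F(3)] agree_restrict_pr[OF G(2) _ F(4)] agree_restrict_pr[OF G(2) _ F(5)]; blast)+
  \<comment> \<open>With pivot 1 the new triangle is the face 0 2 3.\<close>
  define H where "H = pull (pr 0 2 3 3) G"
  have "smap (cyl {0,1,2} D) H" unfolding H_def by (rule smap_pr[OF G(1)]) (simp_all add: pr_simps)
  moreover have "thn H ({0,1,2} \<union> \<sigma>)" if "\<sigma> \<in> D" for \<sigma>
    unfolding H_def using D'[OF that] by (intro thn_pr[OF G(3)[OF that]]) (auto simp: pr_simps)
  moreover have "agree (cyl {0,1} D) (pull (pr 0 2 2 2) G) (pull (pr 0 2 2 2) H1)"
    by (rule agree_cyl[OF g1, where p=0 and q=2 and r=2 and s=2]) (simp_all add: pr_simps)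
  from agree_trans[OF this t1(5)] have "agree (cyl {0,1} D) (pull (pr 0 1 1 1) H) (pull (pr 0 1 2 3) d)"
    by (simp add: H_def pull_pull pr_comp pr_simps)
  moreover have "agree (cyl {0,1} D) (pull (pr 2 3 3 3) G) (pull (pr 1 2 2 2) H2)"
    by (rule agree_cyl[OF g2, where p=2 and q=3 and r=3 and s=3]) (simp_all add: pr_simps)
  from agree_trans[OF this t2(4)] have "agree (cyl {0,1} D) (pull (pr 1 2 2 2) H) (pull (pr 0 1 2 3) c)"
    by (simp add: H_def pull_pull pr_comp pr_simps)
  moreover have "agree (cyl {0,1} D) (pull (pr 0 3 3 3) G) (pull (pr 0 2 2 2) H3)"
    by (rule agree_cyl[OF g3, where p=0 and q=3 and r=3 and s=3]) (simp_all add: pr_simps)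
  from agree_trans[OF this t3(5)] have "agree (cyl {0,1} D) (pull (pr 0 2 2 2) H) (pull (pr 0 1 2 3) f)"
    by (simp add: H_def pull_pull pr_comp pr_simps)
  ultimately have "slice_tri D H d c f" by (intro slice_triI)
  then show ?thesis by blast
qed

lemma thn_pr_degenerate:
  assumes "smap (cyl V D) F" "\<sigma> \<in> D" "fam D" "p \<le> q" "q \<le> r" "r \<le> s" "s < 4" "pr p q r s ` Q \<subseteq> V" "Q \<subseteq> {..<4}"
    "x \<in> Q" "y \<in> Q" "x \<noteq> y" "pr p q r s x = pr p q r s y"
  shows "thn (pull (pr p q r s) F) (Q \<union> \<sigma>)"
proof (rule thn_pull_degenerate[OF assms(1), where x=x and y=y])
  show "mono (pr p q r s)" using assms by (intro mono_pr) auto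
  have "\<sigma> \<subseteq> {4..}" using assms(2,3) by (auto simp: fam_def)
  then show "pr p q r s ` (Q \<union> \<sigma>) \<in> cyl V D"
    using assms by (intro pr_image_cyl[of _ Q D]) (auto simp: Un_in_cyl)
qed (use assms in auto)

text \<open>The degeneracy of e that repeats its first vertex: the relabelling sends 0, 1, 2 to 0,
  0, 1, which collapses the edge 01 and maps the other two edges onto e.\<close>

lemma slice_tri_unit_left:
  assumes "fam D" "smap (cyl {0,1} D) e"
  shows "slice_tri D (pull (pr 0 0 1 1) e) (pull (pr 0 0 0 0) e) e e"
proof (rule slice_triI)
  show "smap (cyl {0,1,2} D) (pull (pr 0 0 1 1) e)" by (rule smap_pr[OF assms(2)]) (auto simp: pr_simps)
  show "thn (pull (pr 0 0 1 1) e) ({0,1,2} \<union> \<sigma>)" if "\<sigma> \<in> D" for \<sigma>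
    by (rule thn_pr_degenerate[OF assms(2) that assms(1), where x=0 and y=1]) (auto simp: pr_simps)
qed (simp_all add: pull_pull pr_comp pr_simps agree_pr)

lemma slice_tri_cong:
  assumes "slice_tri D H a b c" "agree (cyl {0,1} D) (pull (pr 0 1 2 3) a) (pull (pr 0 1 2 3) a')"
    "agree (cyl {0,1} D) (pull (pr 0 1 2 3) b) (pull (pr 0 1 2 3) b')"
    "agree (cyl {0,1} D) (pull (pr 0 1 2 3) c) (pull (pr 0 1 2 3) c')"
  shows "slice_tri D H a' b' c'"
  using assms unfolding slice_tri_def by (blast intro: agree_trans)

text \<open>The map on the standard n-simplex that corresponds to x by the Yoneda lemma.\<close>

definition sx :: "nat \<Rightarrow> 'a \<Rightarrow> nat \<Rightarrow> (nat \<Rightarrow> nat) \<Rightarrow> 'a" where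
  "sx n x = (\<lambda>m \<alpha>. Act A m n \<alpha> x)"

lemma smap_sx:
  assumes "x \<in> Simp A n" shows "smap {S. S \<noteq> {} \<and> S \<subseteq> {0..n}} (sx n x)"
  unfolding smap_def sx_def
proof (intro allI ballI impI conjI)
  fix m \<alpha> assume "\<alpha> \<in> Ops m" "\<alpha> ` {0..m} \<in> {S. S \<noteq> {} \<and> S \<subseteq> {0..n}}"
  then have a: "\<alpha> \<in> ops m n" by (auto simp: ops_eq_Ops)
  then show "Act A m n \<alpha> x \<in> Simp A m" using assms Act_in by blast
  fix k \<beta> assume "\<beta> \<in> ops k m"
  then show "Act A k n (opcomp k \<beta> \<alpha>) x = Act A k m \<beta> (Act A m n \<alpha> x)" using Act_opcomp a assms by blast
qed

lemma agree_sx: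
  assumes "x \<in> Simp A n" "\<theta> \<in> ops 1 n" "\<phi> 0 = \<theta> 0" "\<phi> 1 = \<theta> 1"
  shows "agree (cyl {0,1} {{}}) (pull \<phi> (sx n x)) (pull (pr 0 1 2 3) (sx 1 (Act A 1 n \<theta> x)))"
  unfolding agree_def pr_id
proof (intro allI ballI impI)
  fix m \<alpha> assume a: "\<alpha> \<in> Ops m" "\<alpha> ` {0..m} \<in> cyl {0,1} {{}}"
  have im: "\<alpha> ` {0..m} \<subseteq> {0,1}"
  proof
    fix x assume x: "x \<in> \<alpha> ` {0..m}"
    have "\<alpha> ` {0..m} \<inter> {..<4} \<subseteq> {0,1}" "\<alpha> ` {0..m} \<inter> {4..} = {}" using a(2) by (simp_all add: cyl_def)
    then show "x \<in> {0,1}" using x by (cases "x < 4") (meson IntI lessThan_iff subsetD, auto)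
  qed
  then have ao: "\<alpha> \<in> ops m 1" using a(1) by (auto simp: ops_eq_Ops)
  have e: "opcomp m \<alpha> \<phi> = opcomp m \<alpha> \<theta>" using im assms(3,4) by (intro opcomp_cong) auto
  have i: "opcomp m \<alpha> id = \<alpha>" using a(1) by (intro opcomp_id) auto
  show "pull \<phi> (sx n x) m \<alpha> = pull id (sx 1 (Act A 1 n \<theta> x)) m \<alpha>"
    unfolding pull_def sx_def e i using Act_opcomp[OF assms(2) ao assms(1)] .
qed

end

section \<open>Inverses in a slice\<close>

text \<open>The faces opposite 2, 0 and 1 are the edges 01, 12 and 02, so s witnesses that c is a
  composite of a followed by b.\<close>

definition tri :: "'a strat \<Rightarrow> 'a \<Rightarrow> 'a \<Rightarrow> 'a \<Rightarrow> 'a \<Rightarrow> bool" where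
  "tri A s a b c \<longleftrightarrow> s \<in> Thin A 2 \<and> Act A 1 2 (face 2 2) s = a \<and> Act A 1 2 (face 2 0) s = b \<and> Act A 1 2 (face 2 1) s = c"

text \<open>The constant operator on [1]. Its action yields the degenerate 1-simplex at a vertex,
  which serves as the identity there, so that 0-simplices need not be mentioned.\<close>

definition vop :: "nat \<Rightarrow> nat \<Rightarrow> nat" where
  "vop j = (\<lambda>i. if i \<le> 1 then j else 0)"

lemma vop_in_ops: "j \<le> n \<Longrightarrow> vop j \<in> ops 1 n" by (auto simp: ops_def vop_def)

lemma cyl_empty:
  assumes "S \<in> cyl P {{}}" shows "S \<subseteq> P"
proof
  fix x assume x: "x \<in> S"
  have "S \<inter> {..<4} \<subseteq> P" "S \<inter> {4..} = {}" using assms by (simp_all add: cyl_def)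
  moreover have "x \<in> S \<inter> {..<4} \<or> x \<in> S \<inter> {4..}" using x by auto
  ultimately show "x \<in> P" by auto
qed

context inner_complicial begin

lemma thn_sx:
  assumes "s \<in> Simp A n" "\<theta> \<in> ops m n" "inj_on \<theta> {0..m}" "Act A m n \<theta> s \<in> Thin A m"
  shows "thn (sx n s) (\<theta> ` {0..m})"
proof (rule thnI[OF smap_sx[OF assms(1)]])
  show "\<theta> \<in> Ops m" "\<theta> ` {0..m} \<in> {S. S \<noteq> {} \<and> S \<subseteq> {0..n}}" using assms(2) by (auto simp: ops_eq_Ops)
  show "inj_on \<theta> {0..m}" by fact
  show "sx n s m \<theta> \<in> Thin A m" using assms(4) by (simp add: sx_def)
qed simp

text \<open>The slice maps to A by a right fibration: the horn consisting of the edges y = 12 and z = 02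
  lifts along a thin 2-simplex s of A.\<close>
lemma lift_right:
  assumes D: "fam D" and y: "smap (cyl {0,1} D) y" "marked D y" and z: "smap (cyl {0,1} D) z"
    and yz: "agree (cyl {0} D) (pull (pr 1 1 1 1) y) (pull (pr 1 1 1 1) z)"
    and s: "s \<in> Thin A 2"
    and sy: "agree (cyl {0,1} {{}}) (pull (pr 1 2 2 2) (sx 2 s)) (pull (pr 0 1 2 3) y)"
    and sz: "agree (cyl {0,1} {{}}) (pull (pr 0 2 2 2) (sx 2 s)) (pull (pr 0 1 2 3) z)"
  obtains x H where "smap (cyl {0,1} D) x" "slice_tri D H x y z"
    "agree (cyl {0,1} {{}}) (pull (pr 0 1 1 1) (sx 2 s)) (pull (pr 0 1 2 3) x)"
    "marked D z \<longrightarrow> Act A 1 2 (face 2 2) s \<in> Thin A 1 \<longrightarrow> marked D x"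
proof -
  let ?U1 = "cyl {1,2} D" and ?U2 = "cyl {0,2} D" and ?U3 = "cyl {0,1,2} {{}}"
  let ?K1 = "pull (pr 0 0 1 1) y" and ?K2 = "pull (pr 0 0 1 1) z" and ?K3 = "pull (pr 0 1 2 3) (sx 2 s)"
  let ?R = "{0,1,2} :: nat set"
  have D': "\<And>\<sigma>. \<sigma> \<in> D \<Longrightarrow> \<sigma> \<subseteq> {4..} \<and> finite \<sigma>" using D by (auto simp: fam_def)
  have D0: "{} \<in> D" "D \<inter> {{}} = {{}}" using D by (auto simp: fam_def)
  have sS: "s \<in> Simp A 2" using s Thin_Simp by blast
  have s3: "smap ?U3 (sx 2 s)"
  proof (rule smap_subset[OF smap_sx[OF sS]], rule subsetI)
    fix S assume S: "S \<in> ?U3"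
    have "S \<subseteq> {0,1,2}" "S \<noteq> {}" using cyl_empty[OF S] S by (simp_all add: cyl_def)
    then show "S \<in> {S. S \<noteq> {} \<and> S \<subseteq> {0..2}}" by auto
  qed
  have sm: "smap ?U1 ?K1" "smap ?U2 ?K2" "smap ?U3 ?K3"
    by (rule smap_pr[OF y(1)] smap_pr[OF z(1)] smap_pr[OF s3]; simp add: pr_simps)+
  have "agree (cyl {2} D) ?K1 ?K2"
    by (rule agree_cyl[OF yz, where p=0 and q=0 and r=0 and s=0]) (simp_all add: pr_simps)
  then have o1: "agree (?U1 \<inter> ?U2) ?K1 ?K2" by (simp add: cyl_Int)
  have "agree (cyl {1,2} {{}}) ?K1 ?K3"
    by (rule agree_cyl[OF agree_sym[OF sy], where p=0 and q=0 and r=1 and s=1]) (simp_all add: pr_simps)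
  then have o2: "agree (?U1 \<inter> ?U3) ?K1 ?K3" by (simp add: cyl_Int D0)
  have "agree (cyl {0,2} {{}}) ?K2 ?K3"
    by (rule agree_cyl[OF agree_sym[OF sz], where p=0 and q=0 and r=1 and s=1]) (simp_all add: pr_simps)
  then have o3: "agree (?U2 \<inter> ?U3) ?K2 ?K3" by (simp add: cyl_Int D0)
  let ?U = "?U1 \<union> ?U2 \<union> ?U3"
  obtain F where F: "smap ?U F" "dclosed ?U" "agree ?U1 F ?K1" "agree ?U2 F ?K2" "agree ?U3 F ?K3"
    using smap_glue3[OF sm dclosed_cyl[OF D] dclosed_cyl[OF D] dclosed_cyl[OF fam_empty] o1 o2 o3] .
  \<comment> \<open>The pair 0, 1 occurs only over the empty face, where s supplies it.\<close>
  have inU: "S \<in> ?U \<longleftrightarrow> S \<noteq> {} \<and> 3 \<notin> S \<and> S \<inter> {4..} \<in> D \<and> (\<not> {0,1} \<subseteq> S \<or> S \<inter> {4..} = {})" for S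
  proof -
    have lt: "{..<4} = {0,1,2,3::nat}" by auto
    show ?thesis unfolding cyl_def lt using D0 by auto
  qed
  have thy: "thn F ({1,2} \<union> \<sigma>)" if "\<sigma> \<in> D" for \<sigma>
  proof -
    have "thn ?K1 ({1,2} \<union> \<sigma>)" using y(2) that D'[OF that] unfolding marked_def
      by (intro thn_pr[of y "{0,1}"]) (auto simp: pr_simps simp del: Un_insert_left)
    then show ?thesis by (rule thn_agree[OF _ agree_sym[OF F(3)]]) (use D'[OF that] that in \<open>simp add: Un_in_cyl del: Un_insert_left\<close>)
  qed
  have thz: "thn F ({0,2} \<union> \<sigma>)" if "\<sigma> \<in> D" "marked D z" for \<sigma>
  proof -
    have "thn ?K2 ({0,2} \<union> \<sigma>)" using that D'[OF that(1)] unfolding marked_def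
      by (intro thn_pr[of z "{0,1}"]) (auto simp: pr_simps simp del: Un_insert_left)
    then show ?thesis by (rule thn_agree[OF _ agree_sym[OF F(4)]]) (use D'[OF that(1)] that in \<open>simp add: Un_in_cyl del: Un_insert_left\<close>)
  qed
  have ths: "thn F ?R"
  proof -
    have "thn (sx 2 s) (idop 2 ` {0..2})"
      using Act_id[OF sS] s by (intro thn_sx[OF sS]) (auto simp: ops_def idop_def inj_on_def)
    moreover have "idop 2 ` {0..2} = ?R" by (auto simp: idop_def)
    ultimately have "thn (sx 2 s) (?R \<union> {})" by simp
    then have "thn ?K3 (?R \<union> {})" by (intro thn_pr[of "sx 2 s" ?R]) (auto simp: pr_simps)
    then have "thn F (?R \<union> {})"
      by (rule thn_agree[OF _ agree_sym[OF F(5)]]) (auto simp: cyl_def)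
    then show ?thesis by simp
  qed
  \<comment> \<open>Over a nonempty \<sigma> the pivot 2 lies between 1 and
    \<open>Min \<sigma>\<close>. Over the empty face nothing has to be filled, because s is already
    the triangle.\<close>
  define X where "X = (\<lambda>\<sigma>. ?R \<union> \<sigma>) ` (D - {{}})"
  obtain G where G: "smap (?U \<union> X \<union> (\<lambda>S. S - {2}) ` X) G" "agree ?U G F" "\<forall>S\<in>X. thn G S"
    "\<forall>S\<in>X. 4 \<le> card S \<longrightarrow> (\<forall>q\<in>S. q \<noteq> 2 \<longrightarrow> S - {q} \<in> ?U \<longrightarrow> thn F (S - {q})) \<longrightarrow> thn G (S - {2})"
  proof (rule horn_extensions[of X ?U F 2])
    show "finite X" using D by (auto simp: X_def fam_def)
    show "smap ?U F" "dclosed ?U" by fact+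
  next
    fix S assume "S \<in> X"
    then obtain \<sigma> where \<sigma>: "\<sigma> \<in> D" "\<sigma> \<noteq> {}" "S = ?R \<union> \<sigma>" by (auto simp: X_def)
    have S4: "S \<inter> {4..} = \<sigma>" "(S - {2}) \<inter> {4..} = \<sigma>" using \<sigma>(3) D'[OF \<sigma>(1)] by auto
    show "finite S \<and> S \<notin> ?U \<and> S - {2} \<notin> ?U"
      unfolding inU S4 using \<sigma> D'[OF \<sigma>(1)] by auto
    have m: "Min \<sigma> \<in> \<sigma>" using \<sigma>(2) D'[OF \<sigma>(1)] by simp
    show "\<exists>a b. adjacent S a 2 \<and> adjacent S 2 b \<and> (\<forall>T\<in>?U. T \<subseteq> S \<longrightarrow> {a, 2, b} \<subseteq> T \<longrightarrow> thn F T)"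
    proof (intro exI conjI ballI impI)
      show "adjacent S 1 2" using \<sigma>(3) D'[OF \<sigma>(1)] by (auto simp: adjacent_def)
      have "2 < Min \<sigma>" using m D'[OF \<sigma>(1)] by auto
      then show "adjacent S 2 (Min \<sigma>)" using \<sigma>(3) m D'[OF \<sigma>(1)] by (auto simp: adjacent_def)
      fix T assume T: "T \<in> ?U" "T \<subseteq> S" "{1, 2, Min \<sigma>} \<subseteq> T"
      have "Min \<sigma> \<in> T \<inter> {4..}" using T(3) m D'[OF \<sigma>(1)] by auto
      then have 0: "0 \<notin> T" "3 \<notin> T" "T \<inter> {4..} \<in> D" using T(1) T(3) unfolding inU by auto
      have "T = {1,2} \<union> (T \<inter> {4..})"
      proof
        show "T \<subseteq> {1,2} \<union> (T \<inter> {4..})"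
        proof
          fix x assume "x \<in> T"
          then show "x \<in> {1,2} \<union> (T \<inter> {4..})" using 0(1,2) T(2) \<sigma>(3) D'[OF \<sigma>(1)] by auto
        qed
      qed (use T(3) in auto)
      then show "thn F T" using thy[OF 0(3)] by simp
    qed
    fix T assume T: "T \<subset> S" "T \<noteq> {}"
    show "T \<in> ?U \<or> insert 2 T \<in> X"
    proof (rule disjCI)
      assume ni: "insert 2 T \<notin> X"
      define \<tau> where "\<tau> = T \<inter> {4..}"
      have "\<tau> \<subseteq> \<sigma>" using T(1) S4(1) by (auto simp: \<tau>_def)
      then have \<tau>: "\<tau> \<in> D" by (rule fam_down[OF D \<sigma>(1)])
      have "\<tau> = {}" if "{0,1} \<subseteq> T"
      proof (rule ccontr)
        assume "\<tau> \<noteq> {}"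
        have "insert 2 T = ?R \<union> \<tau>"
        proof
          show "insert 2 T \<subseteq> ?R \<union> \<tau>"
          proof
            fix x assume "x \<in> insert 2 T"
            then show "x \<in> ?R \<union> \<tau>" using T(1) \<sigma>(3) D'[OF \<sigma>(1)] by (auto simp: \<tau>_def)
          qed
        qed (use that in \<open>auto simp: \<tau>_def\<close>)
        then show False using ni \<tau> \<open>\<tau> \<noteq> {}\<close> by (auto simp: X_def)
      qed
      moreover have "3 \<notin> S" using \<sigma>(3) D'[OF \<sigma>(1)] by auto
      then have "3 \<notin> T" using T(1) by blast
      ultimately show "T \<in> ?U" unfolding inU using T(2) \<tau> unfolding \<tau>_def by blast
    qed
  qed (rule that)
  have dom: "cyl ?R D \<subseteq> ?U \<union> X \<union> (\<lambda>S. S - {2}) ` X"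
  proof
    fix S assume S: "S \<in> cyl ?R D"
    define \<tau> where "\<tau> = S \<inter> {4..}"
    have lt: "S \<inter> {..<4} \<subseteq> ?R" using S by (simp add: cyl_def)
    have \<tau>: "\<tau> \<in> D" "S \<noteq> {}" "3 \<notin> S" using S unfolding cyl_def \<tau>_def by auto
    show "S \<in> ?U \<union> X \<union> (\<lambda>S. S - {2}) ` X"
    proof (cases "{0,1} \<subseteq> S \<and> \<tau> \<noteq> {}")
      case False then show ?thesis using inU[of S] \<tau> unfolding \<tau>_def by blast
    next
      case True
      have *: "insert 2 S = ?R \<union> \<tau>"
      proof
        show "insert 2 S \<subseteq> ?R \<union> \<tau>"
        proof
          fix x assume "x \<in> insert 2 S"
          then show "x \<in> ?R \<union> \<tau>" using lt by (cases "x < 4") (auto simp: \<tau>_def)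
        qed
      qed (use True in \<open>auto simp: \<tau>_def\<close>)
      have "insert 2 S \<in> X" using \<tau> True * by (auto simp: X_def)
      moreover have "S = insert 2 S \<or> S = insert 2 S - {2}" by blast
      ultimately show ?thesis by (metis Un_iff image_eqI)
    qed
  qed
  have sG: "smap (cyl ?R D) G" by (rule smap_subset[OF G(1) dom])
  have g1: "agree ?U1 (pull (pr 0 1 2 3) G) ?K1" and g2: "agree ?U2 (pull (pr 0 1 2 3) G) ?K2"
    and g3: "agree ?U3 (pull (pr 0 1 2 3) G) ?K3"
    by (rule agree_restrict_pr[OF G(2) _ F(3)] agree_restrict_pr[OF G(2) _ F(4)] agree_restrict_pr[OF G(2) _ F(5)]; blast)+
  define x where "x = pull (pr 0 1 1 1) G"
  have thG: "thn G (?R \<union> \<sigma>)" if "\<sigma> \<in> D" for \<sigma>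
  proof (cases "\<sigma> = {}")
    case True
    have "thn G ?R" by (rule thn_agree[OF ths agree_sym[OF G(2)]]) (subst inU, use D0 in auto)
    then show ?thesis using True by simp
  next
    case False then show ?thesis using G(3) that by (auto simp: X_def)
  qed
  show thesis
  proof (rule that[of x G])
    show "smap (cyl {0,1} D) x" unfolding x_def by (rule smap_pr[OF sG]) (simp_all add: pr_simps)
    show "slice_tri D G x y z"
    proof (rule slice_triI[OF sG thG])
      show "agree (cyl {0,1} D) (pull (pr 0 1 1 1) G) (pull (pr 0 1 2 3) x)"
        by (simp add: x_def pull_pull pr_comp pr_simps agree_refl)
      show "agree (cyl {0,1} D) (pull (pr 1 2 2 2) G) (pull (pr 0 1 2 3) y)"
        by (rule agree_cyl[OF g1, where p=1 and q=2 and r=2 and s=2]) (simp_all add: pr_simps)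
      show "agree (cyl {0,1} D) (pull (pr 0 2 2 2) G) (pull (pr 0 1 2 3) z)"
        by (rule agree_cyl[OF g2, where p=0 and q=2 and r=2 and s=2]) (simp_all add: pr_simps)
    qed
    show "agree (cyl {0,1} {{}}) (pull (pr 0 1 1 1) (sx 2 s)) (pull (pr 0 1 2 3) x)"
      unfolding x_def pull_pull pr_comp pr_simps
      by (rule agree_cyl[OF agree_sym[OF g3], where p=0 and q=1 and r=1 and s=1]) (simp_all add: pr_simps)
    show "marked D z \<longrightarrow> Act A 1 2 (face 2 2) s \<in> Thin A 1 \<longrightarrow> marked D x"
    proof (intro impI)
      assume mz: "marked D z" and sf: "Act A 1 2 (face 2 2) s \<in> Thin A 1"
      \<comment> \<open>Over the empty face there are too few vertices for an inner extension, and
        the thin edge 01 of s is used instead. Over other faces the facets opposite 0 and 1 are thin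
        by y and z.\<close>
      have "thn G ({0,1} \<union> \<sigma>)" if \<sigma>: "\<sigma> \<in> D" for \<sigma>
      proof (cases "\<sigma> = {}")
        case True
        have "thn (sx 2 s) (face 2 2 ` {0..1})"
          using face_in_ops[of 2 2] sf by (intro thn_sx[OF sS]) (auto simp: face_def inj_on_def)
        moreover have "face 2 2 ` {0..1} = {0,1}" by (auto simp: face_def)
        ultimately have "thn (sx 2 s) ({0,1} \<union> {})" by simp
        then have "thn ?K3 ({0,1} \<union> {})" by (intro thn_pr[of "sx 2 s" "{0,1}"]) (auto simp: pr_simps)
        then have "thn F ({0,1} \<union> {})"
          by (rule thn_agree[OF _ agree_sym[OF F(5)]]) (auto simp: cyl_def)
        then have "thn F {0,1}" by simp
        then have "thn G {0,1}" by (rule thn_agree[OF _ agree_sym[OF G(2)]]) (subst inU, use D0 in auto)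
        then show ?thesis using True by simp
      next
        case False
        have "thn G (?R \<union> \<sigma> - {2})"
        proof (rule G(4)[rule_format])
          show "?R \<union> \<sigma> \<in> X" using \<sigma> False by (auto simp: X_def)
          obtain j where "j \<in> \<sigma>" using False by auto
          then have "{0,1,2,j} \<subseteq> ?R \<union> \<sigma>" "card {0,1,2,j} = 4" using D'[OF \<sigma>] by auto
          then show "4 \<le> card (?R \<union> \<sigma>)" using D'[OF \<sigma>] card_mono[of "?R \<union> \<sigma>" "{0,1,2,j}"] by simp
          fix q assume q: "q \<in> ?R \<union> \<sigma>" "q \<noteq> 2" "?R \<union> \<sigma> - {q} \<in> ?U"
          consider "q = 0" | "q = 1" | "q \<in> \<sigma>" using q by auto
          then show "thn F (?R \<union> \<sigma> - {q})"
          proof cases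
            case 1
            then have "?R \<union> \<sigma> - {q} = {1,2} \<union> \<sigma>" using D'[OF \<sigma>] by auto
            then show ?thesis using thy[OF \<sigma>] by simp
          next
            case 2
            then have "?R \<union> \<sigma> - {q} = {0,2} \<union> \<sigma>" using D'[OF \<sigma>] by auto
            then show ?thesis using thz[OF \<sigma> mz] by simp
          next
            case 3
            have q4: "4 \<le> q" using 3 D'[OF \<sigma>] by auto
            have "(?R \<union> \<sigma> - {q}) \<inter> {4..} = \<sigma> - {q}" using D'[OF \<sigma>] by auto
            moreover have "{0,1} \<subseteq> ?R \<union> \<sigma> - {q}" using q4 by auto
            \<comment> \<open>A set containing 0 and 1 belongs to the given complex only over the
              empty face, so \<sigma> is the single vertex q and the facet in question is s.\<close>
            ultimately have "\<sigma> - {q} = {}" using q(3) unfolding inU by auto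
            then have "?R \<union> \<sigma> - {q} = ?R" using q4 by auto
            then show ?thesis using ths by simp
          qed
        qed
        moreover have "?R \<union> \<sigma> - {2} = {0,1} \<union> \<sigma>" using D'[OF \<sigma>] by auto
        ultimately show ?thesis by simp
      qed
      then show "marked D x" unfolding marked_def x_def
        using D' by (auto intro!: thn_pr[of G "{0,1}"] simp: pr_simps simp del: Un_insert_left)
    qed
  qed
qed

end

text \<open>Invertibility up to thin triangles, written with composition from left to right: s
  witnesses v w = 1 at the source of v, and t witnesses w v = 1 at its target. These are the images
  of the words -+- and +-+.\<close>

definition is_equiv :: "'a strat \<Rightarrow> 'a \<Rightarrow> bool" where
  "is_equiv A v \<longleftrightarrow> v \<in> Simp A 1 \<and> (\<exists>w s t. w \<in> Simp A 1 \<and>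
     tri A s v w (Act A 1 1 (vop 0) v) \<and> tri A t w v (Act A 1 1 (vop 1) v))"

lemma opcomp_vop: "j \<le> 1 \<Longrightarrow> opcomp 1 (vop j) \<theta> = vop (\<theta> j)"
  by (auto simp: opcomp_def vop_def fun_eq_iff)

lemma face2_simps: "face 2 0 0 = 1" "face 2 0 1 = 2" "face 2 1 0 = 0" "face 2 1 1 = 2" "face 2 2 0 = 0" "face 2 2 1 = 1"
  by (auto simp: face_def)

lemma face2_in_ops: "face 2 0 \<in> ops 1 2" "face 2 1 \<in> ops 1 2" "face 2 2 \<in> ops 1 2"
  using face_in_ops[of 2 0] face_in_ops[of 2 1] face_in_ops[of 2 2] by auto

section \<open>Invertible 1-simplices and the lifting of their inverses\<close>

context inner_complicial begin

lemma Act_vop: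
  assumes "\<theta> \<in> ops 1 n" "x \<in> Simp A n" "j \<le> 1"
  shows "Act A 1 1 (vop j) (Act A 1 n \<theta> x) = Act A 1 n (vop (\<theta> j)) x"
  using Act_opcomp[OF assms(1) vop_in_ops[OF assms(3)] assms(2)] opcomp_vop[OF assms(3)] by simp

lemma triD:
  assumes "tri A s a b c"
  shows "s \<in> Thin A 2" "s \<in> Simp A 2" "Act A 1 2 (face 2 2) s = a" "Act A 1 2 (face 2 0) s = b" "Act A 1 2 (face 2 1) s = c"
    "a \<in> Simp A 1" "b \<in> Simp A 1" "c \<in> Simp A 1"
  using assms Thin_Simp Act_in face2_in_ops unfolding tri_def by auto

lemma tri_ends:
  assumes "tri A s a b c"
  shows "Act A 1 1 (vop 0) c = Act A 1 1 (vop 0) a" "Act A 1 1 (vop 1) a = Act A 1 1 (vop 0) b" "Act A 1 1 (vop 1) c = Act A 1 1 (vop 1) b"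
  using Act_vop[OF face2_in_ops(1) triD(2)[OF assms]] Act_vop[OF face2_in_ops(2) triD(2)[OF assms]]
    Act_vop[OF face2_in_ops(3) triD(2)[OF assms]] triD[OF assms] by (simp_all add: face2_simps flip: One_nat_def)

lemma vop_vop: "v \<in> Simp A 1 \<Longrightarrow> i \<le> 1 \<Longrightarrow> j \<le> 1 \<Longrightarrow> Act A 1 1 (vop i) (Act A 1 1 (vop j) v) = Act A 1 1 (vop j) v"
  using Act_vop[OF vop_in_ops[of j 1], of v i] by (simp add: vop_def[of j] flip: One_nat_def)

lemma is_equivE:
  assumes "is_equiv A v"
  obtains w s t where "is_equiv A w" "w \<in> Simp A 1" "v \<in> Simp A 1"
    "tri A s v w (Act A 1 1 (vop 0) v)" "tri A t w v (Act A 1 1 (vop 1) v)"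
    "Act A 1 1 (vop 1) w = Act A 1 1 (vop 0) v" "Act A 1 1 (vop 0) w = Act A 1 1 (vop 1) v"
proof -
  obtain w s t where w: "w \<in> Simp A 1" "v \<in> Simp A 1"
    "tri A s v w (Act A 1 1 (vop 0) v)" "tri A t w v (Act A 1 1 (vop 1) v)"
    using assms unfolding is_equiv_def by blast
  have e: "Act A 1 1 (vop 1) w = Act A 1 1 (vop 0) v" "Act A 1 1 (vop 0) w = Act A 1 1 (vop 1) v"
    using tri_ends[OF w(3)] tri_ends[OF w(4)] vop_vop[OF w(2)] by simp_all
  have "is_equiv A w" unfolding is_equiv_def e using w by blast
  then show thesis using that w e by blast
qed

text \<open>The projection from the slice to A: restriction to the empty face leaves only the
  underlying 1-simplex.\<close>

abbreviation over :: "'a opfun \<Rightarrow> 'a \<Rightarrow> bool" where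
  "over e v \<equiv> agree (cyl {0,1} {{}}) (pull (pr 0 1 2 3) e) (pull (pr 0 1 2 3) (sx 1 v))"

text \<open>The triangle t with edges w, v, 1 is lifted by \<open>lift_right\<close>, with e as edge
  12 and the degenerate edge at the end of e as edge 02. The degenerate edge is marked, so the
  lifted edge 01, which lies over the thin w, is marked as well.\<close>

lemma right_inverse:
  assumes D: "fam D" and e: "smap (cyl {0,1} D) e" "marked D e" and ev: "over e v"
    and t: "tri A t w v (Act A 1 1 (vop 1) v)" "w \<in> Thin A 1"
  obtains x H where "smap (cyl {0,1} D) x" "marked D x" "slice_tri D H x e (pull (pr 1 1 1 1) e)" "over x w"
proof -
  note t' = triD[OF t(1)]
  let ?z = "pull (pr 1 1 1 1) e"
  have z: "smap (cyl {0,1} D) ?z" by (rule smap_pr[OF e(1)]) (simp_all add: pr_simps)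
  have yz: "agree (cyl {0} D) (pull (pr 1 1 1 1) e) (pull (pr 1 1 1 1) ?z)"
    by (simp add: pull_pull pr_comp pr_simps agree_refl del: One_nat_def)
  have "agree (cyl {0,1} {{}}) (pull (pr 1 2 2 2) (sx 2 t)) (pull (pr 0 1 2 3) (sx 1 (Act A 1 2 (face 2 0) t)))"
    by (rule agree_sx[OF t'(2) face2_in_ops(1)]) (simp_all only: pr_simps face2_simps)
  then have sy: "agree (cyl {0,1} {{}}) (pull (pr 1 2 2 2) (sx 2 t)) (pull (pr 0 1 2 3) e)"
    unfolding t'(4) by (rule agree_trans[OF _ agree_sym[OF ev]])
  have 1: "agree (cyl {0,1} {{}}) (pull (pr 0 2 2 2) (sx 2 t)) (pull (pr 0 1 2 3) (sx 1 (Act A 1 2 (face 2 1) t)))"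
    by (rule agree_sx[OF t'(2) face2_in_ops(2)]) (simp_all only: pr_simps face2_simps)
  have 2: "agree (cyl {0,1} {{}}) (pull (pr 1 1 1 1) (sx 1 v)) (pull (pr 0 1 2 3) (sx 1 (Act A 1 1 (vop 1) v)))"
    by (rule agree_sx[OF t'(7) vop_in_ops]) (simp_all add: pr_simps vop_def)
  have 3: "agree (cyl {0,1} {{}}) (pull (pr 1 1 1 1) e) (pull (pr 1 1 1 1) (sx 1 v))"
    by (rule agree_cyl[OF ev, where p=1 and q=1 and r=1 and s=1]) (simp_all add: pr_simps)
  have sz: "agree (cyl {0,1} {{}}) (pull (pr 0 2 2 2) (sx 2 t)) (pull (pr 0 1 2 3) ?z)"
    using agree_common[OF 1[unfolded t'(5)] agree_trans[OF 3 2]] by (simp add: pull_pull pr_comp pr_simps)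
  have mz: "marked D ?z" unfolding marked_def
  proof
    fix \<sigma> assume "\<sigma> \<in> D"
    then show "thn ?z ({0,1} \<union> \<sigma>)"
      by (rule thn_pr_degenerate[OF e(1) _ D, where x=0 and y=1]) (simp_all add: pr_simps)
  qed
  obtain x H where x: "smap (cyl {0,1} D) x" "slice_tri D H x e ?z"
    "agree (cyl {0,1} {{}}) (pull (pr 0 1 1 1) (sx 2 t)) (pull (pr 0 1 2 3) x)"
    "marked D ?z \<longrightarrow> Act A 1 2 (face 2 2) t \<in> Thin A 1 \<longrightarrow> marked D x"
    using lift_right[OF D e z yz t'(1) sy sz] .
  have "agree (cyl {0,1} {{}}) (pull (pr 0 1 1 1) (sx 2 t)) (pull (pr 0 1 2 3) (sx 1 (Act A 1 2 (face 2 2) t)))"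
    by (rule agree_sx[OF t'(2) face2_in_ops(3)]) (simp_all only: pr_simps face2_simps)
  then have "over x w" unfolding t'(3) by (rule agree_trans[OF agree_sym[OF x(3)]])
  moreover have "marked D x" using x(4) mz t'(3) t(2) by simp
  ultimately show thesis using that x(1,2) by blast
qed

text \<open>The right inverse x of e has a right inverse e' in turn; then e' is homotopic to e by
  associativity, so x is also a left inverse of e.\<close>
lemma left_inverse:
  assumes D: "fam D" and e: "smap (cyl {0,1} D) e" "marked D e" and ev: "over e v"
    and eq: "is_equiv A v" and thin: "\<And>v. is_equiv A v \<Longrightarrow> v \<in> Thin A 1"
  obtains x H where "smap (cyl {0,1} D) x" "marked D x" "slice_tri D H e x (pull (pr 0 0 0 0) e)"
proof -
  obtain w s t where w: "is_equiv A w"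
    "tri A s v w (Act A 1 1 (vop 0) v)" "tri A t w v (Act A 1 1 (vop 1) v)"
    "Act A 1 1 (vop 1) w = Act A 1 1 (vop 0) v"
    using is_equivE[OF eq] by metis
  obtain x H1 where x: "smap (cyl {0,1} D) x" "marked D x" "slice_tri D H1 x e (pull (pr 1 1 1 1) e)" "over x w"
    using right_inverse[OF D e ev w(3) thin[OF w(1)]] .
  obtain e' H2 where e': "slice_tri D H2 e' x (pull (pr 1 1 1 1) x)"
    using right_inverse[OF D x(1,2,4) w(2)[folded w(4)] thin[OF eq]] .
  note t1 = slice_triD[OF x(3)]
  \<comment> \<open>The triangle x e = 1 forces x to run from the end of e to its start, so the
    identity at the end of x is the one at the start of e, and conversely for
    \<open>c2\<close>.\<close>
  have "agree (cyl {0,1} D) (pull (pr 1 1 1 1) H1) (pull (pr 1 1 1 1) x)"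
    by (rule agree_cyl[OF t1(3), where p=1 and q=1 and r=1 and s=1]) (simp_all add: pr_simps)
  moreover have "agree (cyl {0,1} D) (pull (pr 1 1 1 1) H1) (pull (pr 0 0 0 0) e)"
    by (rule agree_cyl[OF t1(4), where p=0 and q=0 and r=0 and s=0]) (simp_all add: pr_simps)
  ultimately have c1: "agree (cyl {0,1} D) (pull (pr 0 0 0 0) e) (pull (pr 1 1 1 1) x)"
    using agree_trans agree_sym by blast
  have "agree (cyl {0,1} D) (pull (pr 0 0 0 0) H1) (pull (pr 0 0 0 0) x)"
    by (rule agree_cyl[OF t1(3), where p=0 and q=0 and r=0 and s=0]) (simp_all add: pr_simps)
  moreover have "agree (cyl {0,1} D) (pull (pr 0 0 0 0) H1) (pull (pr 1 1 1 1) e)"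
    by (rule agree_cyl[OF t1(5)[unfolded pull_pull pr_comp pr_simps], where p=0 and q=0 and r=0 and s=0]) (simp_all add: pr_simps)
  ultimately have c2: "agree (cyl {0,1} D) (pull (pr 0 0 0 0) x) (pull (pr 1 1 1 1) e)"
    using agree_trans agree_sym by blast
  have "slice_tri D (pull (pr 0 0 1 1) e) (pull (pr 1 1 1 1) x) e e"
    by (rule slice_tri_cong[OF slice_tri_unit_left[OF D e(1)]]) (simp_all add: c1 pull_pull pr_comp pr_simps agree_refl del: One_nat_def)
  \<comment> \<open>From e' x = 1, x e = 1 and 1 e = e the prism yields e' 1 = e. This is the
    homotopy between e' and e in the form that the next prism consumes.\<close>
  from slice_tri_assoc_right[OF D e' x(3) this] obtain H3 where H3: "slice_tri D H3 e' (pull (pr 1 1 1 1) e) e" by blast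
  have "slice_tri D (pull (pr 0 0 1 1) x) (pull (pr 1 1 1 1) e) x x"
    by (rule slice_tri_cong[OF slice_tri_unit_left[OF D x(1)]]) (simp_all add: c2 pull_pull pr_comp pr_simps agree_refl del: One_nat_def)
  \<comment> \<open>With e' 1 = e, 1 x = x and e' x = 1, regrouping e' 1 x yields e x = 1.\<close>
  from slice_tri_assoc_left[OF D H3 this e'] obtain H4 where "slice_tri D H4 e x (pull (pr 1 1 1 1) x)" by blast
  then have "slice_tri D H4 e x (pull (pr 0 0 0 0) e)"
    by (rule slice_tri_cong) (simp_all add: agree_sym[OF c1] pull_pull pr_comp pr_simps agree_refl del: One_nat_def)
  then show thesis using that x by blast
qed

section \<open>Composition in A as the slice over the empty complex\<close>

lemma slice_tri_of_tri:
  assumes "tri A s a b c"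
  shows "slice_tri {{}} (sx 2 s) (sx 1 a) (sx 1 b) (sx 1 c)"
proof (rule slice_triI)
  note t = triD[OF assms]
  show "smap (cyl {0,1,2} {{}}) (sx 2 s)"
  proof (rule smap_subset[OF smap_sx[OF t(2)]], rule subsetI)
    fix S assume S: "S \<in> cyl {0,1,2} {{}}"
    have "S \<subseteq> {0,1,2}" "S \<noteq> {}" using cyl_empty[OF S] S by (simp_all add: cyl_def)
    then show "S \<in> {S. S \<noteq> {} \<and> S \<subseteq> {0..2}}" by auto
  qed
  have "thn (sx 2 s) (idop 2 ` {0..2})"
    using Act_id[OF t(2)] t(1) by (intro thn_sx[OF t(2)]) (auto simp: ops_def idop_def inj_on_def)
  moreover have "idop 2 ` {0..2} = {0,1,2}" by (auto simp: idop_def)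
  ultimately show "thn (sx 2 s) ({0,1,2} \<union> \<sigma>)" if "\<sigma> \<in> {{}}" for \<sigma> using that by simp
  show "agree (cyl {0,1} {{}}) (pull (pr 0 1 1 1) (sx 2 s)) (pull (pr 0 1 2 3) (sx 1 a))"
    unfolding t(3)[symmetric] by (rule agree_sx[OF t(2) face2_in_ops(3)]) (simp_all only: pr_simps face2_simps)
  show "agree (cyl {0,1} {{}}) (pull (pr 1 2 2 2) (sx 2 s)) (pull (pr 0 1 2 3) (sx 1 b))"
    unfolding t(4)[symmetric] by (rule agree_sx[OF t(2) face2_in_ops(1)]) (simp_all only: pr_simps face2_simps)
  show "agree (cyl {0,1} {{}}) (pull (pr 0 2 2 2) (sx 2 s)) (pull (pr 0 1 2 3) (sx 1 c))"
    unfolding t(5)[symmetric] by (rule agree_sx[OF t(2) face2_in_ops(2)]) (simp_all only: pr_simps face2_simps)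
qed

lemma idop_Ops: "idop n \<in> Ops n" by (auto simp: idop_def Ops_def)

text \<open>The 2-simplex is recovered as the value at the identity of [2], and each edge equation
  by evaluating an agreement on {0, 1} at the identity of [1].\<close>

lemma tri_of_slice_tri:
  assumes "slice_tri {{}} H (sx 1 a) (sx 1 b) (sx 1 c)" "a \<in> Simp A 1" "b \<in> Simp A 1" "c \<in> Simp A 1"
  shows "tri A (H 2 (idop 2)) a b c"
proof -
  note t = slice_triD[OF assms(1)]
  have im: "idop 2 ` {0..2} = {0,1,2} \<union> {}" by (auto simp: idop_def)
  have U: "{0,1,2} \<union> {} \<in> cyl {0,1,2} {{}}" by (subst Un_in_cyl) auto
  have th: "H 2 (idop 2) \<in> Thin A 2" using t(2)[of "{}"] idop_Ops im unfolding thn_def by blast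
  have im1: "idop 1 ` {0..1} \<in> cyl {0,1} {{}}" by (auto simp: idop_def cyl_def)
  have key: "Act A 1 2 \<theta> (H 2 (idop 2)) = d"
    if "\<theta> \<in> ops 1 2" "d \<in> Simp A 1" "agree (cyl {0,1} {{}}) (pull \<phi> H) (pull (pr 0 1 2 3) (sx 1 d))" "\<phi> 0 = \<theta> 0" "\<phi> 1 = \<theta> 1" for \<theta> d \<phi>
  proof -
    have "Act A 1 2 \<theta> (H 2 (idop 2)) = H 1 (opcomp 1 \<theta> (idop 2))"
      using smap_Act[OF t(1) idop_Ops _ that(1)] im U by simp
    also have "opcomp 1 \<theta> (idop 2) = opcomp 1 (idop 1) \<phi>"
      using that(1,4,5) by (auto simp: opcomp_def idop_def ops_def fun_eq_iff le_Suc_eq)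
    also have "H 1 (opcomp 1 (idop 1) \<phi>) = pull (pr 0 1 2 3) (sx 1 d) 1 (idop 1)"
      using that(3) idop_Ops im1 unfolding agree_def pull_def by blast
    also have "\<dots> = Act A 1 1 (idop 1) d"
      unfolding pull_def sx_def pr_id using opcomp_id[OF idop_Ops] by simp
    finally show ?thesis using Act_id[OF that(2)] by simp
  qed
  show ?thesis unfolding tri_def
    using th key[OF face2_in_ops(3) assms(2) t(3)] key[OF face2_in_ops(1) assms(3) t(4)] key[OF face2_in_ops(2) assms(4) t(5)]
    by (simp add: pr_simps face2_simps del: One_nat_def)
qed

lemma tri_assoc_right:
  assumes "tri A s1 a b d" "tri A s2 b c e" "tri A s3 d c f"
  shows "\<exists>s. tri A s a e f"
proof -
  obtain H where H: "slice_tri {{}} H (sx 1 a) (sx 1 e) (sx 1 f)"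
    using slice_tri_assoc_right[OF fam_empty slice_tri_of_tri[OF assms(1)] slice_tri_of_tri[OF assms(2)] slice_tri_of_tri[OF assms(3)]] by blast
  from tri_of_slice_tri[OF this] triD[OF assms(1)] triD[OF assms(2)] triD[OF assms(3)] show ?thesis by blast
qed

lemma tri_assoc_left:
  assumes "tri A s1 a b d" "tri A s2 b c e" "tri A s3 a e f"
  shows "\<exists>s. tri A s d c f"
proof -
  obtain H where H: "slice_tri {{}} H (sx 1 d) (sx 1 c) (sx 1 f)"
    using slice_tri_assoc_left[OF fam_empty slice_tri_of_tri[OF assms(1)] slice_tri_of_tri[OF assms(2)] slice_tri_of_tri[OF assms(3)]] by blast
  from tri_of_slice_tri[OF this] triD[OF assms(1)] triD[OF assms(2)] triD[OF assms(3)] show ?thesis by blast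
qed

lemma smap_sx1: "v \<in> Simp A 1 \<Longrightarrow> smap (cyl {0,1} {{}}) (sx 1 v)"
proof (rule smap_subset[OF smap_sx], assumption, rule subsetI)
  fix S assume S: "S \<in> cyl {0,1} {{}}"
  have "S \<subseteq> {0,1}" "S \<noteq> {}" using cyl_empty[OF S] S by (simp_all add: cyl_def)
  then show "S \<in> {S. S \<noteq> {} \<and> S \<subseteq> {0..1}}" by auto
qed

lemma tri_unit_left:
  assumes "v \<in> Simp A 1" shows "\<exists>s. tri A s (Act A 1 1 (vop 0) v) v v"
proof -
  have "agree (cyl {0,1} {{}}) (pull (pr 0 0 0 0) (sx 1 v)) (pull (pr 0 1 2 3) (sx 1 (Act A 1 1 (vop 0) v)))"
    by (rule agree_sx[OF assms vop_in_ops]) (simp_all add: pr_simps vop_def)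
  then have "slice_tri {{}} (pull (pr 0 0 1 1) (sx 1 v)) (sx 1 (Act A 1 1 (vop 0) v)) (sx 1 v) (sx 1 v)"
    by (intro slice_tri_cong[OF slice_tri_unit_left[OF fam_empty smap_sx1[OF assms]]]) (simp_all add: pull_pull pr_comp pr_simps agree_refl del: One_nat_def)
  from tri_of_slice_tri[OF this Act_in[OF vop_in_ops assms] assms assms] show ?thesis by blast
qed

text \<open>Two consecutive edges form the inner horn of dimension 2; the composite is the third
  edge of a filler.\<close>

lemma tri_composite:
  assumes a: "a \<in> Simp A 1" and b: "b \<in> Simp A 1" and ab: "Act A 1 1 (vop 1) a = Act A 1 1 (vop 0) b"
  shows "\<exists>s c. tri A s a b c"
proof -
  let ?U1 = "cyl {0,1} {{}}" and ?U2 = "cyl {1,2} {{}}"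
  let ?K1 = "pull (pr 0 1 2 3) (sx 1 a)" and ?K2 = "pull (pr 0 0 1 1) (sx 1 b)"
  let ?R = "{0,1,2} :: nat set"
  have sm: "smap ?U1 ?K1" "smap ?U2 ?K2"
    by (rule smap_pr[OF smap_sx1[OF a]] smap_pr[OF smap_sx1[OF b]]; simp add: pr_simps)+
  have "agree (cyl {0,1} {{}}) (pull (pr 1 1 1 1) (sx 1 a)) (pull (pr 0 1 2 3) (sx 1 (Act A 1 1 (vop 1) a)))"
    by (rule agree_sx[OF a vop_in_ops]) (simp_all add: pr_simps vop_def)
  moreover have "agree (cyl {0,1} {{}}) (pull (pr 0 0 0 0) (sx 1 b)) (pull (pr 0 1 2 3) (sx 1 (Act A 1 1 (vop 0) b)))"
    by (rule agree_sx[OF b vop_in_ops]) (simp_all add: pr_simps vop_def)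
  ultimately have "agree (cyl {0,1} {{}}) (pull (pr 1 1 1 1) (sx 1 a)) (pull (pr 0 0 0 0) (sx 1 b))"
    unfolding ab by (rule agree_common)
  then have "agree (cyl {1} {{}}) ?K1 ?K2"
    by (rule agree_cyl[where p=0 and q=0 and r=0 and s=0]) (simp_all add: pr_simps)
  then have o: "agree (?U1 \<inter> ?U2) ?K1 ?K2" by (simp add: cyl_Int)
  obtain F where F: "smap (?U1 \<union> ?U2) F" "agree ?U1 F ?K1" "agree ?U2 F ?K2"
    using smap_glue[OF sm dclosed_cyl[OF fam_empty] dclosed_cyl[OF fam_empty] o] .
  have d: "dclosed (?U1 \<union> ?U2)" by (intro dclosed_Un dclosed_cyl fam_empty)
  have inU: "S \<in> ?U1 \<union> ?U2 \<longleftrightarrow> S \<noteq> {} \<and> (S \<subseteq> {0,1} \<or> S \<subseteq> {1,2})" for S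
  proof
    show "S \<in> ?U1 \<union> ?U2 \<Longrightarrow> S \<noteq> {} \<and> (S \<subseteq> {0,1} \<or> S \<subseteq> {1,2})"
      using cyl_empty[of S "{0,1}"] cyl_empty[of S "{1,2}"] by (auto simp: cyl_def)
    assume S: "S \<noteq> {} \<and> (S \<subseteq> {0,1} \<or> S \<subseteq> {1,2})"
    then have "S \<subseteq> {0,1,2}" by auto
    then have "S \<inter> {4..} = {}" by auto
    then show "S \<in> ?U1 \<union> ?U2" using S by (auto simp: cyl_def)
  qed
  obtain G where G: "smap (?U1 \<union> ?U2 \<union> {?R, ?R - {1}}) G" "agree (?U1 \<union> ?U2) G F" "thn G ?R"
  proof (rule horn_extension[OF F(1), of ?R 1 0 2])
    show "finite ?R" by simp
    show "?R \<notin> ?U1 \<union> ?U2" unfolding inU by auto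
    have "?R - {1} = {0,2}" by auto
    then show "?R - {1} \<notin> ?U1 \<union> ?U2" using inU[of "{0,2}"] by simp
    show "dclosed (?U1 \<union> ?U2)" by fact
    show "adjacent ?R 0 1" "adjacent ?R 1 2" by (auto simp: adjacent_def)
    fix T assume "T \<in> ?U1 \<union> ?U2" "{0,1,2} \<subseteq> T" then show "thn F T" unfolding inU by auto
  next
    fix T assume "T \<subset> ?R" "T \<noteq> {}" "T \<noteq> ?R - {1}"
    then show "T \<in> ?U1 \<union> ?U2" unfolding inU by auto
  qed (rule that)
  have sG: "smap (cyl ?R {{}}) G"
  proof (rule smap_subset[OF G(1)], rule subsetI)
    fix S assume S: "S \<in> cyl ?R {{}}"
    have "S \<subseteq> ?R" "S \<noteq> {}" using cyl_empty[OF S] S by (simp_all add: cyl_def)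
    then show "S \<in> ?U1 \<union> ?U2 \<union> {?R, ?R - {1}}" using inU[of S] by blast
  qed
  define s where "s = G 2 (idop 2)"
  define c where "c = Act A 1 2 (face 2 1) s"
  have g1: "agree ?U1 (pull (pr 0 1 2 3) G) ?K1" and g2: "agree ?U2 (pull (pr 0 1 2 3) G) ?K2"
    by (rule agree_restrict_pr[OF G(2) _ F(2)] agree_restrict_pr[OF G(2) _ F(3)]; blast)+
  have im: "idop 2 ` {0..2} = ?R" by (auto simp: idop_def)
  have sT: "s \<in> Thin A 2" using G(3) idop_Ops im unfolding thn_def s_def by blast
  have sS: "s \<in> Simp A 2" by (rule Thin_Simp[OF sT])
  have cS: "c \<in> Simp A 1" unfolding c_def by (rule Act_in[OF face2_in_ops(2) sS])
  have Gs: "agree (cyl ?R {{}}) (pull (pr 0 1 2 3) (sx 2 s)) (pull (pr 0 1 2 3) G)"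
    unfolding agree_def pr_id
  proof (intro allI ballI impI)
    fix m \<alpha> assume al: "\<alpha> \<in> Ops m" "\<alpha> ` {0..m} \<in> cyl ?R {{}}"
    have "\<alpha> ` {0..m} \<subseteq> ?R" by (rule cyl_empty[OF al(2)])
    then have im2: "\<alpha> ` {0..m} \<subseteq> {0..2}" by auto
    then have ao: "\<alpha> \<in> ops m 2" using al(1) by (simp add: ops_eq_Ops)
    have "idop 2 ` {0..2} \<in> cyl ?R {{}}" unfolding im by (auto simp: cyl_def)
    then have "G m (opcomp m \<alpha> (idop 2)) = Act A m 2 \<alpha> s" unfolding s_def by (rule smap_Act[OF sG idop_Ops _ ao])
    moreover have "opcomp m \<alpha> (idop 2) = \<alpha>" using im2 by (intro opcomp_id[OF al(1)]) (auto simp: idop_def)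
    moreover have "opcomp m \<alpha> id = \<alpha>" using al(1) by (intro opcomp_id) auto
    ultimately show "pull id (sx 2 s) m \<alpha> = pull id G m \<alpha>" by (simp add: pull_def sx_def)
  qed
  have "slice_tri {{}} G (sx 1 a) (sx 1 b) (sx 1 c)"
  proof (rule slice_triI[OF sG])
    show "thn G (?R \<union> \<sigma>)" if "\<sigma> \<in> {{}}" for \<sigma> using that G(3) by simp
    show "agree (cyl {0,1} {{}}) (pull (pr 0 1 1 1) G) (pull (pr 0 1 2 3) (sx 1 a))"
      by (rule agree_cyl[OF g1, where p=0 and q=1 and r=1 and s=1]) (simp_all add: pr_simps)
    show "agree (cyl {0,1} {{}}) (pull (pr 1 2 2 2) G) (pull (pr 0 1 2 3) (sx 1 b))"
      by (rule agree_cyl[OF g2, where p=1 and q=2 and r=2 and s=2]) (simp_all add: pr_simps)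
    have 1: "agree (cyl {0,1} {{}}) (pull (pr 0 2 2 2) (sx 2 s)) (pull (pr 0 2 2 2) G)"
      by (rule agree_cyl[OF Gs, where p=0 and q=2 and r=2 and s=2]) (simp_all add: pr_simps)
    have 2: "agree (cyl {0,1} {{}}) (pull (pr 0 2 2 2) (sx 2 s)) (pull (pr 0 1 2 3) (sx 1 c))"
      unfolding c_def by (rule agree_sx[OF sS face2_in_ops(2)]) (simp_all only: pr_simps face2_simps)
    show "agree (cyl {0,1} {{}}) (pull (pr 0 2 2 2) G) (pull (pr 0 1 2 3) (sx 1 c))"
      by (rule agree_trans[OF agree_sym[OF 1] 2])
  qed
  from tri_of_slice_tri[OF this a b cS] show ?thesis by blast
qed

text \<open>With primes for inverses, c' = b' a' is inverse to c. The triangles \<open>u2\<close>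
  and \<open>u5\<close> say b c' = a' and a' c = b; then c c' = a (b c') = a a' = 1 and c' c = b'
  (a' c) = b' b = 1, which are \<open>u3\<close> and \<open>u6\<close>.\<close>

lemma is_equiv_composite:
  assumes "tri A s a b c" "is_equiv A a" "is_equiv A b"
  shows "is_equiv A c"
proof -
  obtain a' s1 t1 where a: "a' \<in> Simp A 1" "a \<in> Simp A 1"
    "tri A s1 a a' (Act A 1 1 (vop 0) a)" "tri A t1 a' a (Act A 1 1 (vop 1) a)"
    "Act A 1 1 (vop 1) a' = Act A 1 1 (vop 0) a" "Act A 1 1 (vop 0) a' = Act A 1 1 (vop 1) a"
    using is_equivE[OF assms(2)] by metis
  obtain b' s2 t2 where b: "b' \<in> Simp A 1" "b \<in> Simp A 1"
    "tri A s2 b b' (Act A 1 1 (vop 0) b)" "tri A t2 b' b (Act A 1 1 (vop 1) b)"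
    "Act A 1 1 (vop 1) b' = Act A 1 1 (vop 0) b" "Act A 1 1 (vop 0) b' = Act A 1 1 (vop 1) b"
    using is_equivE[OF assms(3)] by metis
  note e = tri_ends[OF assms(1)]
  obtain s3 c' where c': "tri A s3 b' a' c'" using tri_composite[OF b(1) a(1)] b(5) a(6) e(2) by auto
  obtain u1 where u1: "tri A u1 (Act A 1 1 (vop 0) b) a' a'" using tri_unit_left[OF a(1)] a(6) e(2) by auto
  obtain u2 where u2: "tri A u2 b c' a'" using tri_assoc_right[OF b(3) c' u1] by blast
  obtain u3 where u3: "tri A u3 c c' (Act A 1 1 (vop 0) a)" using tri_assoc_left[OF assms(1) u2 a(3)] by blast
  obtain u4 where u4: "tri A u4 (Act A 1 1 (vop 1) a) b b" using tri_unit_left[OF b(2)] e(2) by auto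
  obtain u5 where u5: "tri A u5 a' c b" using tri_assoc_right[OF a(4) assms(1) u4] by blast
  obtain u6 where u6: "tri A u6 c' c (Act A 1 1 (vop 1) b)" using tri_assoc_left[OF c' u5 b(4)] by blast
  show ?thesis unfolding is_equiv_def e using u3 u6 triD(8)[OF assms(1)] triD(8)[OF c'] by blast
qed

text \<open>The edge b is a composite of the inverse of a with c, and composites of invertible edges
  are invertible.\<close>

lemma is_equiv_cancel_left:
  assumes "tri A s a b c" "is_equiv A a" "is_equiv A c"
  shows "is_equiv A b"
proof -
  obtain a' s1 t1 where a: "is_equiv A a'" "tri A t1 a' a (Act A 1 1 (vop 1) a)"
    using is_equivE[OF assms(2)] by metis
  obtain u4 where u4: "tri A u4 (Act A 1 1 (vop 1) a) b b"
    using tri_unit_left[OF triD(7)[OF assms(1)]] tri_ends(2)[OF assms(1)] by auto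
  obtain u5 where u5: "tri A u5 a' c b" using tri_assoc_right[OF a(2) assms(1) u4] by blast
  show ?thesis by (rule is_equiv_composite[OF u5 a(1) assms(3)])
qed

end

section \<open>Left outer anodyne extensions\<close>

text \<open>Between the vertices 0, 1, 2, ..., n of an n-simplex and the vertices 0, 1, 4, ..., n + 2.\<close>
definition spread :: "nat \<Rightarrow> nat" where "spread j = (if j \<le> 1 then j else j + 2)"
definition unspread :: "nat \<Rightarrow> nat" where "unspread j = (if j = 0 then 0 else if j \<le> 3 then 1 else j - 2)"

lemma mono_spread: "mono spread" by (auto simp: mono_def spread_def)
lemma mono_unspread: "mono unspread" by (auto simp: mono_def unspread_def)
lemma unspread_spread: "unspread (spread j) = j" by (auto simp: spread_def unspread_def)

text \<open>Both stratified sets have the same simplices, so the only possible extension is the map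
  itself, and the one additional thin simplex is the face opposite k.\<close>

lemma rlp_DeltaK''I:
  assumes "\<And>f. strat_map (DeltaK' n k) A f \<Longrightarrow> f (n - 1) (face n k) \<in> Thin A (n - 1)"
  shows "rlp A (DeltaK' n k) (DeltaK'' n k)"
  unfolding rlp_def
proof (intro allI impI exI conjI)
  fix f assume f: "strat_map (DeltaK' n k) A f"
  have "f m x \<in> Thin A m" if "x \<in> Thin (DeltaK'' n k) m" for m x
  proof (cases "m = n - 1 \<and> x = face n k")
    case False
    then have "x \<in> Thin (DeltaK' n k) m" using that by (auto simp: DeltaK'_def DeltaK''_def split: if_splits)
    then show ?thesis using f unfolding strat_map_def by blast
  qed (use assms[OF f] in simp)
  moreover have "Simp (DeltaK'' n k) = Simp (DeltaK' n k)" "Act (DeltaK'' n k) = Act (DeltaK' n k)"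
    by (simp_all add: DeltaK'_def DeltaK''_def)
  ultimately show "strat_map (DeltaK'' n k) A f" using f unfolding strat_map_def by auto
qed simp

text \<open>The thin 1-simplices are described by explicit inverses here;
  \<open>is_equiv_iff_th1E2\<close> shows that this is the same as the description by maps out of
  \<open>th1E2\<close>.\<close>

locale inner_complicial_equiv = inner_complicial +
  assumes Thin1_iff: "v \<in> Thin A 1 \<longleftrightarrow> is_equiv A v"
begin

lemma smap_of_strat_map:
  assumes "strat_map X A f" "Act X = (\<lambda>m m' \<beta> x. opcomp m \<beta> x)"
    "\<And>m \<alpha>. \<alpha> \<in> Ops m \<Longrightarrow> \<alpha> ` {0..m} \<in> U \<Longrightarrow> \<alpha> \<in> Simp X m"
  shows "smap U f"
  unfolding smap_def
proof (intro allI ballI impI conjI)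
  fix m \<alpha> assume "\<alpha> \<in> Ops m" "\<alpha> ` {0..m} \<in> U"
  then have a: "\<alpha> \<in> Simp X m" by (rule assms(3))
  then show "f m \<alpha> \<in> Simp A m" using assms(1) unfolding strat_map_def by blast
  fix k \<beta> assume "\<beta> \<in> ops k m"
  then have "f k (Act X k m \<beta> \<alpha>) = Act A k m \<beta> (f m \<alpha>)" using assms(1) a unfolding strat_map_def by blast
  then show "f k (opcomp k \<beta> \<alpha>) = Act A k m \<beta> (f m \<alpha>)" by (simp add: assms(2))
qed

lemma over_restrict:
  assumes "smap U F" "{0,1} \<in> U"
  shows "over F (F 1 (idop 1))"
  unfolding agree_def pr_id
proof (intro allI ballI impI)
  fix m \<alpha> assume al: "\<alpha> \<in> Ops m" "\<alpha> ` {0..m} \<in> cyl {0,1} {{}}"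
  have im: "\<alpha> ` {0..m} \<subseteq> {0,1}" by (rule cyl_empty[OF al(2)])
  then have ao: "\<alpha> \<in> ops m 1" using al(1) by (auto simp: ops_eq_Ops)
  have "idop 1 ` {0..1} = {0,1}" by (auto simp: idop_def)
  then have "F m (opcomp m \<alpha> (idop 1)) = Act A m 1 \<alpha> (F 1 (idop 1))"
    by (intro smap_Act[OF assms(1) idop_Ops _ ao]) (simp add: assms(2) del: One_nat_def)
  moreover have "opcomp m \<alpha> (idop 1) = \<alpha>" using im by (intro opcomp_id[OF al(1)]) (auto simp: idop_def)
  moreover have "opcomp m \<alpha> id = \<alpha>" using al(1) by (intro opcomp_id) auto
  ultimately show "pull id F m \<alpha> = pull id (sx 1 (F 1 (idop 1))) m \<alpha>" by (simp add: pull_def sx_def)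
qed

text \<open>The empty face belongs to D, so the 1-simplex underlying a marked edge is thin and
  therefore invertible.\<close>

lemma over_marked_thin:
  assumes "fam D" "smap (cyl {0,1} D) F" "marked D F"
  shows "over F (F 1 (idop 1))" "is_equiv A (F 1 (idop 1))"
proof -
  have D: "{} \<in> D" using assms(1) by (auto simp: fam_def)
  show "over F (F 1 (idop 1))"
    by (rule over_restrict[OF assms(2)]) (use D in \<open>auto simp: cyl_def\<close>)
  have "thn F {0,1}" using assms(3) D unfolding marked_def by fastforce
  moreover have "idop 1 ` {0..1} = {0,1}" by (auto simp: idop_def)
  ultimately have "F 1 (idop 1) \<in> Thin A 1" using idop_Ops unfolding thn_def by blast
  then show "is_equiv A (F 1 (idop 1))" by (simp only: Thin1_iff)
qed

text \<open>The horn is a single vertex and the degenerate 1-simplex on it is a filler, obtained by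
  relabelling all vertices to 0.\<close>

lemma rlp_left_horn_1: "rlp A (HornK 1 0) (DeltaK 1 0)"
  unfolding rlp_def
proof (intro allI impI)
  fix f assume f: "strat_map (HornK 1 0) A f"
  let ?g = "pull (\<lambda>_. 0) f"
  have ne: "{0} \<noteq> {0..1::nat}" by (metis atLeastAtMost_iff le_numeral_extra(4) singletonD zero_le zero_neq_one)
  have sm: "smap {{0}} f"
    by (rule smap_of_strat_map[OF f]) (use ne in \<open>simp_all add: HornK_def ops_eq_Ops del: One_nat_def\<close>)
  have g: "strat_map (DeltaK 1 0) A ?g"
  proof (rule strat_map_of_smap[OF sm])
    fix m \<alpha> assume t: "\<alpha> \<in> Thin (DeltaK 1 0) m"
    then have a: "\<alpha> \<in> ops m 1" by (auto simp: DeltaK_def)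
    have "0 < m"
    proof (rule ccontr)
      assume "\<not> 0 < m"
      then have "m = 0" by simp
      moreover have "degenerate (stdsimp 1) m \<alpha> \<or> {0,1} \<subseteq> \<alpha> ` {0..m}" using t by (auto simp: DeltaK_def)
      ultimately show False using degenerate_stdsimp_iff[OF a] by auto
    qed
    have o: "opcomp m \<alpha> (\<lambda>_. 0) \<in> Ops m" "opcomp m \<alpha> (\<lambda>_. 0) ` {0..m} \<in> {{0}}"
      by (auto simp: opcomp_def Ops_def)
    have "?g m \<alpha> \<in> Thin A m" unfolding pull_def
      by (rule smap_repeat_thin[OF sm o \<open>0 < m\<close>]) (simp add: opcomp_def)
    then show "\<alpha> \<in> Simp (DeltaK 1 0) m \<and> ((\<exists>i<m. \<alpha> (Suc i) = \<alpha> i) \<or> ?g m \<alpha> \<in> Thin A m)"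
      using a by (simp add: DeltaK_def)
  qed (auto simp: DeltaK_def ops_eq_Ops mono_def image_constant_conv)
  have "?g m \<alpha> = f m \<alpha>" if "\<alpha> \<in> Simp (HornK 1 0) m" for m \<alpha>
  proof -
    have a: "\<alpha> \<in> ops m 1" "\<alpha> ` {0..m} \<union> {0} \<noteq> {0..1}" using that by (simp_all add: HornK_def)
    have "1 \<notin> \<alpha> ` {0..m}"
    proof
      assume 1: "1 \<in> \<alpha> ` {0..m}"
      have e: "{0..1} = {0,1::nat}" by auto
      have 2: "\<alpha> ` {0..m} \<subseteq> {0,1}" using image_ops_le[OF a(1)] unfolding e .
      have "\<alpha> ` {0..m} \<union> {0} = {0..1}" unfolding e by (intro equalityI Un_least insert_subsetI) (use 1 2 in simp_all)
      then show False using a(2) by blast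
    qed
    have "\<alpha> i = 0" if "i \<le> m" for i
    proof -
      have "\<alpha> i \<in> \<alpha> ` {0..m}" using that by simp
      then have "\<alpha> i \<le> 1" "\<alpha> i \<noteq> 1" using image_ops_le[OF a(1)] \<open>1 \<notin> \<alpha> ` {0..m}\<close> by (auto simp del: One_nat_def)
      then show ?thesis by simp
    qed
    then have "opcomp m \<alpha> (\<lambda>_. 0) = \<alpha>" using a(1) by (intro opcomp_id) (auto simp: ops_eq_Ops)
    then show ?thesis by (simp add: pull_def)
  qed
  then show "\<exists>g. strat_map (DeltaK 1 0) A g \<and> (\<forall>n x. x \<in> Simp (HornK 1 0) n \<longrightarrow> g n x = f n x)"
    using g by blast
qed

section \<open>Thinness extensions at the vertex 0\<close>

lemma spread_image: "2 \<le> n \<Longrightarrow> spread ` {0..n} = {0,1} \<union> {4..n+2}"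
proof -
  assume n: "2 \<le> n"
  have "x \<in> spread ` {0..n}" if "x \<in> {4..n+2}" for x
  proof -
    have "x = spread (x - 2)" "x - 2 \<in> {0..n}" using that by (auto simp: spread_def)
    then show ?thesis by (rule image_eqI)
  qed
  moreover have "0 = spread 0" "1 = spread 1" by (auto simp: spread_def)
  then have "{0,1} \<subseteq> spread ` {0..n}" using n by fastforce
  moreover have "spread ` {0..n} \<subseteq> {0,1} \<union> {4..n+2}" by (auto simp: spread_def)
  ultimately show ?thesis by blast
qed

lemma spread_image_Diff:
  assumes "2 \<le> n" "i \<le> 1"
  shows "spread ` ({0..n} - {i}) = {0,1} \<union> {4..n+2} - {i}"
proof -
  have "inj spread" by (rule inj_on_inverseI[of _ unspread]) (simp add: unspread_spread)
  then have "spread ` ({0..n} - {i}) = spread ` {0..n} - spread ` {i}" by (rule image_set_diff)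
  moreover have "spread i = i" using assms(2) by (simp add: spread_def)
  ultimately show ?thesis using spread_image[OF assms(1)] by simp
qed

lemma spread_image_cyl:
  assumes "S \<subseteq> {0..n}" "S \<noteq> {}" "2 \<le> n"
  shows "spread ` S \<in> cyl {0,1} (Pow {4..n+2})"
proof -
  have "spread ` S \<subseteq> {0,1} \<union> {4..n+2}" using image_mono[OF assms(1), of spread] spread_image[OF assms(3)] by simp
  then show ?thesis using assms(2) by (auto simp: cyl_def)
qed

lemma unspread_image_le:
  assumes "S \<in> cyl {0,1} (Pow {4..n+2})" "2 \<le> n"
  shows "unspread ` S \<subseteq> {0..n}"
proof
  fix y assume "y \<in> unspread ` S"
  then obtain x where x: "x \<in> S" "y = unspread x" by auto
  have "S \<inter> {..<4} \<subseteq> {0,1}" "S \<inter> {4..} \<subseteq> {4..n+2}" using assms(1) by (simp_all add: cyl_def)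
  then have "x \<in> {0,1} \<or> x \<in> {4..n+2}" using x(1) by (cases "x < 4") auto
  then show "y \<in> {0..n}" using x(2) assms(2) by (auto simp: unspread_def)
qed

text \<open>The thin simplex + - \<Delta> of a right inverse has all faces other than + \<Delta> thin, hence + \<Delta> is
  thin as well by an inner extension.\<close>
lemma rlp_left_prime:
  assumes n: "3 \<le> n"
  shows "rlp A (DeltaK' n 0) (DeltaK'' n 0)"
proof (rule rlp_DeltaK''I)
  fix f assume f: "strat_map (DeltaK' n 0) A f"
  let ?\<Delta> = "{4..n+2}" and ?PD = "Pow {4..n+2}" and ?F = "pull unspread f"
  have fam: "fam ?PD" by (auto simp: fam_def intro: finite_subset)
  have sf: "smap {T. T \<noteq> {} \<and> T \<subseteq> {0..n}} f"
    by (rule smap_of_strat_map[OF f]) (auto simp: DeltaK'_def DeltaK_def ops_eq_Ops)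
  have sF: "smap (cyl {0,1} ?PD) ?F"
    by (rule smap_pull[OF sf mono_unspread]) (use unspread_image_le n in \<open>auto simp: cyl_def\<close>)
  have thf: "thn f T" if T: "{0,1} \<subseteq> T" "T \<subseteq> {0..n}" for T
    unfolding thn_def
  proof (intro allI ballI impI)
    fix m \<alpha> assume "\<alpha> \<in> Ops m" "\<alpha> ` {0..m} = T"
    then have "\<alpha> \<in> Thin (DeltaK' n 0) m" using T by (auto simp: DeltaK'_def DeltaK_def ops_eq_Ops)
    then show "f m \<alpha> \<in> Thin A m" using f unfolding strat_map_def by blast
  qed
  have mF: "marked ?PD ?F" unfolding marked_def
  proof
    fix \<sigma> assume \<sigma>: "\<sigma> \<in> ?PD"
    have "{0,1} \<union> \<sigma> \<in> cyl {0,1} ?PD" using \<sigma> by (subst Un_in_cyl) auto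
    then have "unspread ` ({0,1} \<union> \<sigma>) \<subseteq> {0..n}" by (rule unspread_image_le) (use n in simp)
    moreover have "{0,1} \<subseteq> unspread ` ({0,1} \<union> \<sigma>)" by (auto simp: unspread_def)
    ultimately show "thn ?F ({0,1} \<union> \<sigma>)" by (intro thn_pull[OF thf mono_unspread])
  qed
  have f1: "face n 1 \<in> ops (n-1) n" "face n 1 ` {0..n-1} = {0..n} - {1}"
    using face_in_ops[of n 1] image_face[of n 1] n by auto
  have "face n 1 \<in> Thin (DeltaK' n 0) (n - 1)" using n by (auto simp: DeltaK'_def)
  then have f1t: "f (n-1) (face n 1) \<in> Thin A (n-1)" using f unfolding strat_map_def by blast
  have "thn f ({0..n} - {1})"
  proof (rule thnI[of "{T. T \<noteq> {} \<and> T \<subseteq> {0..n}}" f _ "face n 1" "n-1", OF sf])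
    show "{0..n} - {1} \<in> {T. T \<noteq> {} \<and> T \<subseteq> {0..n}}" using n by auto
    show "face n 1 \<in> Ops (n-1)" using f1(1) by (simp add: ops_eq_Ops)
    show "inj_on (face n 1) {0..n-1}" by (auto simp: inj_on_def face_def split: if_splits)
  qed (fact f1(2) f1t)+
  moreover have "unspread ` ({0} \<union> ?\<Delta>) = {0..n} - {1}"
  proof -
    have "{0,1} \<union> ?\<Delta> - {1} = {0} \<union> ?\<Delta>" by auto
    then have "spread ` ({0..n} - {1}) = {0} \<union> ?\<Delta>" using spread_image_Diff[of n 1] n by simp
    then have "unspread ` ({0} \<union> ?\<Delta>) = unspread ` spread ` ({0..n} - {1})" by (simp only:)
    then show ?thesis by (simp add: image_image unspread_spread)
  qed
  ultimately have mD: "thn ?F ({0} \<union> ?\<Delta>)" by (intro thn_pull[OF _ mono_unspread]) simp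
  note ov = over_marked_thin[OF fam sF mF]
  obtain w s t where w: "is_equiv A w" "tri A t w (?F 1 (idop 1)) (Act A 1 1 (vop 1) (?F 1 (idop 1)))"
    using is_equivE[OF ov(2)] by metis
  have "w \<in> Thin A 1" using w(1) by (simp only: Thin1_iff)
  then obtain x H where x: "smap (cyl {0,1} ?PD) x" "marked ?PD x" "slice_tri ?PD H x ?F (pull (pr 1 1 1 1) ?F)"
    using right_inverse[OF fam sF mF ov(1) w(2)] by blast
  note t = slice_triD[OF x(3)]
  \<comment> \<open>The triangle x F = 1 identifies the vertex 1 of x with the vertex 0 of F over
    all of \<Delta>, and in \<open>c2\<close> the vertex 0 of x with the vertex 1 of F. Thinness of
    - \<Delta> thus passes from F to x, and thinness of + \<Delta> will pass back.\<close>
  have "agree (cyl {1} ?PD) (pull (pr 1 1 1 1) H) (pull (pr 0 1 2 3) x)"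
    by (rule agree_cyl[OF t(3), where p=1 and q=1 and r=1 and s=1]) (simp_all add: pr_simps)
  moreover have "agree (cyl {1} ?PD) (pull (pr 1 1 1 1) H) (pull (pr 0 0 0 0) ?F)"
    by (rule agree_cyl[OF t(4), where p=0 and q=0 and r=0 and s=0]) (simp_all add: pr_simps)
  ultimately have c1: "agree (cyl {1} ?PD) (pull (pr 0 0 0 0) ?F) (pull (pr 0 1 2 3) x)"
    using agree_trans agree_sym by blast
  have "agree (cyl {1} ?PD) (pull (pr 0 0 0 0) H) (pull (pr 0 0 0 0) x)"
    by (rule agree_cyl[OF t(3), where p=0 and q=0 and r=0 and s=0]) (simp_all add: pr_simps)
  moreover have "agree (cyl {1} ?PD) (pull (pr 0 0 0 0) H) (pull (pr 0 1 2 3) ?F)"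
    by (rule agree_cyl[OF t(5)[unfolded pull_pull[of "pr 0 1 2 3" "pr 1 1 1 1"] pr_comp pr_simps], where p=0 and q=0 and r=0 and s=0]) (simp_all add: pr_simps)
  ultimately have c2: "agree (cyl {1} ?PD) (pull (pr 0 0 0 0) x) (pull (pr 0 1 2 3) ?F)"
    using agree_trans agree_sym by blast
  have inD: "{1} \<union> ?\<Delta> \<in> cyl {1} ?PD" by (subst Un_in_cyl) auto
  have "thn (pull (pr 0 0 0 0) ?F) ({1} \<union> ?\<Delta>)"
    by (rule thn_pr[OF mD]) (auto simp: pr_simps)
  then have "thn (pull (pr 0 1 2 3) x) ({1} \<union> ?\<Delta>)" by (rule thn_agree[OF _ c1 inD])
  then have x1: "thn x ({1} \<union> ?\<Delta>)" unfolding pr_id by (rule thn_agree[OF _ pull_id inD])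
  \<comment> \<open>In + - \<Delta> the pivot - has the neighbours + and 4. Faces through both + and
    - are thin because x is marked, and the face opposite + is thin by \<open>x1\<close>.\<close>
  have "thn x ({0,1} \<union> ?\<Delta> - {1})"
  proof (rule thin_codim1[OF x(1) _ _ _ dclosed_cyl[OF fam], where a=0 and b=4])
    show "{0,1} \<union> ?\<Delta> \<in> cyl {0,1} ?PD" by (subst Un_in_cyl) auto
    show "finite ({0,1} \<union> ?\<Delta>)" by simp
    \<comment> \<open>The bound 3 \<le> n puts the vertex 5 into \<Delta>, which gives the four
      vertices required.\<close>
    have "{0,1,4,5} \<subseteq> {0,1} \<union> ?\<Delta>" using n by auto
    then have "card {0,1,4,5::nat} \<le> card ({0,1} \<union> ?\<Delta>)" by (intro card_mono) auto
    then show "4 \<le> card ({0,1} \<union> ?\<Delta>)" by simp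
    show "adjacent ({0,1} \<union> ?\<Delta>) 0 1" "adjacent ({0,1} \<union> ?\<Delta>) 1 4" using n by (auto simp: adjacent_def)
    have key: "thn x T" if T: "{0,1} \<subseteq> T" "T \<subseteq> {0,1} \<union> ?\<Delta>" for T
    proof -
      have "T = {0,1} \<union> (T \<inter> ?\<Delta>)" using T by blast
      moreover have "thn x ({0,1} \<union> (T \<inter> ?\<Delta>))" using x(2) unfolding marked_def by blast
      ultimately show ?thesis by simp
    qed
    fix T assume "T \<subseteq> {0,1} \<union> ?\<Delta>" "{0,1,4} \<subseteq> T" then show "thn x T" using key by simp
  next
    fix q assume q: "q \<in> {0,1} \<union> ?\<Delta>" "q \<noteq> 1"
    show "thn x ({0,1} \<union> ?\<Delta> - {q})"
    proof (cases "q = 0")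
      case True
      then have "{0,1} \<union> ?\<Delta> - {q} = {1} \<union> ?\<Delta>" by auto
      then show ?thesis using x1 by simp
    next
      case False
      then have "{0,1} \<union> ?\<Delta> - {q} = {0,1} \<union> (?\<Delta> - {q})" using q by auto
      moreover have "thn x ({0,1} \<union> (?\<Delta> - {q}))" using x(2) unfolding marked_def by blast
      ultimately show ?thesis by simp
    qed
  qed
  moreover have "{0,1} \<union> ?\<Delta> - {1} = {0} \<union> ?\<Delta>" by auto
  ultimately have "thn x ({0} \<union> ?\<Delta>)" by simp
  then have "thn (pull (pr 0 0 0 0) x) ({1} \<union> ?\<Delta>)" by (rule thn_pr) (auto simp: pr_simps)
  then have "thn (pull (pr 0 1 2 3) ?F) ({1} \<union> ?\<Delta>)" by (rule thn_agree[OF _ c2 inD])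
  then have F1: "thn ?F ({1} \<union> ?\<Delta>)" unfolding pr_id by (rule thn_agree[OF _ pull_id inD])
  have f0: "face n 0 \<in> Ops (n-1)" "face n 0 ` {0..n-1} = {0..n} - {0}"
    using face_in_ops[of n 0] image_face[of n 0] n by (auto simp: ops_eq_Ops)
  have "{0,1} \<union> ?\<Delta> - {0} = {1} \<union> ?\<Delta>" by auto
  then have "spread ` ({0..n} - {0}) = {1} \<union> ?\<Delta>" using spread_image_Diff[of n 0] n by simp
  then have "opcomp (n-1) (face n 0) spread ` {0..n-1} = {1} \<union> ?\<Delta>" unfolding image_opcomp f0(2) .
  then have "?F (n-1) (opcomp (n-1) (face n 0) spread) \<in> Thin A (n-1)"
    using F1 opcomp_mono_in_Ops[OF mono_spread f0(1)] unfolding thn_def by blast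
  moreover have "opcomp (n-1) (opcomp (n-1) (face n 0) spread) unspread = face n 0"
    unfolding opcomp_twice by (rule opcomp_id[OF f0(1)]) (simp add: unspread_spread)
  ultimately show "f (n-1) (face n 0) \<in> Thin A (n-1)" by (simp add: pull_def)
qed

lemma tri_of_DeltaK':
  assumes "strat_map (DeltaK' 2 k) A f" "k \<le> 2"
  shows "tri A (f 2 (idop 2)) (f 1 (face 2 2)) (f 1 (face 2 0)) (f 1 (face 2 1))"
    "\<And>i. i \<le> 2 \<Longrightarrow> i \<noteq> k \<Longrightarrow> f 1 (face 2 i) \<in> Thin A 1"
proof -
  have id: "idop 2 \<in> ops 2 2" by (auto simp: idop_def ops_def)
  have "idop 2 ` {0..2} = {0..2}" by (auto simp: idop_def)
  then have "idop 2 \<in> Thin (DeltaK' 2 k) 2" using id by (auto simp: DeltaK'_def DeltaK_def)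
  then have "f 2 (idop 2) \<in> Thin A 2" using assms(1) unfolding strat_map_def by blast
  moreover have "Act A 1 2 \<theta> (f 2 (idop 2)) = f 1 \<theta>" if "\<theta> \<in> ops 1 2" for \<theta>
  proof -
    have "f 1 (Act (DeltaK' 2 k) 1 2 \<theta> (idop 2)) = Act A 1 2 \<theta> (f 2 (idop 2))"
      using assms(1) that id unfolding strat_map_def by (simp add: DeltaK'_def DeltaK_def)
    moreover have "opcomp 1 \<theta> (idop 2) = \<theta>" using that by (intro opcomp_id) (auto simp: ops_def Ops_def idop_def)
    ultimately show ?thesis by (simp add: DeltaK'_def DeltaK_def)
  qed
  ultimately show "tri A (f 2 (idop 2)) (f 1 (face 2 2)) (f 1 (face 2 0)) (f 1 (face 2 1))"
    unfolding tri_def using face2_in_ops by simp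
  fix i :: nat assume "i \<le> 2" "i \<noteq> k"
  then have "face 2 i \<in> Thin (DeltaK' 2 k) 1" by (auto simp: DeltaK'_def)
  then show "f 1 (face 2 i) \<in> Thin A 1" using assms(1) unfolding strat_map_def by blast
qed

text \<open>The extension excepted in the hypotheses on A: the face opposite 1 is a composite of the
  other two edges, and invertible edges are closed under composition.\<close>

lemma rlp_prime_2_1: "rlp A (DeltaK' 2 1) (DeltaK'' 2 1)"
proof (rule rlp_DeltaK''I)
  fix f assume f: "strat_map (DeltaK' 2 1) A f"
  have k: "1 \<le> (2::nat)" by simp
  note t = tri_of_DeltaK'[OF f k]
  have "f 1 (face 2 1) \<in> Thin A 1"
    unfolding Thin1_iff by (rule is_equiv_composite[OF t(1)]) (rule Thin1_iff[THEN iffD1, OF t(2)]; simp)+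
  then show "f (2-1) (face 2 1) \<in> Thin A (2-1)" by simp
qed

lemma rlp_prime_2_0: "rlp A (DeltaK' 2 0) (DeltaK'' 2 0)"
proof (rule rlp_DeltaK''I)
  fix f assume f: "strat_map (DeltaK' 2 0) A f"
  have k: "0 \<le> (2::nat)" by simp
  note t = tri_of_DeltaK'[OF f k]
  have "f 1 (face 2 0) \<in> Thin A 1"
    unfolding Thin1_iff by (rule is_equiv_cancel_left[OF t(1)]) (rule Thin1_iff[THEN iffD1, OF t(2)]; simp)+
  then show "f (2-1) (face 2 0) \<in> Thin A (2-1)" by simp
qed

end

section \<open>Filling left outer horns\<close>

context inner_complicial_equiv begin

lemma Pow_cyl_Un:
  assumes "S \<in> cyl P E" "P \<subseteq> {..<4}"
  shows "S = (S \<inter> P) \<union> (S \<inter> {4..})"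
proof -
  have "S \<inter> {..<4} \<subseteq> P" using assms(1) by (simp add: cyl_def)
  then have "S \<inter> P = S \<inter> {..<4}" using assms(2) by blast
  moreover have "S \<inter> {..<4} \<union> S \<inter> {4..} = S" by auto
  ultimately show ?thesis by (simp only:)
qed

lemma cyl_remove_1:
  assumes "S \<in> cyl {0,1} E" "1 \<notin> S" shows "S \<in> cyl {0} E"
proof -
  have "S \<inter> {..<4} \<subseteq> {0,1}" using assms(1) by (simp add: cyl_def)
  then have "S \<inter> {..<4} \<subseteq> {0}" using assms(2) by blast
  then show ?thesis using assms(1) by (simp add: cyl_def)
qed

text \<open>The domain of F is the horn at 0 on the vertices \<open>{0,1} \<union> \<Delta>\<close>:
  an edge of the slice over the boundary D of \<Delta>, together with the face - \<Delta>. That the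
  edge is marked is the thinness condition of this horn, since the pivot 0 has 1 as its only
  neighbour.\<close>

lemma outer_extension:
  fixes \<Delta> :: "nat set"
  defines "D \<equiv> Pow \<Delta> - {\<Delta>}"
  assumes \<Delta>: "finite \<Delta>" "4 \<in> \<Delta>" "\<Delta> \<subseteq> {4..}"
    and F: "smap (cyl {0,1} D \<union> cyl {0} (Pow \<Delta>)) F" and m: "marked D F"
  obtains G where "smap (cyl {0,1} (Pow \<Delta>)) G" "agree (cyl {0,1} D \<union> cyl {0} (Pow \<Delta>)) G F" "thn G ({0,1} \<union> \<Delta>)"
proof -
  have famD: "fam D" and famP: "fam (Pow \<Delta>)"
    using \<Delta> by (auto simp: fam_def D_def intro: finite_subset)
  have DP: "D \<inter> Pow \<Delta> = D" "Pow \<Delta> \<inter> D = D" by (auto simp: D_def)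
  have sub4: "\<sigma> \<subseteq> {4..}" if "\<sigma> \<in> Pow \<Delta>" for \<sigma> using that \<Delta>(3) by auto
  have inD: "\<sigma> \<in> D \<longleftrightarrow> \<sigma> \<subset> \<Delta>" for \<sigma> by (auto simp: D_def)
  have F1: "smap (cyl {0,1} D) F" and F0: "smap (cyl {0} (Pow \<Delta>)) F"
    using smap_subset[OF F] by auto
  note ov = over_marked_thin[OF famD F1 m]
  obtain w H where w: "smap (cyl {0,1} D) w" "marked D w" and H: "slice_tri D H F w (pull (pr 0 0 0 0) F)"
    using left_inverse[OF famD F1 m ov] Thin1_iff by blast
  note t = slice_triD[OF H]
  have t5: "agree (cyl {0,1} D) (pull (pr 0 2 2 2) H) (pull (pr 0 0 0 0) F)"
    using t(5) by (simp add: pull_pull pr_comp pr_simps)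
  \<comment> \<open>Write - and + for the vertices 0 and 1. The simplex + - \<Delta> is filled first; its face opposite - is the missing simplex + \<Delta>.\<close>
  let ?U1 = "cyl {0,1} D" and ?U2 = "cyl {1} (Pow \<Delta>)"
  \<comment> \<open>The edge w runs from + to -, so in this filling the vertex 0 plays the part of +
    and the vertex 1 that of -.\<close>
  let ?K1 = "pull (pr 0 1 2 3) w" and ?K2 = "pull (pr 0 0 0 0) F"
  have sm: "smap ?U1 ?K1" "smap ?U2 ?K2"
    by (rule smap_pr[OF w(1)] smap_pr[OF F0]; simp add: pr_simps)+
  have 1: "agree (cyl {1} D) (pull (pr 2 2 2 2) H) ?K1"
    by (rule agree_cyl[OF t(4), where p=0 and q=1 and r=1 and s=1]) (simp_all add: pr_simps)
  have 2: "agree (cyl {1} D) (pull (pr 2 2 2 2) H) ?K2"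
    by (rule agree_cyl[OF t5, where p=0 and q=1 and r=1 and s=1]) (simp_all add: pr_simps)
  have "agree (cyl {1} D) ?K1 ?K2" by (rule agree_trans[OF agree_sym[OF 1] 2])
  then have o: "agree (?U1 \<inter> ?U2) ?K1 ?K2" by (simp add: cyl_Int DP)
  obtain W0 where W0: "smap (?U1 \<union> ?U2) W0" "agree ?U1 W0 ?K1" "agree ?U2 W0 ?K2"
    using smap_glue[OF sm dclosed_cyl[OF famD] dclosed_cyl[OF famP] o] .
  let ?S = "{0,1} \<union> \<Delta>"
  have thw: "thn W0 ({0,1} \<union> \<sigma>)" if "\<sigma> \<in> D" for \<sigma>
  proof -
    have s4: "\<sigma> \<subseteq> {4..}" using that sub4 by (auto simp: D_def)
    have "thn w ({0,1} \<union> \<sigma>)" using w(2) that unfolding marked_def by blast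
    then have "thn ?K1 ({0,1} \<union> \<sigma>)" by (rule thn_pr[OF _ s4]) (simp_all add: pr_simps)
    then show ?thesis
      by (rule thn_agree[OF _ agree_sym[OF W0(2)]]) (subst Un_in_cyl, use s4 that in auto)
  qed
  have nin: "?S \<notin> ?U1 \<union> ?U2" "{0} \<union> \<Delta> \<notin> ?U1 \<union> ?U2"
  proof -
    have "?S \<notin> ?U1" "?S \<notin> ?U2" "{0} \<union> \<Delta> \<notin> ?U1" "{0} \<union> \<Delta> \<notin> ?U2"
      using \<Delta>(3) by (subst Un_in_cyl; simp add: D_def)+
    then show "?S \<notin> ?U1 \<union> ?U2" "{0} \<union> \<Delta> \<notin> ?U1 \<union> ?U2" by blast+
  qed
  have S1: "?S - {1} = {0} \<union> \<Delta>" using \<Delta>(3) by auto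
  have cov: "Q \<in> ?U1 \<union> ?U2" if Q: "Q \<subset> ?S" "Q \<noteq> {}" "Q \<noteq> {0} \<union> \<Delta>" for Q
  proof (cases "\<Delta> \<subseteq> Q")
    case False
    have "Q = (Q \<inter> {0,1}) \<union> (Q \<inter> \<Delta>)" using Q(1) by blast
    moreover have "(Q \<inter> {0,1}) \<union> (Q \<inter> \<Delta>) \<in> ?U1"
      by (subst Un_in_cyl) (use \<Delta>(3) Q False in \<open>auto simp: D_def\<close>)
    ultimately show ?thesis by simp
  next
    case True
    have "0 \<notin> Q"
    proof
      assume "0 \<in> Q"
      then have "1 \<notin> Q" using Q(1) True by blast
      then have "Q = {0} \<union> \<Delta>" using Q(1) True \<open>0 \<in> Q\<close> by blast
      then show False using Q(3) by blast
    qed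
    then have "Q = (Q \<inter> {1}) \<union> \<Delta>" using Q(1) True by blast
    moreover have "(Q \<inter> {1}) \<union> \<Delta> \<in> ?U2"
      by (subst Un_in_cyl) (use \<Delta> in auto)
    ultimately show ?thesis by simp
  qed
  obtain W where W: "smap (?U1 \<union> ?U2 \<union> {?S, ?S - {1}}) W" "agree (?U1 \<union> ?U2) W W0" "thn W ?S"
  proof (rule horn_extension[OF W0(1), of ?S 1 0 4])
    show "finite ?S" using \<Delta>(1) by simp
    show "?S \<notin> ?U1 \<union> ?U2" "?S - {1} \<notin> ?U1 \<union> ?U2" unfolding S1 by (fact nin)+
    show "dclosed (?U1 \<union> ?U2)" by (intro dclosed_Un dclosed_cyl famD famP)
    show "adjacent ?S 0 1" by (auto simp: adjacent_def)
    show "adjacent ?S 1 4" using \<Delta> by (auto simp: adjacent_def)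
    fix Q assume Q: "Q \<in> ?U1 \<union> ?U2" "Q \<subseteq> ?S" "{0,1,4} \<subseteq> Q"
    have "\<not> \<Delta> \<subseteq> Q"
    proof
      assume "\<Delta> \<subseteq> Q" then have "Q = ?S" using Q(2,3) by blast
      then show False using nin(1) Q(1) by simp
    qed
    then have "Q \<inter> \<Delta> \<in> D" by (auto simp: D_def)
    moreover have "Q = {0,1} \<union> (Q \<inter> \<Delta>)" using Q(2,3) by blast
    ultimately show "thn W0 Q" using thw[of "Q \<inter> \<Delta>"] by simp
  next
    fix Q assume "Q \<subset> ?S" "Q \<noteq> {}" "Q \<noteq> ?S - {1}"
    then show "Q \<in> ?U1 \<union> ?U2" unfolding S1 by (intro cov)
  qed (rule that)
  have domW: "Q \<subseteq> ?S" if "Q \<in> cyl {0,1} (Pow \<Delta>)" for Q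
  proof -
    have "Q = (Q \<inter> {0,1}) \<union> (Q \<inter> {4..})" by (rule Pow_cyl_Un[OF that]) auto
    moreover have "Q \<inter> {4..} \<subseteq> \<Delta>" using that by (simp add: cyl_def)
    ultimately show ?thesis by blast
  qed
  have sW: "smap (cyl {0,1} (Pow \<Delta>)) W"
  proof (rule smap_subset[OF W(1)], rule subsetI)
    fix Q assume Q: "Q \<in> cyl {0,1} (Pow \<Delta>)"
    have "Q \<noteq> {}" using Q by (simp add: cyl_def)
    then show "Q \<in> ?U1 \<union> ?U2 \<union> {?S, ?S - {1}}" using domW[OF Q] cov[of Q] unfolding S1 by blast
  qed
  have mW: "thn W ({0,1} \<union> \<sigma>)" if "\<sigma> \<in> Pow \<Delta>" for \<sigma>
  proof (cases "\<sigma> = \<Delta>")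
    case False
    then have D: "\<sigma> \<in> D" using that by (simp add: D_def)
    have "{0,1} \<union> \<sigma> \<in> ?U1" by (subst Un_in_cyl) (use sub4[OF that] D in auto)
    then show ?thesis by (intro thn_agree[OF thw[OF D] agree_sym[OF W(2)]]) simp
  qed (use W(3) in simp)
  have W1: "agree ?U1 (pull (pr 0 1 2 3) W) ?K1" and W2: "agree ?U2 (pull (pr 0 1 2 3) W) ?K2"
    by (rule agree_restrict_pr[OF W(2) _ W0(2)] agree_restrict_pr[OF W(2) _ W0(3)]; blast)+

  \<comment> \<open>In - + - \<Delta> the face opposite the first - is the simplex just found, and the face opposite + is degenerate, so the filler has the wanted simplex - + \<Delta> as a face.\<close>
  let ?V1 = "cyl {0,1,2} D" and ?V2 = "cyl {1,2} (Pow \<Delta>)" and ?V3 = "cyl {0,2} (Pow \<Delta>)"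
  \<comment> \<open>The vertices 0, 1, 2 stand for -, +, -. Hence \<open>pr 0 0 1 1\<close> places +
    - \<Delta> on the vertices 1, 2, and \<open>pr 0 0 0 0\<close> sends both copies of - to the
    given face - \<Delta>.\<close>
  let ?L1 = "pull (pr 0 1 2 3) H" and ?L2 = "pull (pr 0 0 1 1) W" and ?L3 = "pull (pr 0 0 0 0) F"
  have sm': "smap ?V1 ?L1" "smap ?V2 ?L2" "smap ?V3 ?L3"
    by (rule smap_pr[OF t(1)] smap_pr[OF sW] smap_pr[OF F0]; simp add: pr_simps)+
  have "agree (cyl {0,1} D) (pull (pr 1 2 2 2) H) (pull (pr 0 1 2 3) W)"
    by (rule agree_trans[OF t(4) agree_sym[OF W1]])
  then have "agree (cyl {1,2} D) ?L1 ?L2"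
    by (rule agree_cyl[where p=0 and q=0 and r=1 and s=1]) (simp_all add: pr_simps)
  then have o1: "agree (?V1 \<inter> ?V2) ?L1 ?L2" by (simp add: cyl_Int DP)
  have "agree (cyl {0,2} D) ?L1 ?L3"
    by (rule agree_cyl[OF t5, where p=0 and q=0 and r=1 and s=1]) (simp_all add: pr_simps)
  then have o2: "agree (?V1 \<inter> ?V3) ?L1 ?L3" by (simp add: cyl_Int DP)
  have "agree (cyl {2} (Pow \<Delta>)) ?L2 ?L3"
    by (rule agree_cyl[OF W2, where p=0 and q=1 and r=1 and s=1]) (simp_all add: pr_simps)
  then have o3: "agree (?V2 \<inter> ?V3) ?L2 ?L3" by (simp add: cyl_Int)
  let ?V = "?V1 \<union> ?V2 \<union> ?V3"
  obtain K where K: "smap ?V K" "dclosed ?V" "agree ?V1 K ?L1" "agree ?V2 K ?L2" "agree ?V3 K ?L3"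
    using smap_glue3[OF sm' dclosed_cyl[OF famD] dclosed_cyl[OF famP] dclosed_cyl[OF famP] o1 o2 o3] .
  let ?R = "{0,1,2} \<union> \<Delta>"
  have R2: "?R - {2} = {0,1} \<union> \<Delta>" "?R - {0} = {1,2} \<union> \<Delta>" "?R - {1} = {0,2} \<union> \<Delta>" using \<Delta>(3) by auto
  have k1: "thn K ({0,1,2} \<union> \<sigma>)" if "\<sigma> \<in> D" for \<sigma>
  proof -
    have s4: "\<sigma> \<subseteq> {4..}" using that sub4 by (auto simp: D_def)
    have "thn ?L1 ({0,1,2} \<union> \<sigma>)" by (rule thn_pr[OF t(2)[OF that] s4]) (simp_all add: pr_simps)
    then show ?thesis
      by (rule thn_agree[OF _ agree_sym[OF K(3)]]) (subst Un_in_cyl, use s4 that in auto)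
  qed
  have k2: "thn K ({1,2} \<union> \<sigma>)" if "\<sigma> \<in> Pow \<Delta>" for \<sigma>
  proof -
    have "thn ?L2 ({1,2} \<union> \<sigma>)" by (rule thn_pr[OF mW[OF that] sub4[OF that]]) (simp_all add: pr_simps)
    then show ?thesis
      by (rule thn_agree[OF _ agree_sym[OF K(4)]]) (subst Un_in_cyl, use sub4[OF that] that in auto)
  qed
  have k3: "thn K ({0,2} \<union> \<Delta>)"
  proof -
    have "thn ?L3 ({0,2} \<union> \<Delta>)"
      by (rule thn_pr_degenerate[OF F0 _ famP, where x=0 and y=2]) (simp_all add: pr_simps)
    then show ?thesis
      by (rule thn_agree[OF _ agree_sym[OF K(5)]]) (subst Un_in_cyl, use \<Delta>(3) in auto)
  qed
  have nin': "?R \<notin> ?V" "{0,1} \<union> \<Delta> \<notin> ?V"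
  proof -
    have "?R \<notin> ?V1" "?R \<notin> ?V2" "?R \<notin> ?V3" "{0,1} \<union> \<Delta> \<notin> ?V1" "{0,1} \<union> \<Delta> \<notin> ?V2" "{0,1} \<union> \<Delta> \<notin> ?V3"
      using \<Delta>(3) by (subst Un_in_cyl; simp add: D_def)+
    then show "?R \<notin> ?V" "{0,1} \<union> \<Delta> \<notin> ?V" by blast+
  qed
  have cov': "Q \<in> ?V" if Q: "Q \<subseteq> ?R" "Q \<noteq> {}" "\<not> {0,1} \<union> \<Delta> \<subseteq> Q" for Q
  proof -
    have e: "Q = (Q \<inter> {0,1,2}) \<union> (Q \<inter> \<Delta>)" using Q(1) by blast
    have c: "(Q \<inter> {0,1,2}) \<union> (Q \<inter> \<Delta>) \<in> cyl P E \<longleftrightarrow> Q \<inter> {0,1,2} \<subseteq> P \<and> Q \<inter> \<Delta> \<in> E" for P E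
      by (subst Un_in_cyl) (use \<Delta>(3) Q(2) e in auto)
    consider "\<not> \<Delta> \<subseteq> Q" | "0 \<notin> Q" | "1 \<notin> Q" using Q(3) by blast
    then have "(Q \<inter> {0,1,2}) \<union> (Q \<inter> \<Delta>) \<in> ?V"
    proof cases
      case 1
      then have "Q \<inter> \<Delta> \<in> D" by (auto simp: D_def)
      then show ?thesis using c[of "{0,1,2}" D] by blast
    next
      case 2 then show ?thesis using c[of "{1,2}" "Pow \<Delta>"] by blast
    next
      case 3 then show ?thesis using c[of "{0,2}" "Pow \<Delta>"] by blast
    qed
    then show ?thesis using e by simp
  qed
  obtain G where G: "smap (?V \<union> {?R} \<union> (\<lambda>S. S - {2}) ` {?R}) G" "agree ?V G K"
    "\<forall>S\<in>{?R}. 4 \<le> card S \<longrightarrow> (\<forall>q\<in>S. q \<noteq> 2 \<longrightarrow> S - {q} \<in> ?V \<longrightarrow> thn K (S - {q})) \<longrightarrow> thn G (S - {2})"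
  proof (rule horn_extensions[of "{?R}" ?V K 2])
    show "finite {?R}" "smap ?V K" "dclosed ?V" using K by simp_all
  next
    fix S assume S: "S \<in> {?R}"
    then have S': "S = ?R" by simp
    show "finite S \<and> S \<notin> ?V \<and> S - {2} \<notin> ?V" unfolding S' R2 using \<Delta>(1) nin' by blast
    show "\<exists>a b. adjacent S a 2 \<and> adjacent S 2 b \<and> (\<forall>T\<in>?V. T \<subseteq> S \<longrightarrow> {a, 2, b} \<subseteq> T \<longrightarrow> thn K T)"
      unfolding S'
    proof (intro exI conjI ballI impI)
      show "adjacent ?R 1 2" "adjacent ?R 2 4" using \<Delta> by (auto simp: adjacent_def)
      fix Q assume Q: "Q \<in> ?V" "Q \<subseteq> ?R" "{1,2,4} \<subseteq> Q"
      show "thn K Q"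
      proof (cases "0 \<in> Q")
        case False
        then have "Q = {1,2} \<union> (Q \<inter> \<Delta>)" using Q(2,3) by blast
        then show ?thesis using k2[of "Q \<inter> \<Delta>"] by simp
      next
        case True
        then have e: "Q = {0,1,2} \<union> (Q \<inter> \<Delta>)" using Q(2,3) by blast
        have "Q \<inter> \<Delta> \<noteq> \<Delta>"
        proof
          assume "Q \<inter> \<Delta> = \<Delta>" then have "Q = ?R" using e by simp
          then show False using nin'(1) Q(1) by simp
        qed
        then have "Q \<inter> \<Delta> \<in> D" by (auto simp: D_def)
        then show ?thesis using k1[of "Q \<inter> \<Delta>"] e by simp
      qed
    qed
    fix Q assume Q: "Q \<subset> S" "Q \<noteq> {}"
    show "Q \<in> ?V \<or> insert 2 Q \<in> {?R}"
    proof (cases "{0,1} \<union> \<Delta> \<subseteq> Q")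
      case True then have "insert 2 Q = ?R" using Q(1) S' by blast
      then show ?thesis by simp
    next
      case False then show ?thesis using cov'[of Q] Q S' by blast
    qed
  qed (rule that)
  \<comment> \<open>The other facets of - + - \<Delta> are the thin simplex + - \<Delta>, the
    degenerate simplex - - \<Delta>, and simplices over the boundary of \<Delta>, which are thin by
    H.\<close>
  have "thn G (?R - {2})"
  proof (rule G(3)[rule_format])
    show "?R \<in> {?R}" by simp
    have "{0,1,2,4} \<subseteq> ?R" using \<Delta>(2) by auto
    then have "card {0,1,2,4::nat} \<le> card ?R" using \<Delta>(1) by (intro card_mono) auto
    then show "4 \<le> card ?R" by simp
    fix q assume q: "q \<in> ?R" "q \<noteq> 2"
    then consider "q = 0" | "q = 1" | "q \<in> \<Delta>" by blast
    then show "thn K (?R - {q})"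
    proof cases
      case 1 then show ?thesis using k2[of \<Delta>] R2 by simp
    next
      case 2 then show ?thesis using k3 R2 by simp
    next
      case 3
      then have "?R - {q} = {0,1,2} \<union> (\<Delta> - {q})" using \<Delta>(3) by auto
      moreover have "\<Delta> - {q} \<in> D" using 3 by (auto simp: D_def)
      ultimately show ?thesis using k1 by simp
    qed
  qed
  then have thG: "thn G ({0,1} \<union> \<Delta>)" unfolding R2 .
  have sG: "smap (cyl {0,1} (Pow \<Delta>)) G"
  proof (rule smap_subset[OF G(1)], rule subsetI)
    fix Q assume Q: "Q \<in> cyl {0,1} (Pow \<Delta>)"
    have "Q \<noteq> {}" "Q \<subseteq> ?R" using Q domW[OF Q] by (auto simp: cyl_def)
    show "Q \<in> ?V \<union> {?R} \<union> (\<lambda>S. S - {2}) ` {?R}"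
    proof (cases "{0,1} \<union> \<Delta> \<subseteq> Q")
      case True then have "Q = {0,1} \<union> \<Delta>" using domW[OF Q] by blast
      then show ?thesis using R2(1) by simp
    next
      case False then show ?thesis using cov'[OF \<open>Q \<subseteq> ?R\<close> \<open>Q \<noteq> {}\<close>] by blast
    qed
  qed
  have G1: "agree ?V1 (pull (pr 0 1 2 3) G) ?L1" and G3: "agree ?V3 (pull (pr 0 1 2 3) G) ?L3"
    by (rule agree_restrict_pr[OF G(2) _ K(3)] agree_restrict_pr[OF G(2) _ K(5)]; blast)+
  have a1: "agree (cyl {0,1} D) (pull (pr 0 1 2 3) G) (pull (pr 0 1 1 1) H)"
    by (rule agree_cyl[OF G1, where p=0 and q=1 and r=1 and s=1]) (simp_all add: pr_simps)
  have a2: "agree (cyl {0,1} D) (pull (pr 0 1 2 3) G) (pull (pr 0 1 2 3) F)"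
    by (rule agree_trans[OF a1 t(3)])
  have a3: "agree (cyl {0} (Pow \<Delta>)) (pull (pr 0 1 2 3) G) (pull (pr 0 1 2 3) F)"
    by (rule agree_cyl[OF G3, where p=0 and q=0 and r=0 and s=0]) (simp_all add: pr_simps)
  have "agree (cyl {0,1} D \<union> cyl {0} (Pow \<Delta>)) (pull id G) (pull id F)"
    using a2 a3 unfolding pr_id agree_def by blast
  then have "agree (cyl {0,1} D \<union> cyl {0} (Pow \<Delta>)) G F"
    by (rule agree_trans[OF agree_sym[OF pull_id] agree_trans[OF _ pull_id]])
  then show thesis using that sG thG by blast
qed

lemma rlp_left_horn:
  assumes n: "2 \<le> n"
  shows "rlp A (HornK n 0) (DeltaK n 0)"
  unfolding rlp_def
proof (intro allI impI)
  fix f assume f: "strat_map (HornK n 0) A f"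
  let ?\<Delta> = "{4..n+2}" and ?F = "pull unspread f"
  let ?D = "Pow ?\<Delta> - {?\<Delta>}"
  let ?U = "cyl {0,1} ?D \<union> cyl {0} (Pow ?\<Delta>)"
  let ?V = "{T. T \<noteq> {} \<and> T \<subseteq> {0..n} \<and> T \<union> {0} \<noteq> {0..n}}"
  have sf: "smap ?V f"
    by (rule smap_of_strat_map[OF f]) (simp_all add: HornK_def ops_eq_Ops)
  have imV: "unspread ` S \<in> ?V" if S: "S \<in> ?U" for S
  proof -
    have "S \<in> cyl {0,1} (Pow ?\<Delta>)" "S \<noteq> {}" using S by (auto simp: cyl_def)
    then have "unspread ` S \<subseteq> {0..n}" "unspread ` S \<noteq> {}" using unspread_image_le[of S n] n by auto
    \<comment> \<open>A vertex set of the domain that contains 1 misses some j in \<Delta>, that is,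
      the original vertex j - 2; one that does not contain 1 misses the original vertex 1.\<close>
    moreover have "unspread ` S \<union> {0} \<noteq> {0..n}"
    proof (cases "1 \<in> S")
      case True
      then have "S \<in> cyl {0,1} ?D" using S by (auto simp: cyl_def)
      then have "S \<inter> {4..} \<in> ?D" by (simp add: cyl_def)
      then have "S \<inter> {4..} \<subset> ?\<Delta>" by blast
      then obtain j where "j \<in> ?\<Delta>" "j \<notin> S \<inter> {4..}" by blast
      then have j: "j \<in> ?\<Delta>" "j \<notin> S" by auto
      have "j - 2 \<notin> unspread ` S"
      proof
        assume "j - 2 \<in> unspread ` S"
        then obtain i where i: "i \<in> S" "j - 2 = unspread i" by auto
        have "i = j" using i(2) j(1) by (auto simp: unspread_def split: if_splits)
        then show False using i j by simp
      qed
      moreover have "j - 2 \<in> {0..n}" "j - 2 \<noteq> 0" using j by auto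
      ultimately show ?thesis by (metis Un_iff singletonD)
    next
      case False
      have s: "S \<inter> {..<4} \<subseteq> {0,1}" using S by (auto simp: cyl_def)
      have "1 \<notin> unspread ` S"
      proof
        assume "1 \<in> unspread ` S"
        then obtain i where i: "i \<in> S" "1 = unspread i" by auto
        then have "i < 4" "i \<noteq> 0" by (auto simp: unspread_def split: if_splits)
        then have "i = 1" using s i(1) by auto
        then show False using i False by simp
      qed
      moreover have "1 \<in> {0..n}" using n by simp
      ultimately show ?thesis by (metis Un_iff singletonD zero_neq_one)
    qed
    ultimately show ?thesis by simp
  qed
  have sF: "smap ?U ?F" by (rule smap_pull[OF sf mono_unspread imV])
  have thf: "thn f T" if T: "{0,1} \<subseteq> T" "T \<in> ?V" for T
    unfolding thn_def
  proof (intro allI ballI impI)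
    fix m \<alpha> assume "\<alpha> \<in> Ops m" "\<alpha> ` {0..m} = T"
    then have "\<alpha> \<in> Thin (HornK n 0) m" using T by (auto simp: HornK_def DeltaK_def ops_eq_Ops)
    then show "f m \<alpha> \<in> Thin A m" using f unfolding strat_map_def by blast
  qed
  have mF: "marked ?D ?F" unfolding marked_def
  proof
    fix \<sigma> assume \<sigma>: "\<sigma> \<in> ?D"
    have "{0,1} \<union> \<sigma> \<in> cyl {0,1} ?D" by (subst Un_in_cyl) (use \<sigma> in auto)
    then have "unspread ` ({0,1} \<union> \<sigma>) \<in> ?V" by (intro imV) blast
    moreover have "{0,1} \<subseteq> unspread ` ({0,1} \<union> \<sigma>)" by (auto simp: unspread_def)
    ultimately show "thn ?F ({0,1} \<union> \<sigma>)" by (intro thn_pull[OF thf mono_unspread])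
  qed
  have \<Delta>: "finite ?\<Delta>" "4 \<in> ?\<Delta>" "?\<Delta> \<subseteq> {4..}" using n by auto
  obtain G where G: "smap (cyl {0,1} (Pow ?\<Delta>)) G" "agree ?U G ?F" "thn G ({0,1} \<union> ?\<Delta>)"
    using outer_extension[OF \<Delta> sF mF] .
  let ?g = "pull spread G"
  have ext: "?g m \<alpha> = f m \<alpha>" if a: "\<alpha> \<in> Simp (HornK n 0) m" for m \<alpha>
  proof -
    have a: "\<alpha> \<in> Ops m" "\<alpha> ` {0..m} \<subseteq> {0..n}" "\<alpha> ` {0..m} \<union> {0} \<noteq> {0..n}"
      using a by (simp_all add: HornK_def ops_eq_Ops)
    obtain j where j: "j \<le> n" "j \<noteq> 0" "j \<notin> \<alpha> ` {0..m}" using a(2,3) by fastforce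
    have c: "spread ` \<alpha> ` {0..m} \<in> cyl {0,1} (Pow ?\<Delta>)" using spread_image_cyl[OF a(2) _ n] by simp
    have nj: "spread j \<notin> spread ` \<alpha> ` {0..m}"
    proof
      assume "spread j \<in> spread ` \<alpha> ` {0..m}"
      then have "unspread (spread j) \<in> unspread ` spread ` \<alpha> ` {0..m}" by (rule imageI)
      then show False using j(3) by (simp add: image_image unspread_spread)
    qed
    have "spread ` \<alpha> ` {0..m} \<in> ?U"
    proof (cases "j = 1")
      case True
      then have "1 \<notin> spread ` \<alpha> ` {0..m}" using nj by (simp add: spread_def)
      then have "spread ` \<alpha> ` {0..m} \<in> cyl {0} (Pow ?\<Delta>)" by (rule cyl_remove_1[OF c])
      then show ?thesis by blast
    next
      case False
      then have "spread j \<in> ?\<Delta>" using j by (auto simp: spread_def)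
      then have "spread ` \<alpha> ` {0..m} \<inter> {4..} \<noteq> ?\<Delta>" using nj by blast
      then have "spread ` \<alpha> ` {0..m} \<in> cyl {0,1} ?D" using c by (simp add: cyl_def)
      then show ?thesis by blast
    qed
    then have "G m (opcomp m \<alpha> spread) = ?F m (opcomp m \<alpha> spread)"
      using G(2)[unfolded agree_def] opcomp_mono_in_Ops[OF mono_spread a(1)] unfolding image_opcomp[symmetric] by blast
    moreover have "opcomp m (opcomp m \<alpha> spread) unspread = \<alpha>"
      unfolding opcomp_twice by (rule opcomp_id[OF a(1)]) (simp add: unspread_spread)
    ultimately show ?thesis by (simp add: pull_def)
  qed
  have g: "strat_map (DeltaK n 0) A ?g"
  proof (rule strat_map_of_smap[OF G(1) mono_spread])
    fix m \<alpha> assume "\<alpha> \<in> Simp (DeltaK n 0) m"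
    then have "\<alpha> \<in> Ops m" "\<alpha> ` {0..m} \<subseteq> {0..n}" by (simp_all add: DeltaK_def ops_eq_Ops)
    then show "\<alpha> \<in> Ops m \<and> spread ` \<alpha> ` {0..m} \<in> cyl {0,1} (Pow ?\<Delta>)" using spread_image_cyl[OF _ _ n] by simp
  next
    fix m \<alpha> assume t: "\<alpha> \<in> Thin (DeltaK n 0) m"
    then have a: "\<alpha> \<in> ops m n" by (simp add: DeltaK_def)
    have aO: "\<alpha> \<in> Ops m" "\<alpha> ` {0..m} \<subseteq> {0..n}" using a by (simp_all add: ops_eq_Ops)
    have "(\<exists>i<m. \<alpha> (Suc i) = \<alpha> i) \<or> ?g m \<alpha> \<in> Thin A m"
    proof (cases "degenerate (stdsimp n) m \<alpha>")
      case True then show ?thesis using degenerate_stdsimp_iff[OF a] by blast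
    next
      case False
      \<comment> \<open>A nondegenerate thin simplex contains the pivot 0. It therefore either has
        all vertices, where G is thin, or belongs to the horn, where f is a stratified map.\<close>
      then have "0 \<in> \<alpha> ` {0..m}" using t n by (auto simp: DeltaK_def)
      show ?thesis
      proof (cases "\<alpha> ` {0..m} = {0..n}")
        case True
        then have "opcomp m \<alpha> spread ` {0..m} = {0,1} \<union> ?\<Delta>" unfolding image_opcomp using spread_image[OF n] by simp
        then show ?thesis using G(3) opcomp_mono_in_Ops[OF mono_spread aO(1)] unfolding thn_def pull_def by blast
      next
        case False
        then have "\<alpha> ` {0..m} \<union> {0} \<noteq> {0..n}" using \<open>0 \<in> \<alpha> ` {0..m}\<close> by (simp add: insert_absorb)
        then have h: "\<alpha> \<in> Thin (HornK n 0) m" "\<alpha> \<in> Simp (HornK n 0) m" using t a by (simp_all add: HornK_def)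
        have "f m \<alpha> \<in> Thin A m" using f h(1) unfolding strat_map_def by blast
        then show ?thesis using ext[OF h(2)] by simp
      qed
    qed
    then show "\<alpha> \<in> Simp (DeltaK n 0) m \<and> ((\<exists>i<m. \<alpha> (Suc i) = \<alpha> i) \<or> ?g m \<alpha> \<in> Thin A m)"
      using a by (simp add: DeltaK_def)
  qed (simp add: DeltaK_def)
  then show "\<exists>g. strat_map (DeltaK n 0) A g \<and> (\<forall>m x. x \<in> Simp (HornK n 0) m \<longrightarrow> g m x = f m x)"
    using ext by blast
qed

end

section \<open>Duality\<close>

text \<open>The operator \<alpha> conjugated by the order reversals of [m] and [n].\<close>

definition rev_op :: "nat \<Rightarrow> nat \<Rightarrow> (nat \<Rightarrow> nat) \<Rightarrow> nat \<Rightarrow> nat" where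
  "rev_op m n \<alpha> = (\<lambda>i. if i \<le> m then n - \<alpha> (m - i) else 0)"

lemma rev_op_in_ops: "\<alpha> \<in> ops m n \<Longrightarrow> rev_op m n \<alpha> \<in> ops m n"
  by (auto simp: ops_def rev_op_def intro!: diff_le_mono2)

lemma rev_op_rev_op: "\<alpha> \<in> ops m n \<Longrightarrow> rev_op m n (rev_op m n \<alpha>) = \<alpha>"
  by (auto simp: ops_def rev_op_def fun_eq_iff)

lemma rev_op_opcomp:
  "\<beta> \<in> ops k m \<Longrightarrow> rev_op k n (opcomp k \<beta> \<alpha>) = opcomp k (rev_op k m \<beta>) (rev_op m n \<alpha>)"
  by (auto simp: ops_def rev_op_def opcomp_def fun_eq_iff)

lemma rev_op_idop: "rev_op n n (idop n) = idop n"
  by (auto simp: rev_op_def idop_def fun_eq_iff)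

lemma rev_op_face: "1 \<le> n \<Longrightarrow> i \<le> n \<Longrightarrow> rev_op (n - 1) n (face n i) = face n (n - i)"
  by (auto simp: rev_op_def face_def fun_eq_iff)

lemma image_rev_op: "rev_op m n \<alpha> ` {0..m} = (\<lambda>x. n - x) ` \<alpha> ` {0..m}"
proof -
  have "(\<lambda>i. m - i) ` {0..m} = {0..m}"
  proof
    show "{0..m} \<subseteq> (\<lambda>i. m - i) ` {0..m}"
    proof
      fix i assume "i \<in> {0..m}" then have "i = m - (m - i)" "m - i \<in> {0..m}" by auto
      then show "i \<in> (\<lambda>i. m - i) ` {0..m}" by (rule image_eqI)
    qed
  qed auto
  then have "(\<lambda>x. n - x) ` \<alpha> ` {0..m} = (\<lambda>x. n - x) ` \<alpha> ` (\<lambda>i. m - i) ` {0..m}" by simp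
  also have "\<dots> = rev_op m n \<alpha> ` {0..m}" unfolding image_image by (rule image_cong) (auto simp: rev_op_def)
  finally show ?thesis by simp
qed

lemma rev_image_rev: "S \<subseteq> {0..n} \<Longrightarrow> (\<lambda>x. n - x) ` (\<lambda>x. n - x) ` S = (S :: nat set)"
  by (force simp: image_image)

lemma rev_image_all: "(\<lambda>x. n - x) ` {0..n} = {0..n::nat}"
  using image_rev_op[of n n "idop n"] unfolding rev_op_idop by (simp add: idop_def)

text \<open>A symmetric relation is used because the double dual need not be equal to A: the two
  actions are compared only on operators.\<close>

definition opposite :: "'a strat \<Rightarrow> 'a strat \<Rightarrow> bool" where
  "opposite A B \<longleftrightarrow> Simp A = Simp B \<and> Thin A = Thin B \<and>
     (\<forall>m n \<alpha> x. \<alpha> \<in> ops m n \<longrightarrow> Act B m n \<alpha> x = Act A m n (rev_op m n \<alpha>) x)"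

definition dual :: "'a strat \<Rightarrow> 'a strat" where
  "dual A = A\<lparr>Act := (\<lambda>m n \<alpha> x. Act A m n (rev_op m n \<alpha>) x)\<rparr>"

lemma opposite_dual: "opposite A (dual A)" by (simp add: opposite_def dual_def)

lemma opposite_sym: "opposite A B \<Longrightarrow> opposite B A"
  by (simp add: opposite_def rev_op_in_ops rev_op_rev_op)

text \<open>One direction only: transporting a lifting property takes both directions for the
  smaller stratified set but a single one for the larger.\<close>

definition mirror :: "nat \<Rightarrow> (nat \<Rightarrow> nat) strat \<Rightarrow> (nat \<Rightarrow> nat) strat \<Rightarrow> bool" where
  "mirror n U V \<longleftrightarrow> Act U = (\<lambda>m m' \<beta> x. opcomp m \<beta> x) \<and> Act V = (\<lambda>m m' \<beta> x. opcomp m \<beta> x) \<and>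
    (\<forall>m \<alpha>. \<alpha> \<in> Simp U m \<longrightarrow> \<alpha> \<in> ops m n \<and> rev_op m n \<alpha> \<in> Simp V m) \<and>
    (\<forall>m \<alpha>. \<alpha> \<in> Thin U m \<longrightarrow> rev_op m n \<alpha> \<in> Thin V m)"

lemma strat_map_rev:
  assumes "opposite A B" "mirror n U V" "strat_map V A f"
  shows "strat_map U B (\<lambda>m \<alpha>. f m (rev_op m n \<alpha>))"
proof -
  have f: "\<And>m x. x \<in> Simp V m \<Longrightarrow> f m x \<in> Simp A m" "\<And>m x. x \<in> Thin V m \<Longrightarrow> f m x \<in> Thin A m"
    "\<And>k m \<beta> x. \<beta> \<in> ops k m \<Longrightarrow> x \<in> Simp V m \<Longrightarrow> f k (Act V k m \<beta> x) = Act A k m \<beta> (f m x)"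
    using assms(3) unfolding strat_map_def by blast+
  have u: "\<And>m \<alpha>. \<alpha> \<in> Simp U m \<Longrightarrow> \<alpha> \<in> ops m n \<and> rev_op m n \<alpha> \<in> Simp V m"
    "\<And>m \<alpha>. \<alpha> \<in> Thin U m \<Longrightarrow> rev_op m n \<alpha> \<in> Thin V m"
    "Act U = (\<lambda>m m' \<beta> x. opcomp m \<beta> x)" "Act V = (\<lambda>m m' \<beta> x. opcomp m \<beta> x)"
    using assms(2) unfolding mirror_def by blast+
  have b: "Simp B = Simp A" "Thin B = Thin A" "\<And>m n \<alpha> x. \<alpha> \<in> ops m n \<Longrightarrow> Act B m n \<alpha> x = Act A m n (rev_op m n \<alpha>) x"
    using assms(1) unfolding opposite_def by auto
  have "f k (rev_op k n (Act U k m \<beta> \<alpha>)) = Act B k m \<beta> (f m (rev_op m n \<alpha>))" if "\<beta> \<in> ops k m" "\<alpha> \<in> Simp U m" for k m \<beta> \<alpha>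
    using f(3)[OF rev_op_in_ops[OF that(1)]] u(1)[OF that(2)] that(1)
    by (simp add: u(3,4) b(3) rev_op_opcomp)
  then show ?thesis unfolding strat_map_def b(1,2) using f(1,2) u(1,2) by blast
qed

text \<open>Reversing vertices turns a lifting problem against B into one against A, and the
  solution is reversed back.\<close>

lemma rlp_mirror:
  assumes "opposite A B" "mirror n U U'" "mirror n U' U" "mirror n V' V" "rlp A U V"
  shows "rlp B U' V'"
  unfolding rlp_def
proof (intro allI impI)
  fix f assume "strat_map U' B f"
  then have "strat_map U A (\<lambda>m \<alpha>. f m (rev_op m n \<alpha>))"
    by (rule strat_map_rev[OF opposite_sym[OF assms(1)] assms(2)])
  then obtain g where g: "strat_map V A g" "\<And>m x. x \<in> Simp U m \<Longrightarrow> g m x = f m (rev_op m n x)"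
    using assms(5) unfolding rlp_def by blast
  have "strat_map V' B (\<lambda>m \<alpha>. g m (rev_op m n \<alpha>))" by (rule strat_map_rev[OF assms(1,4) g(1)])
  moreover have "g m (rev_op m n x) = f m x" if "x \<in> Simp U' m" for m x
  proof -
    have "rev_op m n x \<in> Simp U m" "x \<in> ops m n" using assms(3) that unfolding mirror_def by blast+
    then show ?thesis using g(2) by (simp add: rev_op_rev_op)
  qed
  ultimately show "\<exists>g. strat_map V' B g \<and> (\<forall>m x. x \<in> Simp U' m \<longrightarrow> g m x = f m x)" by blast
qed

lemma rev_op_Thin_DeltaK:
  assumes "k \<le> n" "\<alpha> \<in> Thin (DeltaK n k) m"
  shows "rev_op m n \<alpha> \<in> Thin (DeltaK n (n - k)) m"
proof -
  have a: "\<alpha> \<in> ops m n" using assms(2) by (simp add: DeltaK_def)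
  note r = rev_op_in_ops[OF a]
  consider "degenerate (stdsimp n) m \<alpha>" | "{k - 1, k, k + 1} \<inter> {0..n} \<subseteq> \<alpha> ` {0..m}"
    using assms(2) by (auto simp: DeltaK_def)
  then show ?thesis
  proof cases
    case 1
    then obtain i where i: "i < m" "\<alpha> (Suc i) = \<alpha> i" using degenerate_stdsimp_iff[OF a] by blast
    then have "rev_op m n \<alpha> (Suc (m - Suc i)) = rev_op m n \<alpha> (m - Suc i)" "m - Suc i < m"
      by (auto simp: rev_op_def Suc_diff_Suc)
    then have "degenerate (stdsimp n) m (rev_op m n \<alpha>)" using degenerate_stdsimp_iff[OF r] by blast
    then show ?thesis using r by (simp add: DeltaK_def)
  next
    case 2
    \<comment> \<open>For k = n truncated subtraction turns n - k - 1 into n - k, which adds no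
      condition; for k = 0 the vertex n - k + 1 is removed by the intersection.\<close>
    have "{n - k - 1, n - k, n - k + 1} \<inter> {0..n} \<subseteq> (\<lambda>x. n - x) ` \<alpha> ` {0..m}"
    proof
      fix y assume y: "y \<in> {n - k - 1, n - k, n - k + 1} \<inter> {0..n}"
      then have "n - y \<in> {k - 1, k, k + 1} \<inter> {0..n}" using assms(1) by auto
      then have "n - y \<in> \<alpha> ` {0..m}" using 2 by blast
      moreover have "y = n - (n - y)" using y by auto
      ultimately show "y \<in> (\<lambda>x. n - x) ` \<alpha> ` {0..m}" by (rule rev_image_eqI)
    qed
    then have "{n - k - 1, n - k, n - k + 1} \<inter> {0..n} \<subseteq> rev_op m n \<alpha> ` {0..m}" by (simp only: image_rev_op)
    then show ?thesis using r by (simp add: DeltaK_def)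
  qed
qed

lemma mirror_DeltaK: "k \<le> n \<Longrightarrow> mirror n (DeltaK n k) (DeltaK n (n - k))"
  using rev_op_Thin_DeltaK rev_op_in_ops unfolding mirror_def by (simp add: DeltaK_def)

lemma rev_op_horn:
  assumes "\<alpha> \<in> ops m n" "k \<le> n" "\<alpha> ` {0..m} \<union> {k} \<noteq> {0..n}"
  shows "rev_op m n \<alpha> ` {0..m} \<union> {n - k} \<noteq> {0..n}"
proof
  assume "rev_op m n \<alpha> ` {0..m} \<union> {n - k} = {0..n}"
  then have "(\<lambda>x. n - x) ` (\<alpha> ` {0..m} \<union> {k}) = {0..n}" unfolding image_rev_op by simp
  then have "(\<lambda>x. n - x) ` (\<lambda>x. n - x) ` (\<alpha> ` {0..m} \<union> {k}) = {0..n}" by (simp only: rev_image_all)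
  moreover have "\<alpha> ` {0..m} \<union> {k} \<subseteq> {0..n}" using image_ops_le[OF assms(1)] assms(2) by simp
  ultimately show False using rev_image_rev assms(3) by metis
qed

lemma mirror_HornK: "k \<le> n \<Longrightarrow> mirror n (HornK n k) (HornK n (n - k))"
proof -
  assume k: "k \<le> n"
  have "\<alpha> \<in> ops m n" if "\<alpha> \<in> Thin (DeltaK n k) m" for m \<alpha> using that by (simp add: DeltaK_def)
  then show ?thesis
    using k rev_op_Thin_DeltaK rev_op_horn rev_op_in_ops unfolding mirror_def HornK_def by simp
qed

lemma mirror_DeltaK': assumes "1 \<le> n" "k \<le> n" shows "mirror n (DeltaK' n k) (DeltaK' n (n - k))"
proof -
  have "rev_op m n \<alpha> \<in> Thin (DeltaK' n (n - k)) m" if t: "\<alpha> \<in> Thin (DeltaK' n k) m" for m \<alpha>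
  proof (cases "\<alpha> \<in> Thin (DeltaK n k) m")
    case True then show ?thesis using rev_op_Thin_DeltaK[OF assms(2)] by (simp add: DeltaK'_def)
  next
    case False
    then obtain i where i: "m = n - 1" "\<alpha> = face n i" "i \<le> n" "i \<noteq> k" using t by (auto simp: DeltaK'_def split: if_splits)
    then have "rev_op m n \<alpha> = face n (n - i)" "n - i \<le> n" "n - i \<noteq> n - k" using rev_op_face assms by auto
    then show ?thesis using i(1) by (auto simp: DeltaK'_def)
  qed
  then show ?thesis using mirror_DeltaK[OF assms(2)] unfolding mirror_def by (simp add: DeltaK'_def)
qed

lemma mirror_DeltaK'': assumes "1 \<le> n" "k \<le> n" shows "mirror n (DeltaK'' n k) (DeltaK'' n (n - k))"
proof -
  have "rev_op m n \<alpha> \<in> Thin (DeltaK'' n (n - k)) m" if t: "\<alpha> \<in> Thin (DeltaK'' n k) m" for m \<alpha>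
  proof (cases "\<alpha> \<in> Thin (DeltaK n k) m")
    case True then show ?thesis using rev_op_Thin_DeltaK[OF assms(2)] by (simp add: DeltaK''_def)
  next
    case False
    then obtain i where i: "m = n - 1" "\<alpha> = face n i" "i \<le> n" using t by (auto simp: DeltaK''_def split: if_splits)
    then have "rev_op m n \<alpha> = face n (n - i)" "n - i \<le> n" using rev_op_face assms by auto
    then show ?thesis using i(1) by (auto simp: DeltaK''_def)
  qed
  then show ?thesis using mirror_DeltaK[OF assms(2)] unfolding mirror_def by (simp add: DeltaK''_def)
qed

lemma rlp_opposite_horn:
  assumes "opposite A B" "k \<le> n" "rlp A (HornK n k) (DeltaK n k)"
  shows "rlp B (HornK n (n - k)) (DeltaK n (n - k))"
proof -
  have k: "n - k \<le> n" "n - (n - k) = k" using assms(2) by auto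
  show ?thesis
    using rlp_mirror[OF assms(1) mirror_HornK[OF assms(2)] _ _ assms(3)]
      mirror_HornK[OF k(1)] mirror_DeltaK[OF k(1)] unfolding k(2) by blast
qed

lemma rlp_opposite_prime:
  assumes "opposite A B" "1 \<le> n" "k \<le> n" "rlp A (DeltaK' n k) (DeltaK'' n k)"
  shows "rlp B (DeltaK' n (n - k)) (DeltaK'' n (n - k))"
proof -
  have k: "n - k \<le> n" "n - (n - k) = k" using assms(3) by auto
  show ?thesis
    using rlp_mirror[OF assms(1) mirror_DeltaK'[OF assms(2,3)] _ _ assms(4)]
      mirror_DeltaK'[OF assms(2) k(1)] mirror_DeltaK''[OF assms(2) k(1)] unfolding k(2) by blast
qed

section \<open>The opposite stratified set and the outer extensions at the last vertex\<close>

lemma stratified_set_dual: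
  assumes "stratified_set A" shows "stratified_set (dual A)"
proof -
  interpret stratified A by unfold_locales fact
  have "simplicial_set (dual A)"
    unfolding simplicial_set_def dual_def
    by (auto simp: Act_in rev_op_in_ops rev_op_idop Act_id rev_op_opcomp Act_opcomp)
  moreover have "degenerate A n x" if d: "degenerate (dual A) n x" for n x
  proof -
    obtain m \<sigma> y where y: "m < n" "\<sigma> \<in> ops n m" "\<sigma> ` {0..n} = {0..m}" "y \<in> Simp A m" "x = Act A n m (rev_op n m \<sigma>) y"
      using d unfolding degenerate_def by (auto simp: dual_def)
    have "rev_op n m \<sigma> ` {0..n} = {0..m}" unfolding image_rev_op y(3) by (rule rev_image_all)
    then show ?thesis unfolding degenerate_def using y(1,4,5) rev_op_in_ops[OF y(2)] by blast
  qed
  ultimately show ?thesis using assms unfolding stratified_set_def by (simp add: dual_def)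
qed

text \<open>Reversal interchanges the edges 01 and 12 and keeps 02, so composition changes its
  order.\<close>

lemma tri_dual: "tri (dual A) s a b c \<longleftrightarrow> tri A s b a c"
proof -
  have "rev_op 1 2 (face 2 0) = face 2 2" "rev_op 1 2 (face 2 1) = face 2 1" "rev_op 1 2 (face 2 2) = face 2 0"
    using rev_op_face[of 2] by auto
  then show ?thesis unfolding tri_def dual_def by (auto simp del: One_nat_def)
qed

text \<open>The notion is self-dual: the inverse stays the same, while source and target and with
  them s and t change places.\<close>

lemma is_equiv_dual: "is_equiv (dual A) v \<longleftrightarrow> is_equiv A v"
proof -
  have "rev_op 1 1 (vop 0) = vop 1" "rev_op 1 1 (vop 1) = vop 0" by (auto simp: rev_op_def vop_def fun_eq_iff)
  then have e: "Act (dual A) 1 1 (vop 0) v = Act A 1 1 (vop 1) v" "Act (dual A) 1 1 (vop 1) v = Act A 1 1 (vop 0) v"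
    by (simp_all add: dual_def del: One_nat_def)
  show ?thesis unfolding is_equiv_def tri_dual e by (auto simp: dual_def)
qed

text \<open>Reversal takes (n, k) to (n, n - k), which preserves inner pivots and fixes the
  exceptional pair (2, 1).\<close>

lemma inner_complicial_equiv_dual:
  assumes "inner_complicial_equiv A" shows "inner_complicial_equiv (dual A)"
proof -
  interpret inner_complicial_equiv A by fact
  show ?thesis
  proof
    show "stratified_set (dual A)" by (rule stratified_set_dual[OF strat])
    show "rlp (dual A) (HornK n k) (DeltaK n k)" if "0 < k" "k < n" for n k
      using rlp_opposite_horn[OF opposite_dual, of "n - k" n] inner1[of "n - k" n] that by simp
    show "rlp (dual A) (DeltaK' n k) (DeltaK'' n k)" if "2 \<le> n" "0 < k" "k < n" "(n, k) \<noteq> (2, 1)" for n k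
      using rlp_opposite_prime[OF opposite_dual, of n "n - k"] inner2[of n "n - k"] that by force
    show "v \<in> Thin (dual A) 1 \<longleftrightarrow> is_equiv (dual A) v" for v
      unfolding is_equiv_dual using Thin1_iff[of v] by (simp add: dual_def)
  qed
qed

lemma (in inner_complicial_equiv) rlp_left_outer:
  "1 \<le> n \<Longrightarrow> rlp A (HornK n 0) (DeltaK n 0)" "2 \<le> n \<Longrightarrow> rlp A (DeltaK' n 0) (DeltaK'' n 0)"
proof -
  show "rlp A (HornK n 0) (DeltaK n 0)" if "1 \<le> n"
    using that rlp_left_horn_1 rlp_left_horn by (cases "n = 1") simp_all
  show "rlp A (DeltaK' n 0) (DeltaK'' n 0)" if "2 \<le> n"
    using that rlp_prime_2_0 rlp_left_prime by (cases "n = 2") simp_all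
qed

lemma (in inner_complicial_equiv) weak_complicial: "weak_complicial A"
proof -
  interpret d: inner_complicial_equiv "dual A"
    by (rule inner_complicial_equiv_dual) (rule inner_complicial_equiv_axioms)
  have op: "opposite (dual A) A" by (rule opposite_sym[OF opposite_dual])
  have "rlp A (HornK n k) (DeltaK n k)" if nk: "1 \<le> n" "k \<le> n" for n k
  proof -
    consider "k = 0" | "0 < k" "k < n" | "k = n" using nk by linarith
    then show ?thesis
    proof cases
      case 1 then show ?thesis using rlp_left_outer nk by simp
    next
      case 2 then show ?thesis by (rule inner1)
    next
      case 3 then show ?thesis using rlp_opposite_horn[OF op _ d.rlp_left_outer(1)[OF nk(1)]] by simp
    qed
  qed
  moreover have "rlp A (DeltaK' n k) (DeltaK'' n k)" if nk: "2 \<le> n" "k \<le> n" for n k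
  proof -
    consider "k = 0" | "0 < k" "k < n" "(n, k) \<noteq> (2, 1)" | "n = 2" "k = 1" | "k = n" using nk
      by (cases "k = 0"; cases "k = n"; cases "n = 2 \<and> k = 1") auto
    then show ?thesis
    proof cases
      case 1 then show ?thesis using rlp_left_outer nk by simp
    next
      case 2 then show ?thesis using inner2 nk by blast
    next
      case 3 then show ?thesis using rlp_prime_2_1 by simp
    next
      case 4 then show ?thesis using rlp_opposite_prime[OF op _ _ d.rlp_left_outer(2)[OF nk(1)]] nk by simp
    qed
  qed
  ultimately show ?thesis unfolding weak_complicial_def using strat by blast
qed

section \<open>Maps out of th1E2\<close>

lemma actE_actE: "\<beta> \<in> ops m n \<Longrightarrow> actE m n \<beta> (actE n l \<alpha> x) = actE m l (opcomp m \<beta> \<alpha>) x"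
  by (auto simp: actE_def opcomp_def ops_def fun_eq_iff)

lemma Simp_E2: "x \<in> Simp E2 m \<longleftrightarrow> (\<exists>\<alpha>\<in>ops m 2. x = actE m 2 \<alpha> mpm \<or> x = actE m 2 \<alpha> pmp)"
  by (auto simp: E2_def)

lemma Act_E2: "Act E2 = actE" by (simp add: E2_def)

context stratified begin

text \<open>The words -+- and +-+ are thin in \<open>th1E2\<close> because their dimension exceeds
  1; their images are the triangles s and t, and the image of +- is the inverse.\<close>

lemma is_equiv_if_th1E2:
  assumes f: "strat_map th1E2 A f"
  shows "is_equiv A (f 1 e1minus)"
proof -
  have id: "idop 2 \<in> ops 2 2" by (auto simp: ops_def idop_def)
  have g: "mpm = actE 2 2 (idop 2) mpm" "pmp = actE 2 2 (idop 2) pmp"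
    by (auto simp: actE_def idop_def mpm_def pmp_def fun_eq_iff)
  have sm: "mpm \<in> Simp E2 2" "pmp \<in> Simp E2 2" unfolding Simp_E2 using g id by blast+
  have act: "Act A m n \<alpha> (f n x) = f m (actE m n \<alpha> x)" if "\<alpha> \<in> ops m n" "x \<in> Simp E2 n" for m n \<alpha> x
  proof -
    have "f m (Act th1E2 m n \<alpha> x) = Act A m n \<alpha> (f n x)"
      using f that unfolding strat_map_def by (simp add: th1E2_def)
    then show ?thesis by (simp add: th1E2_def)
  qed
  define v' :: "nat \<Rightarrow> bool" where "v' = (\<lambda>i. i = 0)"
  have faces: "actE 1 2 (face 2 2) mpm = e1minus" "actE 1 2 (face 2 0) mpm = v'" "actE 1 2 (face 2 1) mpm = actE 1 1 (vop 0) e1minus"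
    "actE 1 2 (face 2 2) pmp = v'" "actE 1 2 (face 2 0) pmp = e1minus" "actE 1 2 (face 2 1) pmp = actE 1 1 (vop 1) e1minus"
    by (auto simp: actE_def face_def mpm_def pmp_def e1minus_def v'_def vop_def fun_eq_iff)
  have e: "e1minus \<in> Simp E2 1" "v' \<in> Simp E2 1" unfolding Simp_E2 using faces(1,2) face2_in_ops by metis+
  have th: "f 2 mpm \<in> Thin A 2" "f 2 pmp \<in> Thin A 2"
    using f sm unfolding strat_map_def by (simp_all add: th1E2_def)
  have S: "f 1 x \<in> Simp A 1" if "x \<in> Simp E2 1" for x
    using f that unfolding strat_map_def by (simp add: th1E2_def)
  have c: "Act A 1 1 (vop j) (f 1 e1minus) = f 1 (actE 1 1 (vop j) e1minus)" if "j \<le> 1" for j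
    by (rule act[OF vop_in_ops[OF that] e(1)])
  have "tri A (f 2 mpm) (f 1 e1minus) (f 1 v') (Act A 1 1 (vop 0) (f 1 e1minus))"
    "tri A (f 2 pmp) (f 1 v') (f 1 e1minus) (Act A 1 1 (vop 1) (f 1 e1minus))"
    unfolding tri_def using th act[OF _ sm(1)] act[OF _ sm(2)] face2_in_ops faces c by (simp_all del: One_nat_def)
  then show ?thesis unfolding is_equiv_def using S e by blast
qed

text \<open>Words of the form - ... - + ... +. Applied to the negated word it describes + ... + -
  ... -, and together these are the words with at most one change of sign.\<close>

definition nondec :: "nat \<Rightarrow> (nat \<Rightarrow> bool) \<Rightarrow> bool" where
  "nondec m x \<longleftrightarrow> (\<forall>i j. i \<le> j \<and> j \<le> m \<longrightarrow> x i \<longrightarrow> x j)"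

text \<open>The image of a word is read off from v or w if the word has at most one change of sign; a word
  with two changes of sign determines the operator whose action on s or t it is.\<close>

definition E2_map :: "'a \<Rightarrow> 'a \<Rightarrow> 'a \<Rightarrow> 'a \<Rightarrow> nat \<Rightarrow> (nat \<Rightarrow> bool) \<Rightarrow> 'a" where
  "E2_map v w s t m x =
    (if nondec m x then Act A m 1 (\<lambda>i. if i \<le> m \<and> x i then 1 else 0) v
     else if nondec m (\<lambda>i. \<not> x i) then Act A m 1 (\<lambda>i. if i \<le> m \<and> \<not> x i then 1 else 0) w
     else Act A m 2 (\<lambda>i. if i \<le> m then if x i \<noteq> x 0 then 1 else if \<exists>j\<le>i. x j \<noteq> x 0 then 2 else 0 else 0)
            (if x 0 then t else s))"

lemma Act_factor:
  assumes "\<beta> \<in> ops m 1" "\<theta> \<in> ops 1 2" "s \<in> Simp A 2" "opcomp m \<beta> \<theta> = \<alpha>" "Act A 1 2 \<theta> s = v"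
  shows "Act A m 2 \<alpha> s = Act A m 1 \<beta> v"
  using Act_opcomp[OF assms(2,1,3)] assms(4,5) by simp

text \<open>An operator to [2] is onto or factors through the face opposite a vertex that it misses.
  The side conditions in the second and third cases make the four cases disjoint and record which
  letters occur in the resulting word.\<close>

lemma ops2_cases:
  assumes a: "\<alpha> \<in> ops m 2"
  obtains (no1) \<beta> where "\<beta> \<in> ops m 1" "opcomp m \<beta> (face 2 1) = \<alpha>" "\<And>i. i \<le> m \<Longrightarrow> \<alpha> i \<noteq> 1"
  | (no0) \<beta> where "\<beta> \<in> ops m 1" "opcomp m \<beta> (face 2 0) = \<alpha>" "\<beta> = (\<lambda>i. if i \<le> m \<and> \<alpha> i \<noteq> 1 then 1 else 0)"
      "\<And>i. i \<le> m \<Longrightarrow> \<alpha> i \<noteq> 0" "\<exists>i\<le>m. \<alpha> i = 1"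
  | (no2) "\<alpha> \<in> ops m 1" "opcomp m \<alpha> (face 2 2) = \<alpha>" "\<And>i. i \<le> m \<Longrightarrow> \<alpha> i \<noteq> 2" "\<exists>i\<le>m. \<alpha> i = 1" "\<exists>i\<le>m. \<alpha> i = 0"
  | (all) "\<exists>i\<le>m. \<alpha> i = 0" "\<exists>i\<le>m. \<alpha> i = 1" "\<exists>i\<le>m. \<alpha> i = 2"
proof -
  have le: "\<alpha> i \<le> 2" if "i \<le> m" for i using a that by (simp add: ops_def)
  have mon: "\<alpha> i \<le> \<alpha> j" if "i \<le> j" "j \<le> m" for i j using a that by (simp add: ops_def)
  have z: "\<alpha> i = 0" if "\<not> i \<le> m" for i using a that by (simp add: ops_def)
  have c3: "\<alpha> i = 0 \<or> \<alpha> i = 1 \<or> \<alpha> i = 2" if "i \<le> m" for i using le[OF that] by auto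
  consider "\<forall>i\<le>m. \<alpha> i \<noteq> 1" | "\<forall>i\<le>m. \<alpha> i \<noteq> 0" "\<exists>i\<le>m. \<alpha> i = 1"
    | "\<forall>i\<le>m. \<alpha> i \<noteq> 2" "\<exists>i\<le>m. \<alpha> i = 1" "\<exists>i\<le>m. \<alpha> i = 0"
    | "\<exists>i\<le>m. \<alpha> i = 0" "\<exists>i\<le>m. \<alpha> i = 1" "\<exists>i\<le>m. \<alpha> i = 2" by meson
  then show thesis
  proof cases
    case 1
    let ?\<beta> = "\<lambda>i. if i \<le> m \<and> \<alpha> i = 2 then 1 else 0 :: nat"
    have m2: "\<alpha> j = 2" if "i \<le> j" "j \<le> m" "\<alpha> i = 2" for i j using mon[OF that(1,2)] le[OF that(2)] that(3) by simp
    have "?\<beta> \<in> ops m 1" using m2 by (auto simp: ops_def)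
    moreover have "opcomp m ?\<beta> (face 2 1) = \<alpha>"
    proof
      fix i show "opcomp m ?\<beta> (face 2 1) i = \<alpha> i" using c3[of i] 1 z[of i] by (auto simp: opcomp_def face_def)
    qed
    ultimately show thesis using no1 1 by blast
  next
    case 2
    let ?\<beta> = "\<lambda>i. if i \<le> m \<and> \<alpha> i \<noteq> 1 then 1 else 0 :: nat"
    have m2: "\<alpha> i = 1" if "i \<le> j" "j \<le> m" "\<alpha> j = 1" for i j
    proof -
      have "i \<le> m" using that by simp
      then have "\<alpha> i \<noteq> 0" using 2(1) by blast
      then show ?thesis using mon[OF that(1,2)] that(3) by simp
    qed
    have "?\<beta> \<in> ops m 1" using m2 by (auto simp: ops_def)
    moreover have "opcomp m ?\<beta> (face 2 0) = \<alpha>"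
    proof
      fix i show "opcomp m ?\<beta> (face 2 0) i = \<alpha> i" using c3[of i] 2(1) z[of i] by (auto simp: opcomp_def face_def)
    qed
    ultimately show thesis using no0 2 by blast
  next
    case 3
    have "\<alpha> i \<le> 1" if "i \<le> m" for i using c3[OF that] 3(1) that by auto
    then have "\<alpha> \<in> ops m 1" using a by (auto simp: ops_def)
    moreover have "opcomp m \<alpha> (face 2 2) = \<alpha>"
    proof
      fix i show "opcomp m \<alpha> (face 2 2) i = \<alpha> i" using c3[of i] 3(1) z[of i] by (auto simp: opcomp_def face_def)
    qed
    ultimately show thesis using no2 3 by blast
  next
    case 4 then show thesis using all by blast
  qed
qed

text \<open>The letters that differ from the first one mark where \<alpha> takes the value 1; by
  monotonicity it is 0 before that stretch and 2 after it.\<close>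

lemma ops2_recover:
  assumes a: "\<alpha> \<in> ops m 2" "\<exists>i\<le>m. \<alpha> i = 0" and x: "\<And>i. i \<le> m \<Longrightarrow> x i \<noteq> x 0 \<longleftrightarrow> \<alpha> i = 1" and "\<exists>i\<le>m. \<alpha> i = 1"
  shows "(\<lambda>i. if i \<le> m then if x i \<noteq> x 0 then 1 else if \<exists>j\<le>i. x j \<noteq> x 0 then 2 else 0 else 0) = \<alpha>"
proof
  fix i
  have mon: "\<alpha> i \<le> \<alpha> j" if "i \<le> j" "j \<le> m" for i j using a that by (simp add: ops_def)
  obtain k where k: "k \<le> m" "\<alpha> k = 1" using assms(4) by blast
  show "(if i \<le> m then if x i \<noteq> x 0 then 1 else if \<exists>j\<le>i. x j \<noteq> x 0 then 2 else 0 else 0) = \<alpha> i"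
  proof (cases "i \<le> m")
    case False then show ?thesis using a by (simp add: ops_def)
  next
    case True
    have "\<alpha> i \<le> 2" using a True by (simp add: ops_def)
    then consider "\<alpha> i = 0" | "\<alpha> i = 1" | "\<alpha> i = 2" by linarith
    then show ?thesis
    proof cases
      case 1
      have e: "\<not> x i \<noteq> x 0" using x[OF True] 1 by simp
      have ne: "\<not> (\<exists>j\<le>i. x j \<noteq> x 0)"
      proof
        assume "\<exists>j\<le>i. x j \<noteq> x 0"
        then obtain j where "j \<le> i" "\<alpha> j = 1" using x True by auto
        then show False using mon[of j i] True 1 by simp
      qed
      show ?thesis unfolding if_P[OF True] if_not_P[OF e] if_not_P[OF ne] by (simp only: 1)
    next
      case 2
      then have "x i \<noteq> x 0" using x[OF True] by simp
      then show ?thesis using True 2 by simp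
    next
      case 3
      have "k \<le> i" using mon[of i k] k 3 by (cases "k \<le> i") auto
      then have ex: "\<exists>j\<le>i. x j \<noteq> x 0" using x[OF k(1)] k(2) by blast
      have e: "\<not> x i \<noteq> x 0" using x[OF True] 3 by simp
      show ?thesis unfolding if_P[OF True] if_not_P[OF e] if_P[OF ex] by (simp only: 3)
    qed
  qed
qed

section \<open>The stratified map determined by an inverse pair\<close>

context
  fixes v w s t
  assumes v: "v \<in> Simp A 1" and w: "w \<in> Simp A 1"
    and s: "tri A s v w (Act A 1 1 (vop 0) v)" and t: "tri A t w v (Act A 1 1 (vop 1) v)"
begin

lemma s_facts: "s \<in> Thin A 2" "s \<in> Simp A 2" "Act A 1 2 (face 2 2) s = v" "Act A 1 2 (face 2 0) s = w"
   "Act A 1 2 (face 2 1) s = Act A 1 1 (vop 0) v"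
  using s Thin_Simp unfolding tri_def by auto

lemma t_facts: "t \<in> Thin A 2" "t \<in> Simp A 2" "Act A 1 2 (face 2 2) t = w" "Act A 1 2 (face 2 0) t = v"
   "Act A 1 2 (face 2 1) t = Act A 1 1 (vop 1) v"
  using t Thin_Simp unfolding tri_def by auto

text \<open>This amounts to well-definedness: different operators, acting on either generator, may
  produce the same word, and the prescribed edges of s and t make their values coincide.\<close>

lemma E2_map_mpm:
  assumes a: "\<alpha> \<in> ops m 2"
  shows "E2_map v w s t m (actE m 2 \<alpha> mpm) = Act A m 2 \<alpha> s"
proof -
  define x where "x = actE m 2 \<alpha> mpm"
  have x: "x i \<longleftrightarrow> i \<le> m \<and> \<alpha> i = 1" for i by (auto simp: x_def actE_def mpm_def)
  have mon: "\<alpha> i \<le> \<alpha> j" if "i \<le> j" "j \<le> m" for i j using a that by (simp add: ops_def)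
  have z: "\<alpha> i = 0" if "\<not> i \<le> m" for i using a that by (simp add: ops_def)
  from a have "E2_map v w s t m x = Act A m 2 \<alpha> s"
  proof (cases rule: ops2_cases)
    case (no1 \<beta>)
    then have xF: "x = (\<lambda>_. False)" using x by auto
    have "opcomp m \<beta> (vop 0) = (\<lambda>_. 0)" by (auto simp: opcomp_def vop_def)
    then have "Act A m 1 \<beta> (Act A 1 1 (vop 0) v) = Act A m 1 (\<lambda>_. 0) v"
      using Act_opcomp[OF vop_in_ops[of 0 1] no1(1) v] by simp
    then have "Act A m 2 \<alpha> s = Act A m 1 (\<lambda>_. 0) v"
      using Act_factor[OF no1(1) face2_in_ops(2) s_facts(2) no1(2) s_facts(5)] by simp
    then show ?thesis by (simp add: E2_map_def nondec_def xF)
  next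
    case (no0 \<beta>)
    have nd: "nondec m (\<lambda>i. \<not> x i)"
      unfolding nondec_def
    proof (intro allI impI)
      fix i j assume ij: "i \<le> j \<and> j \<le> m" "\<not> x i"
      then have "\<alpha> i \<noteq> 1" "\<alpha> i \<noteq> 0" using x no0(4) by auto
      then show "\<not> x j" using mon[of i j] ij x by auto
    qed
    have b: "\<beta> = (\<lambda>i. if i \<le> m \<and> \<not> x i then 1 else 0)" unfolding no0(3) x by auto
    have eq: "Act A m 2 \<alpha> s = Act A m 1 \<beta> w"
      by (rule Act_factor[OF no0(1) face2_in_ops(1) s_facts(2) no0(2) s_facts(4)])
    show ?thesis
    proof (cases "nondec m x")
      case True
      obtain k where k: "k \<le> m" "\<alpha> k = 1" using no0(5) by blast
      have all: "\<alpha> i = 1" if "i \<le> m" for i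
      proof (cases "k \<le> i")
        case True then show ?thesis using \<open>nondec m x\<close> that k x unfolding nondec_def by blast
      next
        case False
        then have "\<alpha> i \<le> 1" using mon[of i k] k by simp
        then show ?thesis using no0(4)[OF that] by simp
      qed
      \<comment> \<open>A constant word + is evaluated through v, so here the vertex 1 of s has to
        be reached along the edge v instead of w.\<close>
      have 0: "\<alpha> = opcomp m (\<lambda>i. if i \<le> m then 1 else 0) (face 2 2)"
        using all z by (auto simp: opcomp_def face_def fun_eq_iff)
      have "Act A m 2 \<alpha> s = Act A m 1 (\<lambda>i. if i \<le> m then 1 else 0) v"
        by (rule Act_factor[OF _ face2_in_ops(3) s_facts(2) 0[symmetric] s_facts(3)]) (auto simp: ops_def)
      moreover have "(\<lambda>i. if i \<le> m \<and> x i then 1 else 0) = (\<lambda>i. if i \<le> m then 1 else 0 :: nat)" using x all by auto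
      ultimately show ?thesis using True by (simp add: E2_map_def)
    next
      case False then show ?thesis using nd eq b by (simp add: E2_map_def)
    qed
  next
    case no2
    have nd: "nondec m x"
      unfolding nondec_def
    proof (intro allI impI)
      fix i j assume ij: "i \<le> j \<and> j \<le> m" "x i"
      have "\<alpha> j \<le> 2" "\<alpha> j \<noteq> 2" using a ij no2(3) by (auto simp: ops_def)
      then show "x j" using mon[of i j] ij x by auto
    qed
    have "\<alpha> = (\<lambda>i. if i \<le> m \<and> x i then 1 else 0)"
    proof
      fix i
      have "\<alpha> i \<le> 1 \<or> \<not> i \<le> m" using no2(1) by (auto simp: ops_def)
      then consider "i \<le> m" "\<alpha> i = 0" | "i \<le> m" "\<alpha> i = 1" | "\<not> i \<le> m" "\<alpha> i = 0" using z[of i] by linarith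
      then show "\<alpha> i = (if i \<le> m \<and> x i then 1 else 0)" by cases (simp_all add: x[of i])
    qed
    then show ?thesis using nd Act_factor[OF no2(1) face2_in_ops(3) s_facts(2) no2(2) s_facts(3)] by (simp add: E2_map_def)
  next
    case all
    obtain i0 i1 i2 where i: "i0 \<le> m" "\<alpha> i0 = 0" "i1 \<le> m" "\<alpha> i1 = 1" "i2 \<le> m" "\<alpha> i2 = 2" using all by blast
    have "i0 \<le> i1" using mon[of i1 i0] i by (cases "i0 \<le> i1") auto
    moreover have "i1 \<le> i2" using mon[of i2 i1] i by (cases "i1 \<le> i2") auto
    ultimately have nn: "\<not> nondec m x" "\<not> nondec m (\<lambda>i. \<not> x i)"
      unfolding nondec_def using i x by (metis numeral_eq_one_iff semiring_norm(85), metis zero_neq_one)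
    have x0: "\<not> x 0" using mon[of 0 i0] i x by auto
    show ?thesis using nn x0 ops2_recover[OF a all(1) _ all(2), of x] x by (simp add: E2_map_def)
  qed
  then show ?thesis by (simp add: x_def)
qed

lemma E2_map_pmp:
  assumes a: "\<alpha> \<in> ops m 2"
  shows "E2_map v w s t m (actE m 2 \<alpha> pmp) = Act A m 2 \<alpha> t"
proof -
  define x where "x = actE m 2 \<alpha> pmp"
  have le: "\<alpha> i \<le> 2" if "i \<le> m" for i using a that by (simp add: ops_def)
  have x: "x i \<longleftrightarrow> i \<le> m \<and> \<alpha> i \<noteq> 1" for i using le[of i] by (auto simp: x_def actE_def pmp_def)
  have mon: "\<alpha> i \<le> \<alpha> j" if "i \<le> j" "j \<le> m" for i j using a that by (simp add: ops_def)
  have z: "\<alpha> i = 0" if "\<not> i \<le> m" for i using a that by (simp add: ops_def)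
  from a have "E2_map v w s t m x = Act A m 2 \<alpha> t"
  proof (cases rule: ops2_cases)
    case (no1 \<beta>)
    then have xT: "x = (\<lambda>i. i \<le> m)" using x by auto
    have "\<beta> i \<le> 1" if "i \<le> m" for i using no1(1) that by (simp add: ops_def)
    then have "opcomp m \<beta> (vop 1) = (\<lambda>i. if i \<le> m then 1 else 0)" by (auto simp: opcomp_def vop_def fun_eq_iff)
    then have "Act A m 1 \<beta> (Act A 1 1 (vop 1) v) = Act A m 1 (\<lambda>i. if i \<le> m then 1 else 0) v"
      using Act_opcomp[OF vop_in_ops[of 1 1] no1(1) v] by simp
    then have "Act A m 2 \<alpha> t = Act A m 1 (\<lambda>i. if i \<le> m then 1 else 0) v"
      using Act_factor[OF no1(1) face2_in_ops(2) t_facts(2) no1(2) t_facts(5)] by simp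
    then show ?thesis by (simp add: E2_map_def nondec_def xT)
  next
    case (no0 \<beta>)
    have nd: "nondec m x"
      unfolding nondec_def
    proof (intro allI impI)
      fix i j assume ij: "i \<le> j \<and> j \<le> m" "x i"
      then have "\<alpha> i \<noteq> 1" "\<alpha> i \<noteq> 0" using x no0(4) by auto
      then show "x j" using mon[of i j] ij x by auto
    qed
    have b: "\<beta> = (\<lambda>i. if i \<le> m \<and> x i then 1 else 0)" unfolding no0(3) x by auto
    have eq: "Act A m 2 \<alpha> t = Act A m 1 \<beta> v"
      by (rule Act_factor[OF no0(1) face2_in_ops(1) t_facts(2) no0(2) t_facts(4)])
    show ?thesis using nd eq b by (simp add: E2_map_def)
  next
    case no2
    obtain i0 i1 where i: "i0 \<le> m" "\<alpha> i0 = 0" "i1 \<le> m" "\<alpha> i1 = 1" using no2(4,5) by blast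
    have "i0 \<le> i1" using mon[of i1 i0] i by (cases "i0 \<le> i1") auto
    then have nn: "\<not> nondec m x" unfolding nondec_def using i x by (metis zero_neq_one)
    have nd: "nondec m (\<lambda>i. \<not> x i)"
      unfolding nondec_def
    proof (intro allI impI)
      fix i j assume ij: "i \<le> j \<and> j \<le> m" "\<not> x i"
      have "\<alpha> j \<le> 2" "\<alpha> j \<noteq> 2" using a ij no2(3) by (auto simp: ops_def)
      then show "\<not> x j" using mon[of i j] ij x by auto
    qed
    have "\<alpha> = (\<lambda>i. if i \<le> m \<and> \<not> x i then 1 else 0)"
    proof
      fix i
      have "\<alpha> i \<le> 1 \<or> \<not> i \<le> m" using no2(1) by (auto simp: ops_def)
      then consider "i \<le> m" "\<alpha> i = 0" | "i \<le> m" "\<alpha> i = 1" | "\<not> i \<le> m" "\<alpha> i = 0" using z[of i] by linarith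
      then show "\<alpha> i = (if i \<le> m \<and> \<not> x i then 1 else 0)" by cases (simp_all add: x[of i])
    qed
    then show ?thesis using nd nn Act_factor[OF no2(1) face2_in_ops(3) t_facts(2) no2(2) t_facts(3)] by (simp add: E2_map_def)
  next
    case all
    obtain i0 i1 i2 where i: "i0 \<le> m" "\<alpha> i0 = 0" "i1 \<le> m" "\<alpha> i1 = 1" "i2 \<le> m" "\<alpha> i2 = 2" using all by blast
    have "i0 \<le> i1" using mon[of i1 i0] i by (cases "i0 \<le> i1") auto
    moreover have "i1 \<le> i2" using mon[of i2 i1] i by (cases "i1 \<le> i2") auto
    ultimately have nn: "\<not> nondec m x" "\<not> nondec m (\<lambda>i. \<not> x i)"
      unfolding nondec_def using i x by (metis zero_neq_one, metis numeral_eq_one_iff semiring_norm(85))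
    have x0: "x 0" using mon[of 0 i0] i x by auto
    show ?thesis using nn x0 ops2_recover[OF a all(1) _ all(2), of x] x by (simp add: E2_map_def)
  qed
  then show ?thesis by (simp add: x_def)
qed

text \<open>An operator from [m] to [2] with m > 1 is the identity of [2] or repeats a
  vertex.\<close>

lemma thin_dim2:
  assumes "u \<in> Thin A 2" "1 < m" "\<alpha> \<in> ops m 2"
  shows "Act A m 2 \<alpha> u \<in> Thin A m"
proof -
  have uS: "u \<in> Simp A 2" by (rule Thin_Simp[OF assms(1)])
  have aO: "\<alpha> \<in> Ops m" using assms(3) by (simp add: ops_eq_Ops)
  show ?thesis
  proof (cases "inj_on \<alpha> {0..m}")
    case True
    have "card {0..m} \<le> card {0..2::nat}" using image_ops_le[OF assms(3)] True by (intro card_inj_on_le) auto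
    then have m: "m = 2" using assms(2) by simp
    have "\<alpha> ` {0..2} = {0..2}"
      using True image_ops_le[OF assms(3)] unfolding m by (intro card_subset_eq) (auto simp: card_image)
    moreover have "idop 2 ` {0..2} = {0..2}" "inj_on (idop 2) {0..2}" "idop 2 \<in> Ops 2"
      by (auto simp: idop_def Ops_def inj_on_def)
    ultimately have "\<alpha> = idop 2" using inj_Ops_unique[of \<alpha> m "idop 2" 2] aO True m by simp
    then show ?thesis using m Act_id[OF uS] assms(1) by simp
  next
    case False
    then obtain i where i: "i < m" "\<alpha> (Suc i) = \<alpha> i" using repeat_if_not_inj[OF aO] by blast
    show ?thesis
    proof (rule thin_if_repeat[OF Act_in[OF assms(3) uS] i(1)])
      show "Act A m m (repeat_op m i) (Act A m 2 \<alpha> u) = Act A m 2 \<alpha> u"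
        using Act_opcomp[OF assms(3) repeat_op_in_ops[OF i(1)] uS] unfolding opcomp_repeat_op[OF aO i(2,1)] by (rule sym)
    qed
  qed
qed

lemma strat_map_E2_map:
  "strat_map th1E2 A (E2_map v w s t)" "E2_map v w s t 1 e1minus = v"
proof -
  let ?f = "E2_map v w s t"
  \<comment> \<open>Each simplex arises from one of the generating words, on which the map is the
    action on s or t. Naturality and thinness above dimension 1 then follow without inspecting
    words.\<close>
  have form: "\<exists>\<alpha> u p. \<alpha> \<in> ops m 2 \<and> u \<in> Thin A 2 \<and> x = actE m 2 \<alpha> p \<and> (\<forall>k. \<forall>\<beta>\<in>ops k 2. ?f k (actE k 2 \<beta> p) = Act A k 2 \<beta> u)"
    if "x \<in> Simp E2 m" for x m
    using that E2_map_mpm E2_map_pmp s_facts(1) t_facts(1) unfolding Simp_E2 by blast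
  have Sf: "?f m x \<in> Simp A m" if "x \<in> Simp E2 m" for m x
    using form[OF that] Act_in Thin_Simp by metis
  have nat: "?f m (actE m n \<beta> x) = Act A m n \<beta> (?f n x)" if bx: "\<beta> \<in> ops m n" "x \<in> Simp E2 n" for m n \<beta> x
  proof -
    obtain \<alpha> u p where p: "\<alpha> \<in> ops n 2" "u \<in> Thin A 2" "x = actE n 2 \<alpha> p" "\<And>k \<beta>. \<beta>\<in>ops k 2 \<Longrightarrow> ?f k (actE k 2 \<beta> p) = Act A k 2 \<beta> u"
      using form[OF bx(2)] by blast
    have "?f m (actE m n \<beta> x) = ?f m (actE m 2 (opcomp m \<beta> \<alpha>) p)" unfolding p(3) actE_actE[OF bx(1)] ..
    also have "\<dots> = Act A m 2 (opcomp m \<beta> \<alpha>) u" by (rule p(4)[OF ops_opcomp[OF p(1) bx(1)]])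
    also have "\<dots> = Act A m n \<beta> (Act A n 2 \<alpha> u)" by (rule Act_opcomp[OF p(1) bx(1) Thin_Simp[OF p(2)]])
    also have "Act A n 2 \<alpha> u = ?f n x" unfolding p(3) by (rule p(4)[OF p(1), symmetric])
    finally show ?thesis .
  qed
  have thin: "?f m x \<in> Thin A m" if x: "x \<in> Simp E2 m" "degenerate E2 m x \<or> 1 < m" for m x
  proof (cases "1 < m")
    case True
    obtain \<alpha> u p where p: "\<alpha> \<in> ops m 2" "u \<in> Thin A 2" "x = actE m 2 \<alpha> p" "\<And>k \<beta>. \<beta>\<in>ops k 2 \<Longrightarrow> ?f k (actE k 2 \<beta> p) = Act A k 2 \<beta> u"
      using form[OF x(1)] by blast
    show ?thesis unfolding p(3) p(4)[OF p(1)] by (rule thin_dim2[OF p(2) True p(1)])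
  next
    case False
    then obtain l \<sigma> y where y: "l < m" "\<sigma> \<in> ops m l" "\<sigma> ` {0..m} = {0..l}" "y \<in> Simp E2 l" "x = actE m l \<sigma> y"
      using x(2) unfolding degenerate_def Act_E2 by blast
    have "?f m x = Act A m l \<sigma> (?f l y)" unfolding y(5) by (rule nat[OF y(2,4)])
    then have "degenerate A m (?f m x)" unfolding degenerate_def using y(1-3) Sf[OF y(4)] by blast
    then show ?thesis using strat Sf[OF x(1)] unfolding stratified_set_def by blast
  qed
  show "strat_map th1E2 A ?f"
    unfolding strat_map_def using Sf nat thin by (simp add: th1E2_def)
  have "actE 1 2 (face 2 2) mpm = e1minus"
    by (auto simp: actE_def face_def mpm_def e1minus_def fun_eq_iff)
  then show "?f 1 e1minus = v" using E2_map_mpm[OF face2_in_ops(3)] s_facts(3) by simp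
qed

end

lemma is_equiv_iff_th1E2:
  "is_equiv A v \<longleftrightarrow> (\<exists>f. strat_map th1E2 A f \<and> f 1 e1minus = v)"
proof
  assume "is_equiv A v"
  then obtain w s t where "v \<in> Simp A 1" "w \<in> Simp A 1"
    "tri A s v w (Act A 1 1 (vop 0) v)" "tri A t w v (Act A 1 1 (vop 1) v)"
    unfolding is_equiv_def by blast
  from strat_map_E2_map[OF this] show "\<exists>f. strat_map th1E2 A f \<and> f 1 e1minus = v" by blast
next
  assume "\<exists>f. strat_map th1E2 A f \<and> f 1 e1minus = v"
  then show "is_equiv A v" using is_equiv_if_th1E2 by blast
qed

end

theorem mainTheorem8:
  fixes A :: "'a strat"
  assumes strat: "stratified_set A"
    and inner1: "\<forall>n k. 0 < k \<and> k < n \<longrightarrow> rlp A (HornK n k) (DeltaK n k)"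
    and inner2: "\<forall>n k. 2 \<le> n \<and> 0 < k \<and> k < n \<and> (n, k) \<noteq> (2, 1) \<longrightarrow>
                   rlp A (DeltaK' n k) (DeltaK'' n k)"
    and thin1: "\<forall>v. v \<in> Thin A 1 \<longleftrightarrow>
                   v \<in> Simp A 1 \<and> (\<exists>f. strat_map th1E2 A f \<and> f 1 e1minus = v)"
  shows "weak_complicial A"
proof -
  interpret stratified A by unfold_locales fact
  have "v \<in> Thin A 1 \<longleftrightarrow> is_equiv A v" for v
    using thin1[rule_format, of v] is_equiv_iff_th1E2[of v] unfolding is_equiv_def by blast
  then interpret inner_complicial_equiv A using inner1 inner2 by unfold_locales blast+
  show ?thesis by (rule weak_complicial)
qed

end
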